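(* Let $M$ be a simply laced spherical Coxeter diagram with Weyl group $W$, and let $\mathcal B$ be an admissible $W$-orbit of sets of mutually orthogonal positive roots. Then there exists a partial order $<$ on $\mathcal B$ with a unique maximal element $B_0$ for which the construction described in the context is well defined and for which the assignment $s_i\mapsto\tau_i$ ($i$ a node of $M$) extends to a homomorphism of monoids $A^+\to\operatorname{End}_Z(V)$. Here "well defined" means: for every $B\ne B_0$ there is a node $j$ with $B<r_jB$; for every $B\in\mathcal B$ and node $i$ with $\alpha_i\notin B\cup B^\perp$ the sets $B$ and $r_iB$ are distinct and comparable; and for every $B\in\mathcal B$ and node $i$ with $\alpha_i\in B^\perp$, all words $v\in V(B,i)$ give the same image of $v^{-1}s_iv$ in $H$, and this element $h_{B,i}$ lies in $Z$.
   Context: Let $M$ be a spherical simply laced Coxeter diagram (each connected component of type A, D or E) with nodes $1,\dots,n$; for distinct nodes write $i\sim j$ if they are joined by an edge and $i\not\sim j$ otherwise. Let $(W,R)$, $R=\{r_1,\dots,r_n\}$, be the Coxeter system of type $M$, with root system $\Phi$, positive roots $\Phi^+$, fundamental roots $\alpha_1,\dots,\alpha_n$, $r_i$ the reflection in $\alpha_i$, and invariant inner product with $(\alpha_i,\alpha_i)=2$, $(\alpha_i,\alpha_j)=-1$ if $i\sim j$ and $0$ otherwise. For a set $B$ of mutually orthogonal positive roots and $w\in W$ put $wB=\Phi^+\cap\{\pm w\beta:\beta\in B\}$ (so e.g. $r_i\{\alpha_i\}=\{\alpha_i\}$); $B^\perp$ is the set of roots orthogonal to every element of $B$. A $W$-orbit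 $\mathcal B$ of such sets is admissible if for every $B\in\mathcal B$, all nodes $i,j$ with $i\not\sim j$ and every root $\gamma$ with $\gamma,\gamma-\alpha_i+\alpha_j\in B$, we have $r_iB=r_jB$. The Artin group $A$ of type $M$ has generators $s_1,\dots,s_n$ and relations $s_is_js_i=s_js_is_j$ if $i\sim j$, $s_is_j=s_js_i$ if $i\not\sim j$; $A^+$ is the monoid with the same presentation. Let $m$ be an indeterminate and $H$ the Hecke algebra of type $M$ over $\mathbb Q(m)$, the quotient of the group algebra $\mathbb Q(m)[A]$ by the relations $s_i^2=1-ms_i$. Given a partial order $<$ on $\mathcal B$ with unique maximal element $B_0$: let $C$ be the set of nodes $i$ with $\alpha_i\in B_0^\perp$ and $Z$ the subalgebra of $H$ generated by the $s_i$, $i\in C$ (the Hecke algebra of type $C$). For $B\in\mathcal B$ and a node $i$ with $\alpha_i\in B^\perp$, let $V(B,i)\subseteq A$ be defined inductively (smallest family of sets satisfying): $1\in V(B_0,i)$; if $j$ is a node with $B<r_jB$ and $j\not\sim i$, then $s_jv\in V(B,i)$ for every $v\in V(r_jB,i)$; if $j$ is a node with $B<r_jB$ and $j\sim i$, then $s_js_iv\in V(B,i)$ for every $v\in V(r_ir_jB,j)$. Set $h_{B,i}$ = image of $v^{-1}s_iv$ in $H$ for $v\in V(B,i)$. Let $V$ be the free right $Z$-module with basis $\{x_B: B\in\mathcal B\}$, and define the right $Z$-linear map $\tau_i$ on $V$ by: $\tau_ix_B=0$ if $\alpha_i\in B$; $\tau_ix_B=x_Bh_{B,i}$ if $\alpha_i\in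 B^\perp$; $\tau_ix_B=x_{r_iB}$ if $r_iB<B$; $\tau_ix_B=x_{r_iB}-mx_B$ if $r_iB>B$. *)

theory Defs
  imports Main "HOL-Computational_Algebra.Polynomial" "HOL-Computational_Algebra.Fraction_Field"
begin

text \<open>Nodes are 0..n-1; adj i j means i and j are joined by an edge.
 Roots are integer coefficient vectors w.r.t. the fundamental roots (type vec).\<close>

type_synonym vec = "nat \<Rightarrow> int"

definition gram :: "(nat \<Rightarrow> nat \<Rightarrow> bool) \<Rightarrow> nat \<Rightarrow> nat \<Rightarrow> int" where
  "gram adj i j = (if i = j then 2 else if adj i j then -1 else 0)"

definition ip :: "nat \<Rightarrow> (nat \<Rightarrow> nat \<Rightarrow> bool) \<Rightarrow> vec \<Rightarrow> vec \<Rightarrow> int" where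
  "ip n adj x y = (\<Sum>i<n. \<Sum>j<n. x i * y j * gram adj i j)"

definition fund :: "nat \<Rightarrow> vec" where
  "fund i = (\<lambda>k. if k = i then 1 else 0)"

definition refl :: "nat \<Rightarrow> (nat \<Rightarrow> nat \<Rightarrow> bool) \<Rightarrow> nat \<Rightarrow> vec \<Rightarrow> vec" where
  "refl n adj i x = (\<lambda>k. x k - ip n adj x (fund i) * fund i k)"

definition weyl :: "nat \<Rightarrow> (nat \<Rightarrow> nat \<Rightarrow> bool) \<Rightarrow> (vec \<Rightarrow> vec) set" where
  "weyl n adj = {foldr (\<circ>) (map (refl n adj) w) id | w. set w \<subseteq> {..<n}}"

definition coxeter_diagram :: "nat \<Rightarrow> (nat \<Rightarrow> nat \<Rightarrow> bool) \<Rightarrow> bool" where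
  "coxeter_diagram n adj \<longleftrightarrow> (\<forall>i<n. \<forall>j<n. adj i j \<longleftrightarrow> adj j i) \<and> (\<forall>i<n. \<not> adj i i)"

text \<open>Simply laced (encoded by adj) and spherical (finite Weyl group).\<close>
definition spherical_simply_laced :: "nat \<Rightarrow> (nat \<Rightarrow> nat \<Rightarrow> bool) \<Rightarrow> bool" where
  "spherical_simply_laced n adj \<longleftrightarrow> coxeter_diagram n adj \<and> finite (weyl n adj)"

definition roots :: "nat \<Rightarrow> (nat \<Rightarrow> nat \<Rightarrow> bool) \<Rightarrow> vec set" where
  "roots n adj = {f (fund i) | f i. f \<in> weyl n adj \<and> i < n}"

definition pos_roots :: "nat \<Rightarrow> (nat \<Rightarrow> nat \<Rightarrow> bool) \<Rightarrow> vec set" where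
  "pos_roots n adj = {x \<in> roots n adj. \<forall>k. 0 \<le> x k}"

definition orth_set :: "nat \<Rightarrow> (nat \<Rightarrow> nat \<Rightarrow> bool) \<Rightarrow> vec set \<Rightarrow> bool" where
  "orth_set n adj B \<longleftrightarrow> B \<subseteq> pos_roots n adj \<and>
     (\<forall>\<beta>\<in>B. \<forall>\<gamma>\<in>B. \<beta> \<noteq> \<gamma> \<longrightarrow> ip n adj \<beta> \<gamma> = 0)"

definition wact :: "nat \<Rightarrow> (nat \<Rightarrow> nat \<Rightarrow> bool) \<Rightarrow> (vec \<Rightarrow> vec) \<Rightarrow> vec set \<Rightarrow> vec set" where
  "wact n adj f B = {\<gamma> \<in> pos_roots n adj. \<exists>\<beta>\<in>B. \<gamma> = f \<beta> \<or> \<gamma> = (\<lambda>k. - f \<beta> k)}"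

definition ract :: "nat \<Rightarrow> (nat \<Rightarrow> nat \<Rightarrow> bool) \<Rightarrow> nat \<Rightarrow> vec set \<Rightarrow> vec set" where
  "ract n adj i B = wact n adj (refl n adj i) B"

definition perp :: "nat \<Rightarrow> (nat \<Rightarrow> nat \<Rightarrow> bool) \<Rightarrow> vec set \<Rightarrow> vec set" where
  "perp n adj B = {x \<in> roots n adj. \<forall>\<beta>\<in>B. ip n adj x \<beta> = 0}"

definition orbit :: "nat \<Rightarrow> (nat \<Rightarrow> nat \<Rightarrow> bool) \<Rightarrow> vec set \<Rightarrow> vec set set" where
  "orbit n adj B = {wact n adj f B | f. f \<in> weyl n adj}"

definition admissible :: "nat \<Rightarrow> (nat \<Rightarrow> nat \<Rightarrow> bool) \<Rightarrow> vec set set \<Rightarrow> bool" where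
  "admissible n adj BB \<longleftrightarrow>
     (\<exists>B. orth_set n adj B \<and> BB = orbit n adj B) \<and>
     (\<forall>B\<in>BB. \<forall>i<n. \<forall>j<n. i \<noteq> j \<longrightarrow> \<not> adj i j \<longrightarrow>
        (\<forall>\<gamma>. \<gamma> \<in> B \<longrightarrow> (\<lambda>k. \<gamma> k - fund i k + fund j k) \<in> B \<longrightarrow>
             ract n adj i B = ract n adj j B))"

type_synonym K = "rat poly fract"

definition m_ind :: K where "m_ind = Fract [:0, 1:] 1"

text \<open>Letters (j, True) = s_j and (j, False) = s_j^{-1}.  Elements of the free
 associative algebra over K on these letters are coefficient functions on words
 (only finitely supported ones occur).  The group algebra Q(m)[A] is this free
 algebra modulo inverse and braid relations; H is the further quotient by the
 quadratic relations.\<close>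
type_synonym letter = "nat \<times> bool"
type_synonym fa = "letter list \<Rightarrow> K"

definition fa_zero :: fa where "fa_zero = (\<lambda>_. 0)"
definition mono :: "letter list \<Rightarrow> fa" where "mono w = (\<lambda>u. if u = w then 1 else 0)"
definition fa_add :: "fa \<Rightarrow> fa \<Rightarrow> fa" where "fa_add x y = (\<lambda>w. x w + y w)"
definition fa_diff :: "fa \<Rightarrow> fa \<Rightarrow> fa" where "fa_diff x y = (\<lambda>w. x w - y w)"
definition fa_scal :: "K \<Rightarrow> fa \<Rightarrow> fa" where "fa_scal c x = (\<lambda>w. c * x w)"
definition fa_mult :: "fa \<Rightarrow> fa \<Rightarrow> fa" where
  "fa_mult x y = (\<lambda>w. \<Sum>k\<in>{0..length w}. x (take k w) * y (drop k w))"

definition letters :: "nat \<Rightarrow> letter set" where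
  "letters n = {(j, b) | j b. j < n}"

definition sg :: "nat \<Rightarrow> letter" where "sg j = (j, True)"
definition sginv :: "nat \<Rightarrow> letter" where "sginv j = (j, False)"

definition hecke_rels :: "nat \<Rightarrow> (nat \<Rightarrow> nat \<Rightarrow> bool) \<Rightarrow> fa set" where
  "hecke_rels n adj =
     {fa_diff (mono [sg j, sginv j]) (mono []) | j. j < n} \<union>
     {fa_diff (mono [sginv j, sg j]) (mono []) | j. j < n} \<union>
     {fa_diff (mono [sg i, sg j, sg i]) (mono [sg j, sg i, sg j]) | i j. i < n \<and> j < n \<and> adj i j} \<union>
     {fa_diff (mono [sg i, sg j]) (mono [sg j, sg i]) | i j. i < n \<and> j < n \<and> i \<noteq> j \<and> \<not> adj i j} \<union>
     {fa_add (fa_diff (mono [sg j, sg j]) (mono [])) (fa_scal m_ind (mono [sg j])) | j. j < n}"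

inductive_set hecke_ideal :: "nat \<Rightarrow> (nat \<Rightarrow> nat \<Rightarrow> bool) \<Rightarrow> fa set"
  for n :: nat and adj :: "nat \<Rightarrow> nat \<Rightarrow> bool" where
  zero: "fa_zero \<in> hecke_ideal n adj"
| step: "x \<in> hecke_ideal n adj \<Longrightarrow> r \<in> hecke_rels n adj \<Longrightarrow> set u \<subseteq> letters n \<Longrightarrow>
         set v \<subseteq> letters n \<Longrightarrow>
         fa_add x (fa_scal c (fa_mult (fa_mult (mono u) r) (mono v))) \<in> hecke_ideal n adj"

definition heq :: "nat \<Rightarrow> (nat \<Rightarrow> nat \<Rightarrow> bool) \<Rightarrow> fa \<Rightarrow> fa \<Rightarrow> bool" where
  "heq n adj x y \<longleftrightarrow> fa_diff x y \<in> hecke_ideal n adj"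

definition inZ :: "nat \<Rightarrow> (nat \<Rightarrow> nat \<Rightarrow> bool) \<Rightarrow> nat set \<Rightarrow> fa \<Rightarrow> bool" where
  "inZ n adj C h \<longleftrightarrow> (\<exists>z. finite {w. z w \<noteq> 0} \<and>
      (\<forall>w. z w \<noteq> 0 \<longrightarrow> set w \<subseteq> sg ` C) \<and> heq n adj h z)"

definition conj_img :: "nat \<Rightarrow> nat list \<Rightarrow> fa" where
  "conj_img i v = mono (map sginv (rev v) @ [sg i] @ map sg v)"

definition Cset :: "nat \<Rightarrow> (nat \<Rightarrow> nat \<Rightarrow> bool) \<Rightarrow> vec set \<Rightarrow> nat set" where
  "Cset n adj B0 = {i. i < n \<and> fund i \<in> perp n adj B0}"

inductive inV :: "nat \<Rightarrow> (nat \<Rightarrow> nat \<Rightarrow> bool) \<Rightarrow> vec set set \<Rightarrow> (vec set \<Rightarrow> vec set \<Rightarrow> bool)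
    \<Rightarrow> vec set \<Rightarrow> vec set \<Rightarrow> nat \<Rightarrow> nat list \<Rightarrow> bool"
  for n adj BB lt B0 where
  base: "B0 \<in> BB \<Longrightarrow> i < n \<Longrightarrow> fund i \<in> perp n adj B0 \<Longrightarrow> inV n adj BB lt B0 B0 i []"
| nadj: "B \<in> BB \<Longrightarrow> i < n \<Longrightarrow> fund i \<in> perp n adj B \<Longrightarrow> j < n \<Longrightarrow> j \<noteq> i \<Longrightarrow> \<not> adj j i \<Longrightarrow>
         lt B (ract n adj j B) \<Longrightarrow> inV n adj BB lt B0 (ract n adj j B) i v \<Longrightarrow>
         inV n adj BB lt B0 B i (j # v)"
| isadj: "B \<in> BB \<Longrightarrow> i < n \<Longrightarrow> fund i \<in> perp n adj B \<Longrightarrow> j < n \<Longrightarrow> adj j i \<Longrightarrow>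
         lt B (ract n adj j B) \<Longrightarrow> inV n adj BB lt B0 (ract n adj i (ract n adj j B)) j v \<Longrightarrow>
         inV n adj BB lt B0 B i (j # i # v)"

definition hB :: "nat \<Rightarrow> (nat \<Rightarrow> nat \<Rightarrow> bool) \<Rightarrow> vec set set \<Rightarrow> (vec set \<Rightarrow> vec set \<Rightarrow> bool)
    \<Rightarrow> vec set \<Rightarrow> vec set \<Rightarrow> nat \<Rightarrow> fa" where
  "hB n adj BB lt B0 B i = conj_img i (SOME v. inV n adj BB lt B0 B i v)"

text \<open>Coefficient of x_{B'} in tau_i x_B.\<close>
definition tau_coef :: "nat \<Rightarrow> (nat \<Rightarrow> nat \<Rightarrow> bool) \<Rightarrow> vec set set \<Rightarrow> (vec set \<Rightarrow> vec set \<Rightarrow> bool)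
    \<Rightarrow> vec set \<Rightarrow> nat \<Rightarrow> vec set \<Rightarrow> vec set \<Rightarrow> fa" where
  "tau_coef n adj BB lt B0 i B B' =
    (if fund i \<in> B then fa_zero
     else if fund i \<in> perp n adj B then (if B' = B then hB n adj BB lt B0 B i else fa_zero)
     else if lt (ract n adj i B) B then (if B' = ract n adj i B then mono [] else fa_zero)
     else if lt B (ract n adj i B) then
        fa_diff (if B' = ract n adj i B then mono [] else fa_zero)
                (if B' = B then fa_scal m_ind (mono []) else fa_zero)
     else fa_zero)"

text \<open>Elements of V = free right Z-module on x_B (B in BB): f represents
  sum over B of x_B * f B.\<close>
type_synonym vm = "vec set \<Rightarrow> fa"

definition Vspace :: "nat \<Rightarrow> (nat \<Rightarrow> nat \<Rightarrow> bool) \<Rightarrow> vec set set \<Rightarrow> vec set \<Rightarrow> vm set" where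
  "Vspace n adj BB B0 = {f. (\<forall>B. B \<notin> BB \<longrightarrow> f B = fa_zero) \<and>
                             (\<forall>B\<in>BB. inZ n adj (Cset n adj B0) (f B))}"

definition veq :: "nat \<Rightarrow> (nat \<Rightarrow> nat \<Rightarrow> bool) \<Rightarrow> vec set set \<Rightarrow> vm \<Rightarrow> vm \<Rightarrow> bool" where
  "veq n adj BB f g \<longleftrightarrow> (\<forall>B\<in>BB. heq n adj (f B) (g B))"

definition tau_apply :: "nat \<Rightarrow> (nat \<Rightarrow> nat \<Rightarrow> bool) \<Rightarrow> vec set set \<Rightarrow> (vec set \<Rightarrow> vec set \<Rightarrow> bool)
    \<Rightarrow> vec set \<Rightarrow> nat \<Rightarrow> vm \<Rightarrow> vm" where
  "tau_apply n adj BB lt B0 i f =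
     (\<lambda>B'. if B' \<in> BB then
              (\<lambda>w. \<Sum>B\<in>BB. fa_mult (tau_coef n adj BB lt B0 i B B') (f B) w)
           else fa_zero)"

fun tau_word :: "nat \<Rightarrow> (nat \<Rightarrow> nat \<Rightarrow> bool) \<Rightarrow> vec set set \<Rightarrow> (vec set \<Rightarrow> vec set \<Rightarrow> bool)
    \<Rightarrow> vec set \<Rightarrow> nat list \<Rightarrow> vm \<Rightarrow> vm" where
  "tau_word n adj BB lt B0 [] f = f"
| "tau_word n adj BB lt B0 (i # w) f = tau_apply n adj BB lt B0 i (tau_word n adj BB lt B0 w f)"

inductive artin_eq :: "nat \<Rightarrow> (nat \<Rightarrow> nat \<Rightarrow> bool) \<Rightarrow> nat list \<Rightarrow> nat list \<Rightarrow> bool"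
  for n adj where
  refl: "artin_eq n adj u u"
| sym: "artin_eq n adj u v \<Longrightarrow> artin_eq n adj v u"
| trans: "artin_eq n adj u v \<Longrightarrow> artin_eq n adj v w \<Longrightarrow> artin_eq n adj u w"
| braid: "i < n \<Longrightarrow> j < n \<Longrightarrow> adj i j \<Longrightarrow> artin_eq n adj (u @ [i, j, i] @ v) (u @ [j, i, j] @ v)"
| comm: "i < n \<Longrightarrow> j < n \<Longrightarrow> i \<noteq> j \<Longrightarrow> \<not> adj i j \<Longrightarrow> artin_eq n adj (u @ [i, j] @ v) (u @ [j, i] @ v)"

definition strict_po_on :: "vec set set \<Rightarrow> (vec set \<Rightarrow> vec set \<Rightarrow> bool) \<Rightarrow> bool" where
  "strict_po_on BB lt \<longleftrightarrow> (\<forall>B\<in>BB. \<not> lt B B) \<and>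
     (\<forall>B1\<in>BB. \<forall>B2\<in>BB. \<forall>B3\<in>BB. lt B1 B2 \<longrightarrow> lt B2 B3 \<longrightarrow> lt B1 B3)"

definition unique_max :: "vec set set \<Rightarrow> (vec set \<Rightarrow> vec set \<Rightarrow> bool) \<Rightarrow> vec set \<Rightarrow> bool" where
  "unique_max BB lt B0 \<longleftrightarrow> B0 \<in> BB \<and> (\<forall>B\<in>BB. \<not> lt B0 B) \<and>
     (\<forall>B\<in>BB. (\<forall>B'\<in>BB. \<not> lt B B') \<longrightarrow> B = B0)"

definition well_defined :: "nat \<Rightarrow> (nat \<Rightarrow> nat \<Rightarrow> bool) \<Rightarrow> vec set set \<Rightarrow> (vec set \<Rightarrow> vec set \<Rightarrow> bool)
    \<Rightarrow> vec set \<Rightarrow> bool" where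
  "well_defined n adj BB lt B0 \<longleftrightarrow>
     (\<forall>B\<in>BB. B \<noteq> B0 \<longrightarrow> (\<exists>j<n. lt B (ract n adj j B))) \<and>
     (\<forall>B\<in>BB. \<forall>i<n. fund i \<notin> B \<union> perp n adj B \<longrightarrow>
        B \<noteq> ract n adj i B \<and> (lt B (ract n adj i B) \<or> lt (ract n adj i B) B)) \<and>
     (\<forall>B\<in>BB. \<forall>i<n. fund i \<in> perp n adj B \<longrightarrow>
        (\<exists>v. inV n adj BB lt B0 B i v) \<and>
        (\<forall>v v'. inV n adj BB lt B0 B i v \<longrightarrow> inV n adj BB lt B0 B i v' \<longrightarrow>
              heq n adj (conj_img i v) (conj_img i v')) \<and>
        (\<forall>v. inV n adj BB lt B0 B i v \<longrightarrow> inZ n adj (Cset n adj B0) (conj_img i v)))"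

definition extends_to_artin_hom :: "nat \<Rightarrow> (nat \<Rightarrow> nat \<Rightarrow> bool) \<Rightarrow> vec set set
    \<Rightarrow> (vec set \<Rightarrow> vec set \<Rightarrow> bool) \<Rightarrow> vec set \<Rightarrow> bool" where
  "extends_to_artin_hom n adj BB lt B0 \<longleftrightarrow>
     (\<forall>i<n. \<forall>f\<in>Vspace n adj BB B0. tau_apply n adj BB lt B0 i f \<in> Vspace n adj BB B0) \<and>
     (\<forall>u w. set u \<subseteq> {..<n} \<longrightarrow> set w \<subseteq> {..<n} \<longrightarrow> artin_eq n adj u w \<longrightarrow>
        (\<forall>f\<in>Vspace n adj BB B0.
           veq n adj BB (tau_word n adj BB lt B0 u f) (tau_word n adj BB lt B0 w f)))"

end

theory Submission
  imports Defs "HOL-Library.Function_Algebras"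
begin

text \<open>
  Order \<open>\<B>\<close> by comparing lexicographically, from height 1 upwards, the number of roots of
  each height: sets with more low roots are smaller. If \<open>r\<^sub>i\<close> moves \<open>B\<close>, the comparison of \<open>B\<close> with
  \<open>r\<^sub>iB\<close> is decided by the lowest root that is moved; ties are impossible, because a tie would produce
  a root of height 0.

  On an orbit of a rank-two parabolic subgroup this order has only a few shapes. For \<open>i \<not>\<sim> j\<close>
  admissibility forces either \<open>r\<^sub>iB = r\<^sub>jB\<close> or a square with parallel sides oriented alike. For \<open>i \<sim> j\<close>
  one finds a hexagon oriented like the weak order, a chain of three sets, a peak
  (when \<open>\<alpha>\<^sub>i + \<alpha>\<^sub>j\<close> lies in its top), or a point. Hence moving upwards is locally confluent, and Newman's
  lemma yields the unique maximal element \<open>B\<^sub>0\<close>.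

  Each clause defining \<open>V(B,i)\<close> replaces \<open>(B,i)\<close> by \<open>(r\<^sub>jB,i)\<close> or \<open>(r\<^sub>ir\<^sub>jB,j)\<close> without changing the
  conjugate \<open>v\<^sup>-\<^sup>1s\<^sub>iv\<close>. This rewriting of pairs is confluent too, so it ends in a unique \<open>(B\<^sub>0,k)\<close> and
  \<open>h\<^sub>B\<^sub>,\<^sub>i = s\<^sub>k\<close> with \<open>k \<in> C\<close>. The Artin relations for the \<open>\<tau>\<^sub>i\<close> can then be checked on each of the
  shapes above.
\<close>

text \<open>Only finiteness of \<open>W\<close> is given, so nothing is read off from the list of
  diagrams. Finiteness enters through averaging, which makes the form definite; since the lattice is
  even, every lattice vector of norm 2 then behaves like a root: constant sign, nonzero height,
  inner product at most 1 with any other. Membership among them is an inner product computation, so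
  sums and differences of roots can be tested directly.

  The order is global, yet the relations concern single edges from \<open>B\<close> to
  \<open>act i B\<close>. The predicate \<open>up\<close> records their direction locally. The
  condition on pairs of roots in an admissible orbit is invoked once, in \<open>up_comm\<close>: it
  prevents a commuting reflection from reversing an edge.

  Each \<open>h\<close> is at first only a conjugate in \<open>H\<close>. Once it is identified with
  a single generator, the coefficients reduce to left multiplication by generators, and the question
  left about them is how \<open>kap\<close> treats adjacent and nonadjacent nodes. The quadratic
  relation is needed only at the bottom of a chain of three sets, where a multiple of
  \<open>s^2 - 1 + m s\<close> is left over.\<close>

locale simply_laced =
  fixes n :: nat and adj :: "nat \<Rightarrow> nat \<Rightarrow> bool"
  assumes spherical: "spherical_simply_laced n adj"
begin

section \<open>The bilinear form and the simple reflections\<close>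

abbreviation inner :: "vec \<Rightarrow> vec \<Rightarrow> int" (infixl "\<bullet>" 70) where
  "x \<bullet> y \<equiv> ip n adj x y"

abbreviation ref :: "nat \<Rightarrow> vec \<Rightarrow> vec" where
  "ref i \<equiv> refl n adj i"

lemma adj_sym: "i < n \<Longrightarrow> j < n \<Longrightarrow> adj i j \<Longrightarrow> adj j i"
  and adj_irrefl: "i < n \<Longrightarrow> \<not> adj i i"
  and finite_weyl: "finite (weyl n adj)"
  using spherical by (auto simp: spherical_simply_laced_def coxeter_diagram_def)

lemma gram_sym: "i < n \<Longrightarrow> j < n \<Longrightarrow> gram adj i j = gram adj j i"
  using adj_sym by (auto simp: gram_def)

lemma ip_sym: "x \<bullet> y = y \<bullet> x"
  unfolding ip_def
  by (subst sum.swap) (intro sum.cong refl, auto simp: gram_sym)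

lemma ip_add_scaled_left: "(\<lambda>k. x k + c * y k) \<bullet> z = x \<bullet> z + c * (y \<bullet> z)"
  by (simp add: ip_def algebra_simps sum.distrib sum_distrib_left)

lemma ip_add_left [simp]: "(x + y) \<bullet> z = x \<bullet> z + y \<bullet> z"
  by (simp add: ip_def algebra_simps sum.distrib)

lemma ip_diff_left [simp]: "(x - y) \<bullet> z = x \<bullet> z - y \<bullet> z"
  by (simp add: ip_def algebra_simps sum_subtractf fun_diff_def)

lemma ip_minus_left [simp]: "(- x) \<bullet> z = - (x \<bullet> z)"
  by (simp add: ip_def sum_negf)

lemma ip_add_right [simp]: "z \<bullet> (x + y) = z \<bullet> x + z \<bullet> y"
  and ip_diff_right [simp]: "z \<bullet> (x - y) = z \<bullet> x - z \<bullet> y"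
  and ip_minus_right [simp]: "z \<bullet> (- x) = - (z \<bullet> x)"
  using ip_sym[of z] by simp_all

lemma ip_fund_right: "i < n \<Longrightarrow> x \<bullet> fund i = (\<Sum>k<n. x k * gram adj k i)"
  by (simp add: ip_def fund_def mult.assoc if_distrib[of "\<lambda>t. _ * t"] if_distrib[of "\<lambda>t. t * _"] cong: if_cong)

lemma ip_fund_fund: "i < n \<Longrightarrow> j < n \<Longrightarrow> fund i \<bullet> fund j = gram adj i j"
  by (simp add: ip_fund_right) (simp add: fund_def if_distrib[of "\<lambda>t. t * _"] cong: if_cong)

lemma ip_fund_self [simp]: "i < n \<Longrightarrow> fund i \<bullet> fund i = 2"
  by (simp add: ip_fund_fund gram_def)

lemma ip_fund_adj: "i < n \<Longrightarrow> j < n \<Longrightarrow> adj i j \<Longrightarrow> fund i \<bullet> fund j = -1"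
  using adj_irrefl by (auto simp: ip_fund_fund gram_def)

lemma ip_fund_nonadj: "i < n \<Longrightarrow> j < n \<Longrightarrow> i \<noteq> j \<Longrightarrow> \<not> adj i j \<Longrightarrow> fund i \<bullet> fund j = 0"
  by (simp add: ip_fund_fund gram_def)

lemma ip_expand: "x \<bullet> y = (\<Sum>k<n. y k * (x \<bullet> fund k))"
  unfolding ip_def[of _ _ x y]
  by (subst sum.swap) (simp add: ip_fund_right sum_distrib_left mult.assoc mult.left_commute)

lemma ref_eq: "ref i x = (\<lambda>k. x k + (- (x \<bullet> fund i)) * fund i k)"
  by (simp add: refl_def)

lemma ip_ref_left: "ref i x \<bullet> y = x \<bullet> y - (x \<bullet> fund i) * (fund i \<bullet> y)"
  unfolding ref_eq ip_add_scaled_left by simp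

lemma ip_ref_right: "x \<bullet> ref i y = x \<bullet> y - (y \<bullet> fund i) * (x \<bullet> fund i)"
  using ip_ref_left[of i y x] by (simp add: ip_sym)

lemma ip_ref_ref: "i < n \<Longrightarrow> ref i x \<bullet> ref i y = x \<bullet> y"
  using ip_sym[of "fund i" y] by (simp add: ip_ref_left ip_ref_right algebra_simps)

lemma ref_ref [simp]: "i < n \<Longrightarrow> ref i (ref i x) = x"
  by (rule ext) (simp add: refl_def[of _ _ _ "ref i x"] ip_ref_left, simp add: refl_def)

lemma ref_fund [simp]: "i < n \<Longrightarrow> ref i (fund i) = - fund i"
  by (rule ext) (simp add: refl_def)

lemma ref_minus: "ref i (- x) = - ref i x"
  by (rule ext) (simp add: refl_def)

lemma ref_fix: "x \<bullet> fund i = 0 \<Longrightarrow> ref i x = x"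
  and ref_lower: "x \<bullet> fund i = 1 \<Longrightarrow> ref i x = x - fund i"
  and ref_raise: "x \<bullet> fund i = -1 \<Longrightarrow> ref i x = x + fund i"
  by (rule ext; simp add: refl_def)+

lemma ref_comm:
  assumes "i < n" "j < n" "i \<noteq> j" "\<not> adj i j"
  shows "ref i (ref j x) = ref j (ref i x)"
proof -
  have "fund i \<bullet> fund j = 0" "fund j \<bullet> fund i = 0"
    using assms ip_fund_nonadj[of i j] ip_sym[of "fund i" "fund j"] by auto
  then show ?thesis
    by (intro ext) (simp add: refl_def[of _ _ _ "ref _ x"] ip_ref_left, simp add: refl_def)
qed

lemma ref_braid:
  assumes "i < n" "j < n" "adj i j"
  shows "ref i (ref j (ref i x)) = ref j (ref i (ref j x))"
proof -
  have "fund i \<bullet> fund j = -1" "fund j \<bullet> fund i = -1"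
    using assms ip_fund_adj adj_sym by auto
  then show ?thesis using assms(1,2)
    by (intro ext)
      (simp add: refl_def[of _ _ _ "ref _ (ref _ x)"] ip_ref_left,
       simp add: refl_def[of _ _ _ "ref _ x"] ip_ref_left, simp add: refl_def algebra_simps)
qed

section \<open>The Weyl group as words in simple reflections\<close>

lemma weyl_id: "id \<in> weyl n adj"
  unfolding weyl_def by (auto intro: exI[of _ "[]"])

lemma weyl_ref_comp: "f \<in> weyl n adj \<Longrightarrow> i < n \<Longrightarrow> ref i \<circ> f \<in> weyl n adj"
  unfolding weyl_def by clarsimp (rule_tac x="i # w" in exI, simp)

lemma foldr_comp: "foldr (\<circ>) fs g = foldr (\<circ>) fs id \<circ> g"
  by (induction fs) (auto simp: comp_assoc)

text \<open>Words grow on the left; the right-hand version reindexes sums over the group and shows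
  that the negative of a root is a root.\<close>

lemma weyl_comp_ref: "f \<in> weyl n adj \<Longrightarrow> i < n \<Longrightarrow> f \<circ> ref i \<in> weyl n adj"
  unfolding weyl_def
proof clarsimp
  fix w assume "i < n" "set w \<subseteq> {..<n}"
  then show "\<exists>w'. foldr (\<circ>) (map ref w) id \<circ> ref i = foldr (\<circ>) (map ref w') id \<and> set w' \<subseteq> {..<n}"
    by (intro exI[of _ "w @ [i]"]) (auto simp: foldr_comp[of "map ref w" "ref i"])
qed

lemma weyl_induct [consumes 1, case_names id ref]:
  assumes "f \<in> weyl n adj" "P id" "\<And>i f. i < n \<Longrightarrow> f \<in> weyl n adj \<Longrightarrow> P f \<Longrightarrow> P (ref i \<circ> f)"
  shows "P f"
proof -
  obtain w where w: "f = foldr (\<circ>) (map ref w) id" "set w \<subseteq> {..<n}"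
    using assms(1) unfolding weyl_def by blast
  have "P (foldr (\<circ>) (map ref w) id) \<and> foldr (\<circ>) (map ref w) id \<in> weyl n adj"
    using w(2) by (induction w) (auto simp: assms weyl_id weyl_ref_comp)
  with w show ?thesis by simp
qed

subsection \<open>Positive definiteness\<close>

lemma weyl_linear: "f \<in> weyl n adj \<Longrightarrow> f (\<lambda>k. x k + c * y k) = (\<lambda>k. f x k + c * f y k)"
  by (induction f rule: weyl_induct) (simp_all add: refl_def ip_add_scaled_left algebra_simps)

text \<open>The Euclidean product averaged over the finite group, the usual source of an invariant
  definite form.\<close>

definition avg :: "vec \<Rightarrow> vec \<Rightarrow> int" where
  "avg x y = (\<Sum>f\<in>weyl n adj. \<Sum>k<n. f x k * f y k)"

lemma avg_sym: "avg x y = avg y x"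
  by (simp add: avg_def mult.commute)

lemma avg_add_scaled: "avg (\<lambda>k. x k + c * y k) z = avg x z + c * avg y z"
  by (simp add: avg_def weyl_linear algebra_simps sum.distrib sum_distrib_left)

lemma avg_ref: assumes "i < n" shows "avg (ref i x) (ref i y) = avg x y"
  unfolding avg_def
  by (rule sum.reindex_bij_witness[of _ "\<lambda>f. f \<circ> ref i" "\<lambda>f. f \<circ> ref i"])
     (use assms in \<open>auto simp: comp_assoc weyl_comp_ref comp_def[of _ "ref i"] dest: weyl_comp_ref\<close>)

text \<open>\<open>ref i\<close> negates \<open>fund i\<close>, so invariance gives
  \<open>avg x (fund i) = - avg (ref i x) (fund i)\<close>; expanding \<open>ref i x\<close> leaves
  the claim. Against one fundamental root the averaged form is thus a multiple of \<open>ip\<close>,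
  with a factor depending on the node.\<close>

lemma avg_fund: assumes "i < n" shows "2 * avg x (fund i) = (x \<bullet> fund i) * avg (fund i) (fund i)"
proof -
  have "- fund i = (\<lambda>k. 0 + (-1) * fund i k)" by auto
  then have "avg y (- fund i) = - avg y (fund i)" for y
    using avg_add_scaled[of "fund i" "-2" "fund i" y] by (simp add: avg_sym[of y] fun_Compl_def)
  then have "avg x (fund i) = - avg (ref i x) (fund i)"
    using avg_ref[OF assms, of x "fund i"] assms by simp
  also have "\<dots> = - avg x (fund i) + (x \<bullet> fund i) * avg (fund i) (fund i)"
    unfolding ref_eq avg_add_scaled by simp
  finally show ?thesis by simp
qed

lemma avg_self_pos: assumes "k < n" "x k \<noteq> 0" shows "avg x x > 0"
proof -
  have "0 < x k * x k" using assms(2) by (auto simp: zero_less_mult_iff linorder_neq_iff)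
  also have "\<dots> \<le> (\<Sum>k<n. id x k * id x k)"
    using assms(1) member_le_sum[of k "{..<n}" "\<lambda>k. x k * x k"] by simp
  also have "\<dots> \<le> avg x x"
    unfolding avg_def using finite_weyl
    by (intro member_le_sum[OF weyl_id, where f="\<lambda>f. \<Sum>k<n. f x k * f x k"]) (auto intro: sum_nonneg)
  finally show ?thesis .
qed

text \<open>\<open>ip\<close> sees only coordinates below \<open>n\<close>, so it can be definite
  only on vectors that vanish elsewhere.\<close>

definition lat :: "vec set" where "lat = {x. \<forall>k\<ge>n. x k = 0}"

lemma avg_expand:
  assumes "x \<in> lat" shows "avg y x = (\<Sum>k<n. x k * avg y (fund k))"
proof -
  \<comment> \<open>Additivity handles two vectors at a time, so \<open>x\<close> is assembled from
    its truncations.\<close>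
  have "avg y (\<lambda>l. if l < m then x l else 0) = (\<Sum>k<m. x k * avg y (fund k))" for m
  proof (induction m)
    case 0
    have "avg (\<lambda>_. 0) y = 0" using avg_add_scaled[of "\<lambda>_. 0" 1 "\<lambda>_. 0" y] by simp
    then show ?case by (simp add: avg_sym[of y])
  next
    case (Suc m)
    have "(\<lambda>l. if l < Suc m then x l else 0) = (\<lambda>l. (if l < m then x l else 0) + x m * fund m l)"
      by (rule ext) (auto simp: fund_def less_Suc_eq)
    then show ?case using Suc by (simp add: avg_sym[of y] avg_add_scaled)
  qed
  moreover have "(\<lambda>l. if l < n then x l else 0) = x"
    using assms by (auto simp: lat_def)
  ultimately show ?thesis by metis
qed

text \<open>The averaged form is proportional to the given one on each connected component; the
  coordinates are therefore grouped by the scaling factor.\<close>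

lemma ip_pos_def:
  assumes "x \<in> lat" "x \<noteq> 0" shows "x \<bullet> x > 0"
proof -
  define c where "c i = avg (fund i) (fund i)" for i
  define p where "p v = (\<lambda>k. if k < n \<and> c k = v then x k else 0)" for v
  \<comment> \<open>\<open>avg_fund\<close> evaluates \<open>avg (fund i) (fund j)\<close> once with
    factor \<open>c i\<close> and once with \<open>c j\<close>; the inner product -1 being nonzero,
    the factors agree.\<close>
  have c_adj: "c i = c j" if "i < n" "j < n" "adj i j" for i j
    using avg_fund[OF that(1), of "fund j"] avg_fund[OF that(2), of "fund i"] 
      ip_fund_adj[OF that] ip_sym[of "fund j" "fund i"] avg_sym[of "fund i" "fund j"]
    by (simp add: c_def)
  have cpos: "c i > 0" if "i < n" for i
    using avg_self_pos[of i "fund i"] that by (simp add: c_def fund_def)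
  have plat: "p v \<in> lat" for v by (auto simp: p_def lat_def)
  have scaled: "2 * avg (p v) (p v) = v * (p v \<bullet> p v)" for v
  proof -
    have "2 * avg (p v) (p v) = (\<Sum>k<n. p v k * (2 * avg (p v) (fund k)))"
      by (simp add: avg_expand[OF plat] sum_distrib_left mult.left_commute)
    also have "\<dots> = (\<Sum>k<n. v * (p v k * (p v \<bullet> fund k)))"
      by (intro sum.cong) (auto simp: avg_fund c_def[symmetric] p_def)
    finally show ?thesis by (simp add: ip_expand[of "p v" "p v"] sum_distrib_left)
  qed
  have nonneg: "p v \<bullet> p v \<ge> 0" if "v \<in> c ` {..<n}" for v
  proof -
    have "avg (p v) (p v) \<ge> 0" unfolding avg_def by (intro sum_nonneg) auto
    moreover have "v > 0" using that cpos by auto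
    ultimately show ?thesis using scaled[of v] by (smt (verit) mult_pos_neg)
  qed
  \<comment> \<open>The parts are mutually orthogonal: a nonzero Gram entry joins equal or adjacent
    nodes, and these share the value of \<open>c\<close>.\<close>
  have split: "x \<bullet> x = (\<Sum>v\<in>c ` {..<n}. p v \<bullet> p v)"
  proof -
    have "(\<Sum>v\<in>c ` {..<n}. p v \<bullet> p v) =
        (\<Sum>i<n. \<Sum>j<n. \<Sum>v\<in>c ` {..<n}. p v i * p v j * gram adj i j)"
      unfolding ip_def by (subst sum.swap, intro sum.cong HOL.refl, rule sum.swap)
    also have "\<dots> = (\<Sum>i<n. \<Sum>j<n. x i * x j * gram adj i j)"
    proof (intro sum.cong HOL.refl)
      fix i j assume ij: "i \<in> {..<n}" "j \<in> {..<n}"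
      have "(\<Sum>v\<in>c ` {..<n}. p v i * p v j * gram adj i j) =
          (\<Sum>v\<in>c ` {..<n}. if v = c i then (if c i = c j then x i * x j * gram adj i j else 0) else 0)"
        using ij by (intro sum.cong) (auto simp: p_def)
      also have "\<dots> = x i * x j * gram adj i j"
        using ij c_adj[of i j] by (auto simp: gram_def)
      finally show "(\<Sum>v\<in>c ` {..<n}. p v i * p v j * gram adj i j) = x i * x j * gram adj i j" .
    qed
    finally show ?thesis by (simp add: ip_def)
  qed
  obtain k where k: "k < n" "x k \<noteq> 0"
    using assms unfolding lat_def by (auto simp: fun_eq_iff) (meson not_le)
  have "avg (p (c k)) (p (c k)) > 0"
    using k by (intro avg_self_pos[of k]) (auto simp: p_def)
  then have "p (c k) \<bullet> p (c k) > 0"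
    using scaled[of "c k"] cpos[OF k(1)] by (smt (verit) zero_less_mult_iff)
  moreover have "p (c k) \<bullet> p (c k) \<le> (\<Sum>v\<in>c ` {..<n}. p v \<bullet> p v)"
    using k nonneg by (intro member_le_sum) auto
  ultimately show ?thesis by (simp add: split)
qed

text \<open>Off-diagonal terms come in equal pairs and diagonal ones carry the factor 2. With
  definiteness, the least nonzero norm is therefore 2.\<close>

lemma ip_self_even: "even (x \<bullet> x)"
proof -
  have "m \<le> n \<Longrightarrow> even (\<Sum>i<m. \<Sum>j<m. x i * x j * gram adj i j)" for m
  proof (induction m)
    case (Suc m)
    have "(\<Sum>i<m. x i * x m * gram adj i m) = (\<Sum>j<m. x m * x j * gram adj m j)"
      using Suc.prems by (intro sum.cong) (auto simp: gram_sym[of _ m])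
    then have "(\<Sum>i<Suc m. \<Sum>j<Suc m. x i * x j * gram adj i j) =
        (\<Sum>i<m. \<Sum>j<m. x i * x j * gram adj i j) + 2 * (\<Sum>j<m. x m * x j * gram adj m j) + x m * x m * 2"
      by (simp add: sum.distrib gram_def)
    with Suc show ?case by (simp del: sum.lessThan_Suc)
  qed simp
  then show ?thesis by (simp add: ip_def)
qed

lemma ip_self_ge2: "x \<in> lat \<Longrightarrow> x \<noteq> 0 \<Longrightarrow> x \<bullet> x \<ge> 2"
  using ip_pos_def[of x] ip_self_even[of x] by (cases "x \<bullet> x = 1") auto

subsection \<open>Roots\<close>

definition norm2 :: "vec set" where "norm2 = {x \<in> lat. x \<bullet> x = 2}"

definition ht :: "vec \<Rightarrow> int" where "ht x = (\<Sum>k<n. x k)"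

lemma lat_closed [intro, simp]:
  "i < n \<Longrightarrow> fund i \<in> lat" "x \<in> lat \<Longrightarrow> - x \<in> lat"
  "x \<in> lat \<Longrightarrow> y \<in> lat \<Longrightarrow> x + y \<in> lat" "x \<in> lat \<Longrightarrow> y \<in> lat \<Longrightarrow> x - y \<in> lat"
  "x \<in> lat \<Longrightarrow> i < n \<Longrightarrow> ref i x \<in> lat"
  by (auto simp: lat_def fund_def refl_def)

lemma norm2_fund [simp]: "i < n \<Longrightarrow> fund i \<in> norm2"
  by (simp add: norm2_def)

lemma norm2_minus [simp]: "x \<in> norm2 \<Longrightarrow> - x \<in> norm2"
  by (simp add: norm2_def)

lemma norm2_ref [simp]: "i < n \<Longrightarrow> x \<in> norm2 \<Longrightarrow> ref i x \<in> norm2"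
  by (simp add: norm2_def ip_ref_ref)

lemma norm2_nonzero: "x \<in> norm2 \<Longrightarrow> \<exists>k<n. x k \<noteq> 0"
  unfolding norm2_def ip_def by (rule ccontr) simp

lemma ht_simps [simp]:
  "ht (x + y) = ht x + ht y" "ht (x - y) = ht x - ht y" "ht (- x) = - ht x" "i < n \<Longrightarrow> ht (fund i) = 1"
  by (simp_all add: ht_def sum.distrib sum_subtractf sum_negf fund_def)

text \<open>The positive and negative parts have disjoint supports, so their inner product is at
  most 0; were both nonzero, their difference would have norm at least 4.\<close>

lemma norm2_sign:
  assumes "x \<in> norm2" shows "(\<forall>k. 0 \<le> x k) \<or> (\<forall>k. x k \<le> 0)"
proof (rule ccontr)
  assume neg: "\<not> ?thesis"
  define y where "y = (\<lambda>k. max 0 (x k))"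
  define z where "z = (\<lambda>k. max 0 (- x k))"
  have x: "x = y - z" by (auto simp: y_def z_def)
  have lat: "y \<in> lat" "z \<in> lat" using assms by (auto simp: y_def z_def norm2_def lat_def)
  have "y i * z j * gram adj i j \<le> 0" for i j
    by (auto simp: y_def z_def gram_def max_def mult_nonneg_nonpos mult_nonpos_nonneg)
  then have "y \<bullet> z \<le> 0" unfolding ip_def by (intro sum_nonpos)
  moreover from neg obtain k l where "x k < 0" "x l > 0" by (auto simp: not_le)
  then have "y l \<noteq> 0" "z k \<noteq> 0" by (auto simp: y_def z_def)
  then have "y \<noteq> 0" "z \<noteq> 0" by auto
  then have "y \<bullet> y \<ge> 2" "z \<bullet> z \<ge> 2" using lat ip_self_ge2 by auto
  moreover have "x \<bullet> x = y \<bullet> y + z \<bullet> z - 2 * (y \<bullet> z)"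
    unfolding x using ip_sym[of z y] by simp
  ultimately show False using assms by (auto simp: norm2_def)
qed

text \<open>With constant sign, height 0 kills every coordinate. This is the contradiction behind
  the absence of ties.\<close>

lemma norm2_ht_nonzero: assumes "x \<in> norm2" shows "ht x \<noteq> 0"
proof
  assume ht: "ht x = 0"
  have "\<forall>k\<in>{..<n}. x k = 0" using norm2_sign[OF assms]
  proof
    assume "\<forall>k. 0 \<le> x k"
    with ht show ?thesis unfolding ht_def by (subst (asm) sum_nonneg_eq_0_iff) auto
  next
    assume "\<forall>k. x k \<le> 0"
    moreover have "(\<Sum>k<n. - x k) = 0" using ht by (simp add: ht_def sum_negf)
    ultimately show ?thesis by (subst (asm) sum_nonneg_eq_0_iff) auto
  qed
  with norm2_nonzero[OF assms] show False by auto
qed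

lemma norm2_ht_1: assumes "x \<in> norm2" "ht x = 1" shows "\<exists>k<n. x = fund k"
proof -
  have "\<not> (\<forall>k. x k \<le> 0)"
    using assms(2) sum_nonpos[of "{..<n}" x] unfolding ht_def by fastforce
  with norm2_sign[OF assms(1)] have nn: "\<forall>k. 0 \<le> x k" by blast
  obtain k where k: "k < n" "x k \<noteq> 0" using norm2_nonzero[OF assms(1)] by blast
  have "ht x = x k + (\<Sum>l\<in>{..<n} - {k}. x l)" unfolding ht_def using k by (simp add: sum.remove)
  moreover have "(\<Sum>l\<in>{..<n} - {k}. x l) \<ge> 0" using nn by (intro sum_nonneg) auto
  moreover have "x k \<ge> 1" using nn[rule_format, of k] k by auto
  ultimately have "x k = 1" "(\<Sum>l\<in>{..<n} - {k}. x l) = 0" using assms(2) by auto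
  then have "x k = 1" "\<forall>l\<in>{..<n} - {k}. x l = 0"
    using nn by (auto simp: sum_nonneg_eq_0_iff)
  moreover have "\<forall>l\<ge>n. x l = 0" using assms(1) by (simp add: norm2_def lat_def)
  ultimately have "x l = fund k l" for l by (cases "l < n") (auto simp: fund_def)
  then have "x = fund k" by blast
  with k show ?thesis by blast
qed

text \<open>The nonzero vector \<open>x - y\<close> has norm 4 minus twice the inner product, and
  this is at least 2.\<close>

lemma norm2_ip_le: assumes "x \<in> norm2" "y \<in> norm2" "x \<noteq> y" shows "x \<bullet> y \<le> 1"
proof -
  have "(x - y) \<bullet> (x - y) \<ge> 2" using assms by (intro ip_self_ge2) (auto simp: norm2_def)
  then show ?thesis using assms ip_sym[of y x] by (simp add: norm2_def)
qed

lemma norm2_ip_ge: assumes "x \<in> norm2" "y \<in> norm2" "x \<noteq> - y" shows "x \<bullet> y \<ge> - 1"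
  using norm2_ip_le[of x "- y"] assms by simp

section \<open>Roots and their positive representatives\<close>

lemma fund_in_roots: "i < n \<Longrightarrow> fund i \<in> roots n adj"
  unfolding roots_def using weyl_id by (auto intro!: exI[of _ id])

lemma roots_ref: "x \<in> roots n adj \<Longrightarrow> i < n \<Longrightarrow> ref i x \<in> roots n adj"
  unfolding roots_def using weyl_ref_comp[of _ i] by (auto simp: comp_def) (metis comp_apply)

lemma roots_weyl: "f \<in> weyl n adj \<Longrightarrow> x \<in> roots n adj \<Longrightarrow> f x \<in> roots n adj"
  by (induction f rule: weyl_induct) (auto simp: roots_ref)

lemma weyl_minus: "f \<in> weyl n adj \<Longrightarrow> f (- x) = - f x"
  by (induction f rule: weyl_induct) (auto simp: ref_minus simp del: fun_Compl_def uminus_apply)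

lemma roots_minus: assumes "x \<in> roots n adj" shows "- x \<in> roots n adj"
proof -
  obtain f i where "x = f (fund i)" "f \<in> weyl n adj" "i < n" using assms by (auto simp: roots_def)
  then have "- x = (f \<circ> ref i) (fund i)" "f \<circ> ref i \<in> weyl n adj"
    by (auto simp: weyl_minus weyl_comp_ref)
  with \<open>i < n\<close> show ?thesis unfolding roots_def by blast
qed

lemma roots_norm2: "x \<in> roots n adj \<Longrightarrow> x \<in> norm2"
proof -
  have "f \<in> weyl n adj \<Longrightarrow> i < n \<Longrightarrow> f (fund i) \<in> norm2" for f i
    by (induction f rule: weyl_induct) auto
  then show "x \<in> roots n adj \<Longrightarrow> x \<in> norm2" by (auto simp: roots_def)
qed

lemma finite_roots: "finite (roots n adj)"
proof -
  have "roots n adj = (\<lambda>(f, i). f (fund i)) ` (weyl n adj \<times> {..<n})"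
    by (force simp: roots_def)
  then show ?thesis using finite_weyl by simp
qed

lemma pos_roots_norm2 [simp]: "x \<in> pos_roots n adj \<Longrightarrow> x \<in> norm2"
  by (simp add: pos_roots_def roots_norm2)

lemma fund_pos_root [simp]: "i < n \<Longrightarrow> fund i \<in> pos_roots n adj"
  using fund_in_roots by (auto simp: pos_roots_def fund_def)

text \<open>Of a root and its negative exactly one is positive. Selecting it by a function turns the
  intersection with the positive roots in \<open>wact\<close> into an image, which composes
  well.\<close>

definition absv :: "vec \<Rightarrow> vec" where
  "absv x = (if \<forall>k. 0 \<le> x k then x else - x)"

lemma absv_cases: "absv x = x \<or> absv x = - x"
  by (simp add: absv_def)

lemma absv_pos_root: "x \<in> pos_roots n adj \<Longrightarrow> absv x = x"
  by (simp add: absv_def pos_roots_def)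

lemma absv_root: assumes "x \<in> roots n adj" shows "absv x \<in> pos_roots n adj"
  using norm2_sign[OF roots_norm2[OF assms]] assms roots_minus[OF assms]
  by (auto simp: absv_def pos_roots_def)

lemma absv_minus: assumes "x \<in> norm2" shows "absv (- x) = absv x"
proof -
  obtain k where "x k \<noteq> 0" using norm2_nonzero[OF assms] by blast
  then have "\<not> ((\<forall>k. 0 \<le> x k) \<and> (\<forall>k. x k \<le> 0))" by (metis order_antisym)
  with norm2_sign[OF assms] show ?thesis by (auto simp: absv_def)
qed

lemma absv_ref_absv: "i < n \<Longrightarrow> x \<in> norm2 \<Longrightarrow> absv (ref i (absv x)) = absv (ref i x)"
  using absv_cases[of x] by (auto simp: ref_minus absv_minus)

lemma pos_root_minus: "x \<in> pos_roots n adj \<Longrightarrow> - x \<notin> pos_roots n adj"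
  using absv_pos_root[of x] absv_pos_root[of "-x"] absv_minus[of x] norm2_nonzero[of x]
  by (auto simp: fun_eq_iff)

text \<open>The reflection alters only coordinate \<open>i\<close>. A positive root supported on
  \<open>i\<close> alone is \<open>fund i\<close>; any other has a positive coordinate that
  survives, and constancy of sign does the rest.\<close>

lemma ref_pos_root:
  assumes "x \<in> pos_roots n adj" "i < n" "x \<noteq> fund i" shows "ref i x \<in> pos_roots n adj"
proof -
  have "\<exists>k. k \<noteq> i \<and> x k > 0"
  proof (rule ccontr)
    assume neg: "\<not> ?thesis"
    have "x k = 0" if "k \<noteq> i" for k
    proof -
      have "\<not> x k > 0" using neg that by blast
      moreover have "x k \<ge> 0" using assms(1) by (simp add: pos_roots_def)
      ultimately show ?thesis by simp
    qed
    then have x: "x = (\<lambda>k. 0 + x i * fund i k)" by (auto simp: fund_def)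
    have "x \<bullet> x = x i * (fund i \<bullet> x)"
      by (subst x, subst ip_add_scaled_left) (simp add: ip_def)
    also have "fund i \<bullet> x = x i * 2"
      by (subst ip_sym, subst x, subst ip_add_scaled_left) (simp add: ip_def[of _ _ "\<lambda>_. 0"] assms)
    finally have "x i * x i = 1" using pos_roots_norm2[OF assms(1)] by (simp add: norm2_def)
    moreover have "x i \<ge> 0" using assms(1) by (simp add: pos_roots_def)
    ultimately have "x i = 1" by (auto simp: zmult_eq_1_iff)
    with x have "x = fund i" by simp
    with assms show False by simp
  qed
  then obtain k where "k \<noteq> i" "x k > 0" by blast
  then have "ref i x k > 0" by (simp add: refl_def fund_def)
  moreover have "ref i x \<in> roots n adj" using assms by (simp add: pos_roots_def roots_ref)
  moreover from this have "(\<forall>k. 0 \<le> ref i x k) \<or> (\<forall>k. ref i x k \<le> 0)"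
    by (intro norm2_sign roots_norm2)
  ultimately show ?thesis unfolding pos_roots_def by (auto simp: not_le[symmetric])
qed

subsection \<open>The action on sets of orthogonal roots\<close>

abbreviation act :: "nat \<Rightarrow> vec set \<Rightarrow> vec set" where "act i \<equiv> ract n adj i"
abbreviation orth :: "vec set \<Rightarrow> bool" where "orth \<equiv> orth_set n adj"

lemma wact_eq:
  assumes "B \<subseteq> pos_roots n adj" "f \<in> weyl n adj"
  shows "wact n adj f B = (\<lambda>\<beta>. absv (f \<beta>)) ` B"
proof -
  have fr: "f \<beta> \<in> roots n adj" if "\<beta> \<in> B" for \<beta>
    using that assms by (auto simp: pos_roots_def intro: roots_weyl)
  have um: "(\<lambda>k. - f \<beta> k) = - f \<beta>" for \<beta> by auto
  show ?thesis
  proof (intro equalityI subsetI)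
    fix \<gamma> assume "\<gamma> \<in> wact n adj f B"
    then obtain \<beta> where "\<gamma> \<in> pos_roots n adj" "\<beta> \<in> B" "\<gamma> = f \<beta> \<or> \<gamma> = - f \<beta>"
      by (auto simp: wact_def um)
    with fr[of \<beta>] have "\<gamma> = absv (f \<beta>)"
      using absv_pos_root absv_minus roots_norm2 by metis
    with \<open>\<beta> \<in> B\<close> show "\<gamma> \<in> (\<lambda>\<beta>. absv (f \<beta>)) ` B" by blast
  next
    fix \<gamma> assume "\<gamma> \<in> (\<lambda>\<beta>. absv (f \<beta>)) ` B"
    then obtain \<beta> where "\<beta> \<in> B" "\<gamma> = absv (f \<beta>)" by blast
    then show "\<gamma> \<in> wact n adj f B"
      using absv_root[OF fr] absv_cases[of "f \<beta>"] by (auto simp: wact_def um)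
  qed
qed

lemma orth_pos: "orth B \<Longrightarrow> \<beta> \<in> B \<Longrightarrow> \<beta> \<in> pos_roots n adj"
  by (auto simp: orth_set_def)

lemma orth_norm2: "orth B \<Longrightarrow> \<beta> \<in> B \<Longrightarrow> \<beta> \<in> norm2"
  by (auto simp: orth_set_def)

lemma orth_ip: "orth B \<Longrightarrow> \<beta> \<in> B \<Longrightarrow> \<gamma> \<in> B \<Longrightarrow> \<beta> \<noteq> \<gamma> \<Longrightarrow> \<beta> \<bullet> \<gamma> = 0"
  by (auto simp: orth_set_def)

lemma orth_finite: "orth B \<Longrightarrow> finite B"
  using finite_roots by (auto simp: orth_set_def pos_roots_def intro: finite_subset)

lemma ref_weyl: "i < n \<Longrightarrow> ref i \<in> weyl n adj"
  using weyl_ref_comp[OF weyl_id] by simp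

lemma act_eq: "orth B \<Longrightarrow> i < n \<Longrightarrow> act i B = (\<lambda>\<beta>. absv (ref i \<beta>)) ` B"
  unfolding ract_def by (rule wact_eq) (auto simp: orth_set_def ref_weyl)

lemma orth_act: assumes "orth B" "i < n" shows "orth (act i B)"
proof -
  have "absv (ref i \<beta>) \<in> pos_roots n adj" if "\<beta> \<in> B" for \<beta>
    using that assms by (intro absv_root roots_ref) (auto simp: orth_set_def pos_roots_def)
  moreover have "absv (ref i \<beta>) \<bullet> absv (ref i \<gamma>) = 0" if "\<beta> \<in> B" "\<gamma> \<in> B" "\<beta> \<noteq> \<gamma>" for \<beta> \<gamma>
    using absv_cases[of "ref i \<beta>"] absv_cases[of "ref i \<gamma>"] orth_ip[OF assms(1) that]
    by (auto simp: ip_ref_ref assms)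
  ultimately show ?thesis unfolding orth_set_def act_eq[OF assms] by blast
qed

lemma act_act2:
  assumes "orth B" "i < n" "j < n"
  shows "act i (act j B) = (\<lambda>\<beta>. absv (ref i (ref j \<beta>))) ` B"
  by (simp add: act_eq[OF orth_act] assms)
    (use assms in \<open>auto simp: act_eq image_image absv_ref_absv orth_norm2 intro!: image_cong\<close>)

lemma act_act3:
  assumes "orth B" "i < n" "j < n" "k < n"
  shows "act i (act j (act k B)) = (\<lambda>\<beta>. absv (ref i (ref j (ref k \<beta>)))) ` B"
  by (simp add: act_eq[OF orth_act[OF orth_act]] assms)
    (use assms in \<open>auto simp: act_act2 image_image absv_ref_absv orth_norm2 intro!: image_cong\<close>)

lemma act_invol [simp]: "orth B \<Longrightarrow> i < n \<Longrightarrow> act i (act i B) = B"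
  by (simp add: act_act2 absv_pos_root orth_pos)

lemma act_comm:
  "orth B \<Longrightarrow> i < n \<Longrightarrow> j < n \<Longrightarrow> i \<noteq> j \<Longrightarrow> \<not> adj i j \<Longrightarrow> act i (act j B) = act j (act i B)"
  by (simp add: act_act2 ref_comm[of i j])

lemma act_braid:
  "orth B \<Longrightarrow> i < n \<Longrightarrow> j < n \<Longrightarrow> adj i j \<Longrightarrow> act i (act j (act i B)) = act j (act i (act j B))"
  by (simp add: act_act3 ref_braid[of i j])

lemma act_ref: assumes "orth B" "i < n" "fund i \<notin> B" shows "act i B = ref i ` B"
proof -
  have "absv (ref i \<beta>) = ref i \<beta>" if "\<beta> \<in> B" for \<beta>
    using assms that by (intro absv_pos_root ref_pos_root) (auto simp: orth_pos)
  then show ?thesis by (simp add: act_eq assms)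
qed

text \<open>A positive root other than \<open>fund i\<close> has inner product -1, 0 or 1 with it.
  For an orthogonal set this leaves three exclusive cases: \<open>fund i\<close> belongs to it, is
  orthogonal to it, or moves it.\<close>

definition moves :: "nat \<Rightarrow> vec set \<Rightarrow> bool" where
  "moves i B \<longleftrightarrow> (\<exists>\<beta>\<in>B. \<beta> \<bullet> fund i = 1 \<or> \<beta> \<bullet> fund i = -1)"

abbreviation perp_to :: "nat \<Rightarrow> vec set \<Rightarrow> bool" where
  "perp_to i B \<equiv> fund i \<in> perp n adj B"

lemma perp_iff: "i < n \<Longrightarrow> perp_to i B \<longleftrightarrow> (\<forall>\<beta>\<in>B. \<beta> \<bullet> fund i = 0)"
  by (auto simp: perp_def fund_in_roots ip_sym[of "fund i"])

lemma ip_fund_cases: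
  assumes "\<beta> \<in> pos_roots n adj" "i < n" "\<beta> \<noteq> fund i"
  shows "\<beta> \<bullet> fund i = 0 \<or> \<beta> \<bullet> fund i = 1 \<or> \<beta> \<bullet> fund i = -1"
proof -
  have "\<beta> \<noteq> - fund i" using pos_root_minus[of "fund i"] assms by auto
  then show ?thesis
    using norm2_ip_le[of \<beta> "fund i"] norm2_ip_ge[of \<beta> "fund i"] assms by auto
qed

lemma moves_not_mem: "orth B \<Longrightarrow> i < n \<Longrightarrow> moves i B \<Longrightarrow> fund i \<notin> B"
  using orth_ip[of B _ "fund i"] ip_fund_self[of i] unfolding moves_def by fastforce

lemma moves_iff: "orth B \<Longrightarrow> i < n \<Longrightarrow> moves i B \<longleftrightarrow> fund i \<notin> B \<and> \<not> perp_to i B"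
  using moves_not_mem[of B i] ip_fund_cases[OF orth_pos, of B _ i]
  unfolding perp_iff moves_def by (metis zero_neq_neg_one zero_neq_one)

lemma perp_not_moves: "orth B \<Longrightarrow> i < n \<Longrightarrow> perp_to i B \<Longrightarrow> \<not> moves i B"
  by (simp add: moves_iff)

lemma perp_not_mem: "i < n \<Longrightarrow> perp_to i B \<Longrightarrow> fund i \<notin> B"
  by (auto simp: perp_iff)

lemma act_fixed: assumes "orth B" "i < n" "\<not> moves i B" shows "act i B = B"
proof -
  have "absv (ref i \<beta>) = \<beta>" if "\<beta> \<in> B" for \<beta>
  proof (cases "\<beta> = fund i")
    case True
    then show ?thesis using assms that absv_pos_root[OF fund_pos_root] by (simp add: absv_minus)
  next
    case False
    with ip_fund_cases[of \<beta> i] assms that have "\<beta> \<bullet> fund i = 0" by (auto simp: moves_def orth_pos)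
    then show ?thesis using assms that by (simp add: ref_fix absv_pos_root orth_pos)
  qed
  then show ?thesis by (simp add: act_eq assms)
qed

lemma ip_ref_fund_self: "i < n \<Longrightarrow> ref i x \<bullet> fund i = - (x \<bullet> fund i)"
  by (simp add: ip_ref_left)

lemma moves_act: assumes "orth B" "i < n" "moves i B" shows "moves i (act i B)"
  using assms moves_not_mem[OF assms] unfolding moves_def
  by (auto simp: act_ref ip_ref_fund_self)

lemma ht_ref: "i < n \<Longrightarrow> ht (ref i x) = ht x - x \<bullet> fund i"
  by (simp add: ht_def refl_def sum_subtractf fund_def if_distrib[of "\<lambda>t. _ * t"] cong: if_cong)

text \<open>A moved root \<beta> has inner product 2 - 1 = 1 with \<open>ref i \<beta>\<close>, so
  no orthogonal set contains both.\<close>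

lemma moves_act_neq: assumes "orth B" "i < n" "moves i B" shows "act i B \<noteq> B"
proof
  assume eq: "act i B = B"
  obtain \<beta> where \<beta>: "\<beta> \<in> B" "\<beta> \<bullet> fund i = 1 \<or> \<beta> \<bullet> fund i = -1" using assms(3) by (auto simp: moves_def)
  have "ref i \<beta> \<in> B" using eq \<beta> act_ref[OF assms(1,2)] moves_not_mem[OF assms] by auto
  moreover have "\<beta> \<bullet> ref i \<beta> = 1" "ref i \<beta> \<noteq> \<beta>"
    using \<beta> orth_norm2[OF assms(1) \<beta>(1)] ht_ref[OF assms(2), of \<beta>] by (auto simp: ip_ref_right norm2_def)
  ultimately show False using orth_ip[OF assms(1) \<beta>(1)] by fastforce
qed

section \<open>Direction of an edge and the lexicographic order\<close>

text \<open>A moved root occupies two neighbouring heights, one in \<open>B\<close> and one in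
  \<open>act i B\<close>; the lower is \<open>ht \<beta>\<close> for inner product -1 and
  \<open>ht \<gamma> - 1\<close> for inner product 1. The condition says that the lowest height
  involved is occupied on the side of \<open>B\<close>.\<close>

definition up :: "nat \<Rightarrow> vec set \<Rightarrow> bool" where
  "up i B \<longleftrightarrow> (\<exists>\<beta>\<in>B. \<beta> \<bullet> fund i = -1 \<and> (\<forall>\<gamma>\<in>B. \<gamma> \<bullet> fund i = 1 \<longrightarrow> ht \<beta> < ht \<gamma> - 1))"

lemma up_moves: "up i B \<Longrightarrow> moves i B"
  by (auto simp: up_def moves_def)

lemma diff_norm2:
  assumes "i < n" "\<beta> \<in> norm2" "\<gamma> \<in> norm2" "\<beta> \<bullet> \<gamma> = 0" "\<beta> \<bullet> fund i = -1" "\<gamma> \<bullet> fund i = 1"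
  shows "\<gamma> - fund i - \<beta> \<in> norm2"
  using assms ip_sym[of "fund i" \<beta>] ip_sym[of "fund i" \<gamma>] ip_sym[of \<gamma> \<beta>]
  by (auto simp: norm2_def)

text \<open>In a tie \<open>\<gamma> - fund i - \<beta>\<close> would be a vector of norm 2 and
  height 0.\<close>

lemma no_tie:
  assumes "orth B" "i < n" "\<beta> \<in> B" "\<gamma> \<in> B" "\<beta> \<bullet> fund i = -1" "\<gamma> \<bullet> fund i = 1"
  shows "ht \<beta> \<noteq> ht \<gamma> - 1"
proof -
  have "\<beta> \<noteq> \<gamma>" using assms by auto
  then have "\<gamma> - fund i - \<beta> \<in> norm2" using assms by (intro diff_norm2) (auto simp: orth_norm2 orth_ip)
  from norm2_ht_nonzero[OF this] show ?thesis using assms by simp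
qed

lemma up_or_up_act:
  assumes "orth B" "i < n" "moves i B" shows "up i B \<or> up i (act i B)"
proof -
  \<comment> \<open>\<open>e \<beta>\<close> is the smaller of the heights of \<beta> and
    \<open>ref i \<beta>\<close>; the root minimising it decides the direction.\<close>
  define e where "e \<beta> = (if \<beta> \<bullet> fund i = -1 then ht \<beta> else ht \<beta> - 1)" for \<beta>
  define S where "S = {\<beta>\<in>B. \<beta> \<bullet> fund i = 1 \<or> \<beta> \<bullet> fund i = -1}"
  have "finite S" "S \<noteq> {}" using orth_finite[OF assms(1)] assms(3) by (auto simp: S_def moves_def)
  then obtain \<beta> where \<beta>: "\<beta> \<in> S" "\<And>\<gamma>. \<gamma> \<in> S \<Longrightarrow> e \<beta> \<le> e \<gamma>"
    using arg_min_least[of S _ e] arg_min_if_finite(1)[of S e] by blast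
  note tie = no_tie[OF assms(1,2)]
  show ?thesis
  proof (cases "\<beta> \<bullet> fund i = -1")
    case True
    have "ht \<beta> < ht \<gamma> - 1" if "\<gamma> \<in> B" "\<gamma> \<bullet> fund i = 1" for \<gamma>
      using \<beta>(2)[of \<gamma>] tie[of \<beta> \<gamma>] that True \<beta>(1) by (auto simp: S_def e_def)
    then show ?thesis using \<beta>(1) True by (auto simp: up_def S_def)
  next
    case False
    then have b: "\<beta> \<in> B" "\<beta> \<bullet> fund i = 1" using \<beta>(1) by (auto simp: S_def)
    have "ht \<beta> - 1 < ht \<gamma>" if "\<gamma> \<in> B" "\<gamma> \<bullet> fund i = -1" for \<gamma>
      using \<beta>(2)[of \<gamma>] tie[of \<gamma> \<beta>] that b by (auto simp: S_def e_def)
    then have "up i (ref i ` B)" using b assms(2)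
      by (auto simp: up_def ip_ref_fund_self ht_ref intro!: bexI[of _ \<beta>])
    then show ?thesis using act_ref[OF assms(1,2)] moves_not_mem[OF assms] by simp
  qed
qed

lemma up_act_not_up:
  assumes "orth B" "i < n" "up i B" shows "\<not> up i (act i B)"
proof
  assume "up i (act i B)"
  then obtain \<gamma> where g: "\<gamma> \<in> B" "ref i \<gamma> \<bullet> fund i = -1"
    "\<forall>\<beta>\<in>B. ref i \<beta> \<bullet> fund i = 1 \<longrightarrow> ht (ref i \<gamma>) < ht (ref i \<beta>) - 1"
    using act_ref[OF assms(1,2)] moves_not_mem[OF assms(1,2)] up_moves[OF assms(3)] by (auto simp: up_def)
  obtain \<beta> where b: "\<beta> \<in> B" "\<beta> \<bullet> fund i = -1" "\<forall>\<gamma>\<in>B. \<gamma> \<bullet> fund i = 1 \<longrightarrow> ht \<beta> < ht \<gamma> - 1"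
    using assms(3) by (auto simp: up_def)
  show False using g b assms(2) by (fastforce simp: ip_ref_fund_self ht_ref)
qed

lemma up_act_iff: "orth B \<Longrightarrow> i < n \<Longrightarrow> moves i B \<Longrightarrow> up i (act i B) \<longleftrightarrow> \<not> up i B"
  using up_or_up_act up_act_not_up by blast

definition cnt :: "int \<Rightarrow> vec set \<Rightarrow> nat" where
  "cnt h B = card {\<beta>\<in>B. ht \<beta> = h}"

definition below :: "vec set \<Rightarrow> vec set \<Rightarrow> bool" where
  "below B B' \<longleftrightarrow> (\<exists>h. cnt h B' < cnt h B \<and> (\<forall>l<h. cnt l B = cnt l B'))"

lemma below_irrefl: "\<not> below B B"
  by (simp add: below_def)

lemma below_trans: "below A B \<Longrightarrow> below B C \<Longrightarrow> below A C"
  unfolding below_def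
proof clarsimp
  fix h l assume a: "cnt h B < cnt h A" "\<forall>l<h. cnt l A = cnt l B"
    "cnt l C < cnt l B" "\<forall>h<l. cnt h B = cnt h C"
  show "\<exists>h. cnt h C < cnt h A \<and> (\<forall>l<h. cnt l A = cnt l C)"
    using a by (intro exI[of _ "min h l"]) (cases h l rule: linorder_cases; auto simp: min_def)
qed

lemma up_below: assumes "orth B" "i < n" "up i B" shows "below B (act i B)"
proof -
  \<comment> \<open>The witness in \<open>up\<close> need not be lowest, so the lowest root with
    inner product -1 is taken: below its height both sets agree, and at its height
    \<open>act i B\<close> has lost it without gaining anything.\<close>
  define S where "S = {\<beta>\<in>B. \<beta> \<bullet> fund i = -1}"
  obtain \<beta>' where b': "\<beta>' \<in> S" "\<forall>\<gamma>\<in>B. \<gamma> \<bullet> fund i = 1 \<longrightarrow> ht \<beta>' < ht \<gamma> - 1"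
    using assms(3) by (auto simp: up_def S_def)
  have "finite S" using orth_finite[OF assms(1)] by (auto simp: S_def)
  then obtain \<beta> where \<beta>: "\<beta> \<in> S" "\<And>\<gamma>. \<gamma> \<in> S \<Longrightarrow> ht \<beta> \<le> ht \<gamma>"
    using b'(1) arg_min_least[of S _ ht] arg_min_if_finite(1)[of S ht] by blast
  have low: "\<gamma> \<in> B \<Longrightarrow> \<gamma> \<bullet> fund i = 1 \<Longrightarrow> ht \<beta> < ht \<gamma> - 1" for \<gamma>
    using \<beta>(2)[OF b'(1)] b'(2) by force
  have nin: "fund i \<notin> B" using assms moves_not_mem up_moves by blast
  have cases: "\<gamma> \<bullet> fund i = 0 \<or> \<gamma> \<bullet> fund i = 1 \<or> \<gamma> \<bullet> fund i = -1" if "\<gamma> \<in> B" for \<gamma>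
    using that nin assms ip_fund_cases orth_pos by blast
  have fixed: "\<gamma> \<bullet> fund i = 0" if "\<gamma> \<in> B" "ht (ref i \<gamma>) \<le> ht \<beta>" for \<gamma>
    using cases[OF that(1)] that low[of \<gamma>] \<beta>(2)[of \<gamma>] assms(2) by (auto simp: S_def ht_ref)
  have actB: "act i B = ref i ` B" using act_ref[OF assms(1,2) nin] .
  have sub: "{\<gamma>\<in>act i B. ht \<gamma> = l} \<subseteq> {\<gamma>\<in>B. ht \<gamma> = l}" if "l \<le> ht \<beta>" for l
    using fixed that ref_fix unfolding actB by fastforce
  have sup: "{\<gamma>\<in>B. ht \<gamma> = l} \<subseteq> {\<gamma>\<in>act i B. ht \<gamma> = l}" if "l < ht \<beta>" for l
  proof clarsimp
    fix \<gamma> assume g: "\<gamma> \<in> B" "l = ht \<gamma>"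
    then have "\<gamma> \<bullet> fund i = 0" using cases[of \<gamma>] low[of \<gamma>] \<beta>(2)[of \<gamma>] that by (auto simp: S_def)
    then show "\<gamma> \<in> act i B" using g ref_fix unfolding actB by force
  qed
  have "\<beta> \<notin> act i B"
  proof
    assume "\<beta> \<in> act i B"
    then obtain \<gamma> where "\<gamma> \<in> B" "\<beta> = ref i \<gamma>" unfolding actB by blast
    with fixed[of \<gamma>] \<beta>(1) assms(2) show False by (auto simp: S_def ip_ref_fund_self)
  qed
  then have "{\<gamma>\<in>act i B. ht \<gamma> = ht \<beta>} \<subset> {\<gamma>\<in>B. ht \<gamma> = ht \<beta>}" using sub[of "ht \<beta>"] \<beta>(1) by (auto simp: S_def)
  then have "cnt (ht \<beta>) (act i B) < cnt (ht \<beta>) B"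
    unfolding cnt_def using orth_finite[OF assms(1)] by (intro psubset_card_mono) auto
  moreover have "cnt l B = cnt l (act i B)" if "l < ht \<beta>" for l
    unfolding cnt_def
    by (rule arg_cong[where f=card], rule equalityI, rule sup[OF that], rule sub) (use that in simp)
  ultimately show ?thesis unfolding below_def by blast
qed

text \<open>The bridge between the global order and single edges: a moving reflection goes up from
  exactly one end, so the converse follows from \<open>up_below\<close> at the other end.\<close>

lemma below_act_iff: assumes "orth B" "i < n" shows "below B (act i B) \<longleftrightarrow> up i B"
proof
  assume b: "below B (act i B)"
  show "up i B"
  proof (rule ccontr)
    assume "\<not> up i B"
    moreover have "moves i B" using b act_fixed[OF assms] below_irrefl by metis
    ultimately have "up i (act i B)" using assms up_act_iff by blast
    from up_below[OF orth_act[OF assms] assms(2) this] have "below (act i B) B" using assms by simp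
    with b show False using below_trans below_irrefl by blast
  qed
qed (use assms up_below in blast)

lemma act_below_iff: "orth B \<Longrightarrow> i < n \<Longrightarrow> below (act i B) B \<longleftrightarrow> up i (act i B)"
  using below_act_iff[OF orth_act, of B i i] by simp

subsection \<open>The order on orbits of rank-two parabolic subgroups\<close>

lemma ht_pos_root: assumes "\<beta> \<in> pos_roots n adj" shows "ht \<beta> \<ge> 1"
proof -
  have "ht \<beta> \<ge> 0" unfolding ht_def using assms by (intro sum_nonneg) (auto simp: pos_roots_def)
  then show ?thesis using norm2_ht_nonzero[of \<beta>] assms by simp
qed

lemma ip_fund_fund_neq_1: "i < n \<Longrightarrow> j < n \<Longrightarrow> fund i \<bullet> fund j \<noteq> 1"
  by (simp add: ip_fund_fund gram_def)

text \<open>This is what makes parallel edges of a hexagon or chain point the same way: the heights of the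
  two deciding roots shift by up to 2 between parallel edges, and the gap absorbs the shift.\<close>

lemma ht_gap:
  assumes "orth B" "i < n" "j < n" "adj i j" "\<beta> \<in> B" "\<gamma> \<in> B"
    and ip: "\<beta> \<bullet> fund i = 0" "\<gamma> \<bullet> fund i = 0" "\<beta> \<bullet> fund j = -1" "\<gamma> \<bullet> fund j = 1"
    and less: "ht \<beta> < ht \<gamma> - 1"
  shows "ht \<beta> < ht \<gamma> - 3"
proof -
  \<comment> \<open>The height of \<delta> is the gap less 1. Heights 1 and 2 are impossible because
    \<delta>, respectively \<open>\<delta> - fund i\<close>, would be a fundamental root having
    inner product 1 with another one, and Gram entries are never 1.\<close>
  define \<delta> where "\<delta> = \<gamma> - fund j - \<beta>"
  have "\<beta> \<noteq> \<gamma>" using ip by auto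
  then have d: "\<delta> \<in> norm2"
    unfolding \<delta>_def using assms by (intro diff_norm2) (auto simp: orth_norm2 orth_ip)
  have ij: "fund j \<bullet> fund i = -1" "fund i \<bullet> fund j = -1" using assms ip_fund_adj adj_sym by auto
  then have di: "\<delta> \<bullet> fund i = 1" and dj: "\<delta> \<bullet> fund j = 0" using ip assms(2,3) by (simp_all add: \<delta>_def)
  then have d': "\<delta> - fund i \<in> norm2"
    using d assms(2) ip_sym[of "fund i" \<delta>] by (auto simp: norm2_def)
  have "ht \<delta> \<noteq> 1"
    using norm2_ht_1[OF d] di ip_fund_fund_neq_1 assms(2) by metis
  moreover have "ht \<delta> \<noteq> 2"
  proof
    assume "ht \<delta> = 2"
    then have "ht (\<delta> - fund i) = 1" using assms(2) by simp
    then obtain k where "k < n" "\<delta> - fund i = fund k" using norm2_ht_1[OF d'] by blast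
    moreover have "(\<delta> - fund i) \<bullet> fund j = 1" using ij dj by simp
    ultimately show False using ip_fund_fund_neq_1 assms(3) by metis
  qed
  moreover have "ht \<delta> = ht \<gamma> - ht \<beta> - 1" using assms(3) by (simp add: \<delta>_def)
  ultimately show ?thesis using less by linarith
qed

lemma ip_sum_cases:
  assumes "orth B" "i < n" "j < n" "adj i j" "fund i + fund j \<notin> B" "\<beta> \<in> B"
  shows "\<bar>\<beta> \<bullet> fund i + \<beta> \<bullet> fund j\<bar> \<le> 1"
proof -
  have ij: "fund j \<bullet> fund i = -1" "fund i \<bullet> fund j = -1" using assms ip_fund_adj adj_sym by auto
  have s: "fund i + fund j \<in> norm2" using ij assms(2,3) by (simp add: norm2_def)
  have "\<beta> \<noteq> - (fund i + fund j)"
    using ht_pos_root[OF orth_pos[OF assms(1,6)]] assms(2,3) by auto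
  then show ?thesis
    using norm2_ip_le[OF orth_norm2[OF assms(1,6)] s] norm2_ip_ge[OF orth_norm2[OF assms(1,6)] s] assms(5,6)
    by (cases "\<beta> = fund i + fund j") auto
qed

text \<open>\<open>ref j\<close> lowers this sum to \<open>fund i\<close>, of height 1, and no
  positive root of \<open>B\<close> lies lower than that.\<close>

lemma up_sum_not_mem:
  assumes "orth B" "i < n" "j < n" "adj i j" "up j B" shows "fund i + fund j \<notin> B"
proof
  assume m: "fund i + fund j \<in> B"
  moreover have "(fund i + fund j) \<bullet> fund j = 1" using assms ip_fund_adj[of i j] by simp
  ultimately obtain \<beta> where "\<beta> \<in> B" "ht \<beta> < ht (fund i + fund j) - 1" using assms(5) by (auto simp: up_def)
  then show False using ht_pos_root[OF orth_pos[OF assms(1)]] assms(2,3) by force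
qed

text \<open>Applying \<open>r_j r_i\<close> carries the edge labelled \<open>j\<close> at
  \<open>B\<close> to the opposite edge labelled \<open>i\<close>, since \<open>r_i r_j\<close>
  sends \<open>fund i\<close> to \<open>fund j\<close>. The direction must survive the change of
  heights.\<close>

lemma up_transfer:
  assumes "orth B" "i < n" "j < n" "adj i j" "fund i \<notin> B" "up j B"
  shows "up i (act j (act i B))"
proof -
  have ij: "fund j \<bullet> fund i = -1" "fund i \<bullet> fund j = -1" using assms ip_fund_adj adj_sym by auto
  have s: "fund i + fund j \<notin> B" using up_sum_not_mem assms by blast
  have "fund j \<notin> act i B"
  proof
    assume "fund j \<in> act i B"
    then obtain \<beta> where "\<beta> \<in> B" "fund j = ref i \<beta>" using assms act_ref by auto
    then have "\<beta> = ref i (fund j)" using assms by simp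
    then have "\<beta> = fund i + fund j" using ref_raise[of "fund j" i] ij by (simp add: add.commute)
    with s \<open>\<beta> \<in> B\<close> show False by simp
  qed
  then have act: "act j (act i B) = (\<lambda>\<beta>. ref j (ref i \<beta>)) ` B"
    using assms by (simp add: act_ref[OF orth_act] image_image) (simp add: act_ref image_image)
  have ipi: "ref j (ref i \<beta>) \<bullet> fund i = \<beta> \<bullet> fund j" for \<beta>
    using ij assms(2,3) by (simp add: ip_ref_left)
  have htr: "ht (ref j (ref i \<beta>)) = ht \<beta> - 2 * (\<beta> \<bullet> fund i) - \<beta> \<bullet> fund j" for \<beta>
    using ij assms(2,3) by (simp add: ht_ref ip_ref_left)
  have cs: "\<bar>\<beta> \<bullet> fund i\<bar> \<le> 1 \<and> \<bar>\<beta> \<bullet> fund i + \<beta> \<bullet> fund j\<bar> \<le> 1" if "\<beta> \<in> B" for \<beta>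
    using ip_sum_cases[OF assms(1-4) s that] ip_fund_cases[OF orth_pos[OF assms(1) that] assms(2)] that assms(5)
    by (cases "\<beta> = fund i") auto
  obtain \<beta> where b: "\<beta> \<in> B" "\<beta> \<bullet> fund j = -1" "\<And>\<gamma>. \<gamma> \<in> B \<Longrightarrow> \<gamma> \<bullet> fund j = 1 \<Longrightarrow> ht \<beta> < ht \<gamma> - 1"
    using assms(6) by (auto simp: up_def)
  \<comment> \<open>The inner product with \<open>fund i\<close> is 0 or 1 for \<beta> and 0 or -1
    for \<gamma>. Any nonzero value widens the gap by 2; if both vanish, \<open>ht_gap\<close>
    supplies the room.\<close>
  have "ht \<beta> - 2 * (\<beta> \<bullet> fund i) + 1 < ht \<gamma> - 2 * (\<gamma> \<bullet> fund i) - 1 - 1"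
    if g: "\<gamma> \<in> B" "\<gamma> \<bullet> fund j = 1" for \<gamma>
    using ht_gap[OF assms(1-4) b(1) g(1)] b(2) b(3)[OF g] g(2) cs[OF b(1)] cs[OF g(1)]
    by (cases "\<beta> \<bullet> fund i = 0 \<and> \<gamma> \<bullet> fund i = 0") auto
  then show ?thesis unfolding act up_def using b(1,2) by (auto simp: ipi htr intro!: bexI[of _ \<beta>])
qed

lemma up_perp:
  assumes "orth B" "i < n" "j < n" "adj i j" "perp_to i B" "up j B" shows "up i (act j B)"
  using up_transfer[OF assms(1-4) perp_not_mem[OF assms(2,5)] assms(6)] assms
  by (simp add: act_fixed perp_not_moves)

text \<open>The lowest candidates in \<open>act i B\<close> come from the witness \<beta> for
  \<open>i\<close>, now at height \<open>ht \<beta> + 1\<close>, and the witness \<beta>' for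
  \<open>j\<close>, still at \<open>ht \<beta>'\<close>. A candidate drops out if its two inner
  products cancel; both cannot drop out, for each would then have to be lower than the other. The
  lower remaining one serves.\<close>

lemma up_hexagon:
  assumes "orth B" "i < n" "j < n" "adj i j" "up i B" "up j B" shows "up j (act i B)"
proof -
  have ij: "fund j \<bullet> fund i = -1" "fund i \<bullet> fund j = -1" using assms ip_fund_adj adj_sym by auto
  have s: "fund i + fund j \<notin> B" using up_sum_not_mem assms by blast
  have nin: "fund i \<notin> B" "fund j \<notin> B" using assms moves_not_mem up_moves by blast+
  have ipj: "ref i \<beta> \<bullet> fund j = \<beta> \<bullet> fund i + \<beta> \<bullet> fund j" for \<beta> using ij by (simp add: ip_ref_left)
  have htr: "ht (ref i \<beta>) = ht \<beta> - \<beta> \<bullet> fund i" for \<beta> using ht_ref assms by simp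
  have cs: "\<bar>\<beta> \<bullet> fund i\<bar> \<le> 1 \<and> \<bar>\<beta> \<bullet> fund j\<bar> \<le> 1 \<and> \<bar>\<beta> \<bullet> fund i + \<beta> \<bullet> fund j\<bar> \<le> 1" if "\<beta> \<in> B" for \<beta>
    using ip_sum_cases[OF assms(1-4) s that] ip_fund_cases[OF orth_pos[OF assms(1) that] assms(2)]
      ip_fund_cases[OF orth_pos[OF assms(1) that] assms(3)] that nin
    by (cases "\<beta> = fund i"; cases "\<beta> = fund j") auto
  have upI: ?thesis if "\<beta> \<in> B" "\<beta> \<bullet> fund i + \<beta> \<bullet> fund j = -1"
    "\<And>\<gamma>. \<gamma> \<in> B \<Longrightarrow> \<gamma> \<bullet> fund i + \<gamma> \<bullet> fund j = 1 \<Longrightarrow> ht \<beta> - \<beta> \<bullet> fund i < ht \<gamma> - \<gamma> \<bullet> fund i - 1" for \<beta>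
    unfolding act_ref[OF assms(1,2) nin(1)] up_def using that by (auto simp: ipj htr intro!: bexI[of _ \<beta>])
  obtain \<beta> where b: "\<beta> \<in> B" "\<beta> \<bullet> fund i = -1" "\<And>\<gamma>. \<gamma> \<in> B \<Longrightarrow> \<gamma> \<bullet> fund i = 1 \<Longrightarrow> ht \<beta> < ht \<gamma> - 1"
    using assms(5) by (auto simp: up_def)
  obtain \<beta>' where b': "\<beta>' \<in> B" "\<beta>' \<bullet> fund j = -1" "\<And>\<gamma>. \<gamma> \<in> B \<Longrightarrow> \<gamma> \<bullet> fund j = 1 \<Longrightarrow> ht \<beta>' < ht \<gamma> - 1"
    using assms(6) by (auto simp: up_def)
  have gap: "ht \<beta> < ht \<gamma> - 3" if "\<gamma> \<in> B" "\<gamma> \<bullet> fund i = 1" "\<gamma> \<bullet> fund j = 0" "\<beta> \<bullet> fund j = 0" for \<gamma>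
    using ht_gap[OF assms(1,3,2) adj_sym[OF assms(2-4)] b(1) that(1)] that b by auto
  have qb: "\<beta> \<bullet> fund j = 0 \<or> \<beta> \<bullet> fund j = 1" and pb': "\<beta>' \<bullet> fund i = 0 \<or> \<beta>' \<bullet> fund i = 1"
    using cs[OF b(1)] cs[OF b'(1)] b(2) b'(2) by auto
  have cases: "(\<gamma> \<bullet> fund i = 1 \<and> \<gamma> \<bullet> fund j = 0) \<or> (\<gamma> \<bullet> fund i = 0 \<and> \<gamma> \<bullet> fund j = 1)"
    if "\<gamma> \<in> B" "\<gamma> \<bullet> fund i + \<gamma> \<bullet> fund j = 1" for \<gamma>
    using cs[OF that(1)] that(2) by auto
  show ?thesis
  proof (cases "\<beta> \<bullet> fund j = 0 \<and> (\<beta>' \<bullet> fund i = 1 \<or> ht \<beta> + 1 \<le> ht \<beta>')")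
    case True
    have "ht \<beta> + 1 \<le> ht \<beta>'" using True b(3)[OF b'(1)] by auto
    moreover have "ht \<beta> + 1 < ht \<gamma> - \<gamma> \<bullet> fund i - 1"
      if g: "\<gamma> \<in> B" "\<gamma> \<bullet> fund i + \<gamma> \<bullet> fund j = 1" for \<gamma>
      using cases[OF g] gap[OF g(1)] b'(3)[OF g(1)] True calculation by auto
    ultimately show ?thesis using True b by (intro upI[of \<beta>]) auto
  next
    case False
    have p0: "\<beta>' \<bullet> fund i = 0"
      using False qb pb' b(3)[OF b'(1)] b'(3)[OF b(1)] by auto
    have "ht \<beta>' < ht \<gamma> - \<gamma> \<bullet> fund i - 1"
      if g: "\<gamma> \<in> B" "\<gamma> \<bullet> fund i + \<gamma> \<bullet> fund j = 1" for \<gamma>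
      using cases[OF g] gap[OF g(1)] b(3)[OF g(1)] b'(3)[OF g(1)] b'(3)[OF b(1)] False qb p0 by auto
    then show ?thesis using p0 b' by (intro upI[of \<beta>']) auto
  qed
qed

section \<open>Transport of orthogonality and membership along reflections\<close>

lemma perp_act:
  assumes "orth B" "j < n" "k < n"
  shows "perp_to k (act j B) \<longleftrightarrow> (\<forall>\<beta>\<in>B. ref j \<beta> \<bullet> fund k = 0)"
proof -
  have "absv (ref j \<beta>) \<bullet> fund k = 0 \<longleftrightarrow> ref j \<beta> \<bullet> fund k = 0" for \<beta>
    using absv_cases[of "ref j \<beta>"] by auto
  then show ?thesis by (simp add: perp_iff assms act_eq)
qed

lemma perp_act_nonadj:
  assumes "orth B" "i < n" "j < n" "i \<noteq> j" "\<not> adj i j"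
  shows "perp_to i (act j B) \<longleftrightarrow> perp_to i B"
  unfolding perp_act[OF assms(1,3,2)]
  using assms ip_fund_nonadj[of i j] ip_sym[of "fund i" "fund j"]
  by (simp add: ip_ref_left perp_iff)

text \<open>Both sides say that \<open>B\<close> is orthogonal to
  \<open>fund i + fund j\<close>.\<close>

lemma perp_act_adj:
  assumes "orth B" "i < n" "j < n" "adj i j"
  shows "perp_to j (act i B) \<longleftrightarrow> perp_to i (act j B)"
  unfolding perp_act[OF assms(1-3)] perp_act[OF assms(1,3,2)]
  using assms ip_fund_adj[of i j] ip_fund_adj[of j i] adj_sym[of i j]
  by (simp add: ip_ref_left add.commute)

text \<open>\<open>r_i r_j\<close> sends \<open>fund i\<close> to \<open>fund j\<close>. This is why
  the second clause for words in \<open>V(B,i)\<close> replaces the node \<open>i\<close> by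
  \<open>j\<close>.\<close>

lemma perp_act_act:
  assumes "orth B" "i < n" "j < n" "adj i j" "perp_to i B" shows "perp_to j (act i (act j B))"
  using perp_act_adj[OF orth_act[OF assms(1,3)] assms(2-4)] assms by simp

lemma mem_act_nonadj:
  assumes "orth B" "i < n" "j < n" "i \<noteq> j" "\<not> adj i j" "fund i \<in> B"
  shows "fund i \<in> act j B"
proof -
  have "ref j (fund i) = fund i" using ip_fund_nonadj assms by (simp add: ref_fix)
  then show ?thesis using assms absv_pos_root[OF fund_pos_root[OF assms(2)]] by (force simp: act_eq)
qed

lemma mem_act_act:
  assumes "orth B" "i < n" "j < n" "adj i j" "fund i \<in> B"
  shows "fund j \<in> act i (act j B)" "fund i + fund j \<in> act j B"
proof -
  have ij: "fund j \<bullet> fund i = -1" "fund i \<bullet> fund j = -1" using assms ip_fund_adj adj_sym by auto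
  then have r: "ref j (fund i) = fund i + fund j" by (simp add: ref_raise)
  moreover have "ref i (fund i + fund j) = fund j"
    using ref_lower[of "fund i + fund j" i] ij assms(2) by simp
  ultimately show "fund j \<in> act i (act j B)"
    using assms absv_pos_root[OF fund_pos_root[OF assms(3)]] by (force simp: act_act2)
  have "fund i + fund j = absv (ref j (fund i))" using r by (simp add: absv_def fund_def)
  then show "fund i + fund j \<in> act j B" using assms by (force simp: act_eq)
qed

text \<open>\<open>act j B\<close> contains \<open>fund i + fund j\<close>, and from such a set
  \<open>j\<close> does not lead upwards.\<close>

lemma up_mem:
  assumes "orth B" "i < n" "j < n" "adj i j" "fund i \<in> B" shows "up j B"
proof -
  have "fund i \<bullet> fund j = -1" using assms ip_fund_adj by auto
  then have m: "moves j B" using assms(5) by (auto simp: moves_def)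
  show ?thesis
    using up_sum_not_mem[OF orth_act[OF assms(1,3)] assms(2-4)] mem_act_act(2)[OF assms] up_or_up_act[OF assms(1,3) m]
    by blast
qed

text \<open>The sum of the three fundamental roots would have norm 6 - 6 = 0.\<close>

lemma no_triangle:
  assumes "i < n" "j < n" "k < n" "adj i j" "adj j k" "adj k i" shows False
proof -
  have "i \<noteq> j" "j \<noteq> k" "k \<noteq> i" using assms adj_irrefl by auto
  then have "(fund i + fund j + fund k) i = 1" by (simp add: fund_def)
  then have "fund i + fund j + fund k \<noteq> 0" by (metis zero_fun_apply zero_neq_one)
  then have "(fund i + fund j + fund k) \<bullet> (fund i + fund j + fund k) > 0"
    using assms by (intro ip_pos_def) auto
  then show False using assms ip_fund_adj adj_sym by simp
qed

end

subsection \<open>Confluence on an admissible orbit\<close>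

lemma newman:
  assumes wf: "wfp (\<lambda>y x. r x y)"
    and local: "\<And>x y z. r x y \<Longrightarrow> r x z \<Longrightarrow> \<exists>u. r\<^sup>*\<^sup>* y u \<and> r\<^sup>*\<^sup>* z u"
  shows "r\<^sup>*\<^sup>* x y \<Longrightarrow> r\<^sup>*\<^sup>* x z \<Longrightarrow> \<exists>u. r\<^sup>*\<^sup>* y u \<and> r\<^sup>*\<^sup>* z u"
proof (induction x arbitrary: y z rule: wfp_induct_rule[OF wf])
  case (1 x)
  show ?case
  proof (cases "x = y \<or> x = z")
    case True
    then show ?thesis using 1(2,3) by blast
  next
    case False
    then obtain y' z' where s: "r x y'" "r\<^sup>*\<^sup>* y' y" "r x z'" "r\<^sup>*\<^sup>* z' z"
      using 1(2,3) by (metis converse_rtranclpE)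
    obtain u where u: "r\<^sup>*\<^sup>* y' u" "r\<^sup>*\<^sup>* z' u" using local s by blast
    obtain v where v: "r\<^sup>*\<^sup>* y v" "r\<^sup>*\<^sup>* u v" using 1(1)[OF s(1)] s(2) u(1) by blast
    have "r\<^sup>*\<^sup>* z' v" using u(2) v(2) by simp
    then obtain w where "r\<^sup>*\<^sup>* v w" "r\<^sup>*\<^sup>* z w" using 1(1)[OF s(3)] s(4) by blast
    then show ?thesis using v(1) by (meson rtranclp_trans)
  qed
qed

locale admissible_orbit = simply_laced +
  fixes BB :: "vec set set"
  assumes adm: "admissible n adj BB"
begin

section \<open>The orbit and the reflections acting on it\<close>

lemma orbit_rep: "\<exists>R. orth R \<and> BB = orbit n adj R"
  using adm by (simp add: admissible_def)

lemma wact_ref_comp: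
  assumes "orth R" "f \<in> weyl n adj" "i < n" "orth (wact n adj f R)"
  shows "wact n adj (ref i \<circ> f) R = act i (wact n adj f R)"
proof -
  have pos: "R \<subseteq> pos_roots n adj" using assms(1) by (auto simp: orth_set_def)
  then have "f \<beta> \<in> norm2" if "\<beta> \<in> R" for \<beta>
    using that pos by (intro roots_norm2 roots_weyl[OF assms(2)]) (auto simp: pos_roots_def)
  then show ?thesis using pos assms
    by (simp add: act_eq wact_eq weyl_ref_comp[unfolded comp_def] image_image comp_def absv_ref_absv cong: image_cong_simp)
qed

lemma orth_wact: "f \<in> weyl n adj \<Longrightarrow> orth R \<Longrightarrow> orth (wact n adj f R)"
proof (induction f rule: weyl_induct)
  case id
  have "wact n adj id R = R"
    using id absv_pos_root by (subst wact_eq) (auto simp: weyl_id orth_pos orth_set_def)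
  with id show ?case by (simp only:)
next
  case (ref i f)
  show ?case unfolding wact_ref_comp[OF ref(4,2,1) ref(3)[OF ref(4)]] using ref orth_act by blast
qed

lemma orth_BB [simp]: "B \<in> BB \<Longrightarrow> orth B"
  using orbit_rep by (auto simp: orbit_def orth_wact)

lemma act_BB [simp]: "B \<in> BB \<Longrightarrow> i < n \<Longrightarrow> act i B \<in> BB"
proof -
  assume B: "B \<in> BB" "i < n"
  obtain R where R: "orth R" "BB = orbit n adj R" using orbit_rep by blast
  then obtain f where f: "f \<in> weyl n adj" "B = wact n adj f R" using B by (auto simp: orbit_def)
  then have "act i B = wact n adj (ref i \<circ> f) R"
    using B R orth_wact by (metis wact_ref_comp)
  then show "act i B \<in> BB" using R f B weyl_ref_comp unfolding orbit_def by blast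
qed

lemma finite_BB: "finite BB"
proof -
  obtain R where "BB = orbit n adj R" using orbit_rep by blast
  then have "BB = (\<lambda>f. wact n adj f R) ` weyl n adj" by (auto simp: orbit_def)
  then show ?thesis using finite_weyl by simp
qed

lemma BB_nonempty: "BB \<noteq> {}"
  using orbit_rep weyl_id by (auto simp: orbit_def)

text \<open>As reflections are involutions, stability in one direction is an equivalence, so the
  property may be started at any element of the orbit.\<close>

lemma BB_connected:
  assumes "B \<in> BB" "P B" "C \<in> BB" and step: "\<And>B i. B \<in> BB \<Longrightarrow> i < n \<Longrightarrow> P B \<Longrightarrow> P (act i B)"
  shows "P C"
proof -
  obtain R where R: "orth R" "BB = orbit n adj R" using orbit_rep by blast
  have mem: "f \<in> weyl n adj \<Longrightarrow> wact n adj f R \<in> BB" for f using R by (auto simp: orbit_def)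
  have iff: "f \<in> weyl n adj \<Longrightarrow> P (wact n adj f R) \<longleftrightarrow> P (wact n adj id R)" for f
  proof (induction f rule: weyl_induct)
    case (ref i f)
    have "P (act i (wact n adj f R)) \<longleftrightarrow> P (wact n adj f R)"
      using step[of "wact n adj f R" i] step[of "act i (wact n adj f R)" i] mem[OF ref(2)] ref(1) by auto
    then show ?case unfolding wact_ref_comp[OF R(1) ref(2,1) orth_wact[OF ref(2) R(1)]] using ref(3) by blast
  qed simp
  show ?thesis using assms(1-3) iff R(2) by (auto simp: orbit_def)
qed

text \<open>Under \<open>ref j\<close> the heights of \<beta> and \<gamma> shift by at most 1 each,
  so a gap of at least 2 is lost only if \<beta> rises and \<gamma> drops. That determines \<gamma>
  and produces the configuration in which admissibility forces
  \<open>act i B = act j B\<close>.\<close>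

lemma up_comm:
  assumes "B \<in> BB" "i < n" "j < n" "i \<noteq> j" "\<not> adj i j" "act i B \<noteq> act j B" "up i B"
  shows "up i (act j B)"
proof (cases "moves j B")
  case False
  then show ?thesis using assms by (simp add: act_fixed)
next
  case True
  have ij: "fund j \<bullet> fund i = 0" "fund i \<bullet> fund j = 0"
    using assms ip_fund_nonadj[of i j] ip_sym[of "fund i" "fund j"] by auto
  have act: "act j B = ref j ` B" "act i B = ref i ` B"
    using True assms moves_not_mem up_moves by (simp_all add: act_ref)
  obtain \<beta> where b: "\<beta> \<in> B" "\<beta> \<bullet> fund i = -1" "\<And>\<gamma>. \<gamma> \<in> B \<Longrightarrow> \<gamma> \<bullet> fund i = 1 \<Longrightarrow> ht \<beta> < ht \<gamma> - 1"
    using assms(7) by (auto simp: up_def)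
  have ipi: "ref j \<gamma> \<bullet> fund i = \<gamma> \<bullet> fund i" for \<gamma> using ij by (simp add: ip_ref_left)
  have "ht (ref j \<beta>) < ht (ref j \<gamma>) - 1" if g: "\<gamma> \<in> B" "\<gamma> \<bullet> fund i = 1" for \<gamma>
  proof (rule ccontr)
    assume neg: "\<not> ?thesis"
    have tie: "ht (ref j \<beta>) \<noteq> ht (ref j \<gamma>) - 1"
      using b g assms(1-3) orth_act[of B j] act(1) by (intro no_tie[of "act j B" i]) (auto simp: ipi)
    have "fund j \<notin> B" using True assms moves_not_mem by simp
    then have cs: "\<delta> \<bullet> fund j = 0 \<or> \<delta> \<bullet> fund j = 1 \<or> \<delta> \<bullet> fund j = -1" if "\<delta> \<in> B" for \<delta>
      using that assms(1,3) by (intro ip_fund_cases orth_pos[of B]) auto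
    have bj: "\<beta> \<bullet> fund j = -1" and gj: "\<gamma> \<bullet> fund j = 1"
      using neg tie b(3)[OF g] cs[OF b(1)] cs[OF g(1)] assms(3) by (auto simp: ht_ref)
    have n2: "\<beta> \<in> norm2" "\<gamma> \<in> norm2" using b(1) g(1) orth_norm2[OF orth_BB[OF assms(1)]] by auto
    have "\<beta> \<bullet> \<gamma> = 0" using b g assms(1) by (intro orth_ip) auto
    have "\<beta> + fund i + fund j \<in> norm2"
      using n2 b bj ij assms(2,3) ip_sym[of "fund i" \<beta>] ip_sym[of "fund j" \<beta>] by (simp add: norm2_def)
    moreover have "\<gamma> \<bullet> (\<beta> + fund i + fund j) = 2"
      using \<open>\<beta> \<bullet> \<gamma> = 0\<close> g gj ip_sym[of \<gamma> \<beta>] by simp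
    ultimately have geq: "\<gamma> = \<beta> + fund i + fund j" using norm2_ip_le[OF n2(2)] by fastforce
    \<comment> \<open>\<open>act i B\<close> now contains \<open>\<beta> + fund i\<close> and
      \<open>\<beta> + fund j\<close>, the pair to which the admissibility condition
      applies.\<close>
    have "ref i \<beta> \<in> act i B" "ref i \<gamma> \<in> act i B" using b(1) g(1) act by auto
    moreover have "ref i \<beta> = \<beta> + fund i" "ref i \<gamma> = \<beta> + fund j"
      using b g geq by (auto simp: ref_raise ref_lower)
    moreover have "(\<lambda>k. (\<beta> + fund i) k - fund i k + fund j k) = \<beta> + fund j" by auto
    ultimately have "act i (act i B) = act j (act i B)"
      using adm assms(1-5) unfolding admissible_def by (metis act_BB)
    then have "act j B = act i B" using assms by (metis act_invol orth_BB act_BB)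
    with assms show False by simp
  qed
  then show ?thesis unfolding act up_def using b by (auto simp: ipi intro!: bexI[of _ \<beta>])
qed

lemma up_comm_iff:
  assumes "B \<in> BB" "i < n" "j < n" "i \<noteq> j" "\<not> adj i j" "act i B \<noteq> act j B"
  shows "up i (act j B) \<longleftrightarrow> up i B"
proof
  assume u: "up i (act j B)"
  have "act i (act j B) \<noteq> act j (act j B)" using assms by (metis act_invol act_BB orth_BB)
  from up_comm[OF _ assms(2-5) this u] show "up i B" using assms by simp
qed (use up_comm[OF assms] in blast)

lemma wf_below: "wfp (\<lambda>B' B. B \<in> BB \<and> B' \<in> BB \<and> below B B')"
proof -
  have "wf {(B', B). B \<in> BB \<and> B' \<in> BB \<and> below B B'}"
  proof (rule finite_acyclic_wf)
    show "finite {(B', B). B \<in> BB \<and> B' \<in> BB \<and> below B B'}"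
      using finite_BB by (auto intro: finite_subset[of _ "BB \<times> BB"])
    have "trans {(B', B). B \<in> BB \<and> B' \<in> BB \<and> below B B'}" using below_trans by (auto intro!: transI)
    then show "acyclic {(B', B). B \<in> BB \<and> B' \<in> BB \<and> below B B'}"
      using below_irrefl by (auto simp: acyclic_def)
  qed
  then show ?thesis by (simp add: wfp_def)
qed

lemma BB_induct_up [consumes 1, case_names up]:
  assumes "B \<in> BB" "\<And>B. B \<in> BB \<Longrightarrow> (\<And>B'. B' \<in> BB \<Longrightarrow> below B B' \<Longrightarrow> P B') \<Longrightarrow> P B"
  shows "P B"
  using assms(1) by (induction B rule: wfp_induct_rule[OF wf_below]) (use assms(2) in blast)

section \<open>Rising paths and the top of the orbit\<close>

inductive rise :: "vec set \<Rightarrow> vec set \<Rightarrow> bool" where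
  "B \<in> BB \<Longrightarrow> j < n \<Longrightarrow> up j B \<Longrightarrow> rise B (act j B)"

lemma rise_confluent:
  assumes "rise\<^sup>*\<^sup>* A B" "rise\<^sup>*\<^sup>* A C" shows "\<exists>D. rise\<^sup>*\<^sup>* B D \<and> rise\<^sup>*\<^sup>* C D"
proof (rule newman[OF _ _ assms])
  show "wfp (\<lambda>y x. rise x y)"
    by (rule wfp_subset[OF wf_below]) (auto simp: up_below elim!: rise.cases)
next
  have loc: "\<exists>D. rise\<^sup>*\<^sup>* (act i A) D \<and> rise\<^sup>*\<^sup>* (act j A) D"
    if "A \<in> BB" "i < n" "j < n" "up i A" "up j A" for A i j
  proof -
    consider "act i A = act j A" | "i \<noteq> j" "\<not> adj i j" "act i A \<noteq> act j A" | "adj i j" by blast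
    then show ?thesis
    proof cases
      case 2
      then have "rise (act i A) (act j (act i A))" "rise (act j A) (act i (act j A))"
        using that adj_sym[of j i] by (auto intro!: rise.intros up_comm)
      then show ?thesis using that 2 act_comm[of A i j] by (metis orth_BB r_into_rtranclp)
    next
      case 3
      then have ji: "adj j i" using that adj_sym by blast
      have "fund i \<notin> A" "fund j \<notin> A" using that up_moves moves_not_mem by auto
      then have "rise (act i A) (act j (act i A))" "rise (act j (act i A)) (act i (act j (act i A)))"
        "rise (act j A) (act i (act j A))" "rise (act i (act j A)) (act j (act i (act j A)))"
        using that 3 ji by (auto intro!: rise.intros up_hexagon up_transfer)
      then show ?thesis using that 3 act_braid[of A i j]
        by (metis orth_BB converse_rtranclp_into_rtranclp r_into_rtranclp)
    qed auto
  qed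
  show "\<exists>u. rise\<^sup>*\<^sup>* y u \<and> rise\<^sup>*\<^sup>* z u" if "rise x y" "rise x z" for x y z
    using that loc by (auto elim!: rise.cases)
qed

text \<open>Rising from any set ends, by finiteness, at some \<open>B0\<close>. Having a rising path
  to \<open>B0\<close> is stable under reflections: a downward reflection prepends a step, and after
  an upward one confluence applies, \<open>B0\<close> admitting no further step. Connectedness of
  the orbit then spreads the property to all sets.\<close>

lemma ex_top: "\<exists>B0\<in>BB. (\<forall>B\<in>BB. rise\<^sup>*\<^sup>* B B0) \<and> (\<forall>j<n. \<not> up j B0)"
proof -
  obtain A where A: "A \<in> BB" using BB_nonempty by blast
  have "\<exists>B0\<in>BB. rise\<^sup>*\<^sup>* B B0 \<and> (\<forall>j<n. \<not> up j B0)" if "B \<in> BB" for B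
    using that
  proof (induction rule: BB_induct_up)
    case (up B)
    show ?case
    proof (cases "\<exists>j<n. local.up j B")
      case True
      then obtain j where j: "j < n" "local.up j B" by blast
      then have "rise B (act j B)" using up(1) by (auto intro: rise.intros)
      then show ?thesis using up(2)[of "act j B"] j up(1) up_below
        by (metis act_BB converse_rtranclp_into_rtranclp orth_BB)
    qed (use up(1) in blast)
  qed
  then obtain B0 where B0: "B0 \<in> BB" "rise\<^sup>*\<^sup>* A B0" "\<forall>j<n. \<not> up j B0" using A by blast
  have "rise\<^sup>*\<^sup>* B B0" if "B \<in> BB" for B
    using A B0(2) that
  proof (rule BB_connected[where P="\<lambda>B. rise\<^sup>*\<^sup>* B B0"])
    fix C i assume C: "C \<in> BB" "i < n" "rise\<^sup>*\<^sup>* C B0"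
    consider "\<not> moves i C" | "up i C" | "up i (act i C)" using C up_or_up_act[of C i] by auto
    then show "rise\<^sup>*\<^sup>* (act i C) B0"
    proof cases
      case 1
      then show ?thesis using C by (simp add: act_fixed)
    next
      case 2
      then have "rise\<^sup>*\<^sup>* C (act i C)" using C by (auto intro: rise.intros)
      then obtain D where D: "rise\<^sup>*\<^sup>* (act i C) D" "rise\<^sup>*\<^sup>* B0 D" using rise_confluent C(3) by blast
      have "\<not> rise B0 E" for E using B0(3) by (auto elim: rise.cases)
      then have "D = B0" using D(2) by (metis converse_rtranclpE)
      with D show ?thesis by simp
    next
      case 3
      then have "rise (act i C) C" using C rise.intros[of "act i C" i] by simp
      with C(3) show ?thesis by (rule converse_rtranclp_into_rtranclp[rotated])
    qed
  qed
  with B0 show ?thesis by blast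
qed

section \<open>Confluence of the rewriting of pairs\<close>

lemma up_not_perp: "B \<in> BB \<Longrightarrow> i < n \<Longrightarrow> up i B \<Longrightarrow> \<not> perp_to i B"
  by (metis orth_BB perp_not_moves up_moves)

lemma up_not_mem: "B \<in> BB \<Longrightarrow> i < n \<Longrightarrow> up i B \<Longrightarrow> fund i \<notin> B"
  using moves_not_mem up_moves by auto

lemma up_act_not_perp: "B \<in> BB \<Longrightarrow> i < n \<Longrightarrow> up i B \<Longrightarrow> \<not> perp_to i (act i B)"
  by (metis act_BB orth_BB perp_not_moves moves_act up_moves)

text \<open>The rewriting of pairs \<open>(B, i)\<close> that preserves \<open>h\<^sub>B\<^sub>,\<^sub>i\<close>.\<close>

inductive pstep :: "vec set \<times> nat \<Rightarrow> vec set \<times> nat \<Rightarrow> bool" where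
  far: "B \<in> BB \<Longrightarrow> i < n \<Longrightarrow> perp_to i B \<Longrightarrow> j < n \<Longrightarrow> \<not> adj j i \<Longrightarrow> up j B \<Longrightarrow> pstep (B, i) (act j B, i)"
| near: "B \<in> BB \<Longrightarrow> i < n \<Longrightarrow> perp_to i B \<Longrightarrow> j < n \<Longrightarrow> adj j i \<Longrightarrow> up j B \<Longrightarrow> pstep (B, i) (act i (act j B), j)"

text \<open>The case \<open>j = i\<close> cannot arise: \<open>up j B\<close> means that
  \<open>B\<close> is moved by \<open>j\<close>, whereas it is orthogonal to
  \<open>fund i\<close>.\<close>

lemma pstep_far:
  assumes "B \<in> BB" "i < n" "perp_to i B" "j < n" "\<not> adj j i" "up j B"
  shows "perp_to i (act j B)" "below B (act j B)"
proof -
  have "\<not> adj i j" "i \<noteq> j" using assms adj_sym up_not_perp by blast+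
  then show "perp_to i (act j B)" "below B (act j B)" using assms by (auto simp: perp_act_nonadj up_below)
qed

lemma pstep_near:
  assumes "B \<in> BB" "i < n" "perp_to i B" "j < n" "adj j i" "up j B"
  shows "perp_to j (act i (act j B))" "below B (act i (act j B))" "up i (act j B)"
proof -
  have ij: "adj i j" using assms adj_sym by blast
  show "perp_to j (act i (act j B))" using assms ij by (intro perp_act_act) auto
  show u: "up i (act j B)" using assms ij by (intro up_perp) auto
  show "below B (act i (act j B))"
    using below_trans[OF up_below up_below] u assms by (metis act_BB orth_BB)
qed

lemma pstep_inv:
  assumes "pstep (B, i) (B', i')"
  shows "B \<in> BB" "B' \<in> BB" "i' < n" "perp_to i' B'" "below B B'"
  using assms pstep_far pstep_near by (auto elim!: pstep.cases)

abbreviation joinable :: "vec set \<times> nat \<Rightarrow> vec set \<times> nat \<Rightarrow> bool" where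
  "joinable x y \<equiv> \<exists>u. pstep\<^sup>*\<^sup>* x u \<and> pstep\<^sup>*\<^sup>* y u"

text \<open>Neither reflection touches the second component, so the square or hexagon above
  \<open>B\<close> lifts to pairs, orthogonality to \<open>fund i\<close> being carried along its
  sides.\<close>

lemma joinable_far_far:
  assumes B: "B \<in> BB" "i < n" "perp_to i B" and j: "j < n" "\<not> adj j i" "up j B"
    and k: "k < n" "\<not> adj k i" "up k B"
  shows "joinable (act j B, i) (act k B, i)"
proof -
  note f = pstep_far[OF B j] pstep_far[OF B k]
  consider "act j B = act k B" | "j \<noteq> k" "\<not> adj j k" "act j B \<noteq> act k B" | "adj j k" by blast
  then show ?thesis
  proof cases
    case 2
    have "\<not> adj k j" using 2 adj_sym j k by blast
    then have "pstep (act j B, i) (act k (act j B), i)" "pstep (act k B, i) (act j (act k B), i)"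
      using B j k 2 f by (auto intro!: pstep.far up_comm)
    then show ?thesis using act_comm[of B j k] B j k 2 by (metis orth_BB r_into_rtranclp)
  next
    case 3
    then have kj: "adj k j" using adj_sym j k by blast
    have u: "up k (act j B)" "up j (act k B)" using B j k 3 kj by (auto intro!: up_hexagon)
    have u2: "up j (act k (act j B))" "up k (act j (act k B))"
      using B j k 3 kj up_not_mem by (auto intro!: up_transfer)
    have p: "perp_to i (act k (act j B))" "perp_to i (act j (act k B))"
      using pstep_far[OF _ B(2) f(1) k(1,2) u(1)] pstep_far[OF _ B(2) f(3) j(1,2) u(2)] B j k by auto
    have "pstep (act j B, i) (act k (act j B), i)" "pstep (act k (act j B), i) (act j (act k (act j B)), i)"
      "pstep (act k B, i) (act j (act k B), i)" "pstep (act j (act k B), i) (act k (act j (act k B)), i)"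
      using B j k u u2 p f by (auto intro!: pstep.far)
    then show ?thesis using act_braid[of B j k] B j k 3
      by (metis orth_BB converse_rtranclp_into_rtranclp r_into_rtranclp)
  qed auto
qed

text \<open>Nonadjacent \<open>j\<close>, \<open>k\<close> give a square. Otherwise
  \<open>i\<close>, \<open>j\<close>, \<open>k\<close> form a path with end nodes \<open>i\<close>
  and \<open>k\<close>, and the two routes differ by relations of type A3.\<close>

lemma joinable_near_far:
  assumes B: "B \<in> BB" "i < n" "perp_to i B" and j: "j < n" "adj j i" "up j B"
    and k: "k < n" "\<not> adj k i" "up k B"
  shows "joinable (act i (act j B), j) (act k B, i)"
proof -
  note f = pstep_near[OF B j] pstep_far[OF B k]
  have ij: "adj i j" and ik: "\<not> adj i k" "i \<noteq> k" "j \<noteq> k" using adj_sym B j k up_not_perp by blast+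
  define X where "X = act j B"
  have X: "X \<in> BB" "up i X" "perp_to j (act i X)" using B j f by (auto simp: X_def)
  show ?thesis
  proof (cases "adj j k")
    case False
    then have kj: "\<not> adj k j" using adj_sym j k by blast
    \<comment> \<open>\<open>act k B\<close> is still orthogonal to \<open>fund i\<close>, while
      \<open>i\<close> leads upwards from \<open>act j B\<close>.\<close>
    have ne: "act j B \<noteq> act k B" using f B j up_not_perp[of "act j B" i] by auto
    have u: "up k X" "up j (act k B)" unfolding X_def using B j k False kj ne ik by (auto intro!: up_comm)
    have comm: "act k X = act j (act k B)" unfolding X_def using B j k kj ik act_comm[of B k j] by auto
    then have "act k X \<noteq> act i X" using up_act_not_perp[of "act k B" j] u X B j k by auto
    then have "up k (act i X)" using X u B k ik by (auto intro!: up_comm)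
    then have "pstep (act i X, j) (act k (act i X), j)" using X B j k kj by (auto intro!: pstep.far)
    moreover have "pstep (act k B, i) (act i (act j (act k B)), j)" using B j k u f by (auto intro!: pstep.near)
    moreover have "act k (act i X) = act i (act j (act k B))"
      using comm act_comm[of X k i] X B k ik by auto
    ultimately show ?thesis unfolding X_def by (metis r_into_rtranclp)
  next
    case True
    then have kj: "adj k j" using adj_sym j k by blast
    \<comment> \<open>Both routes end at \<open>(act i (act j (act i Y)), k)\<close>: the first by a
      near step and a far step, the second by two near steps and a final braid relation.\<close>
    define Y where "Y = act k X"
    define Z where "Z = act j (act k B)"
    have u: "up k X" "up j (act k B)" unfolding X_def using B j k True kj by (auto intro!: up_hexagon)
    have Y: "Y \<in> BB" "up j Y"
      unfolding Y_def X_def using B j k True kj up_not_mem by (auto intro!: up_transfer)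
    have Z: "Z \<in> BB" "up k Z" "up i Z" "perp_to j (act i Z)"
      unfolding Z_def using B j k True kj up_not_mem u f pstep_near[of "act k B" i j] by (auto intro!: up_transfer)
    have ne: "act i X \<noteq> act k X" using X Y B j up_not_perp[of Y j] by (auto simp: Y_def)
    have "up k (act i X)" and iY: "up i Y"
      unfolding Y_def using X u B k ik ne ne[symmetric] by (auto intro!: up_comm)
    then have "pstep (act i X, j) (act j (act k (act i X)), k)" using X B j k kj by (auto intro!: pstep.near)
    moreover have ki: "act k (act i X) = act i Y" unfolding Y_def using act_comm[of X k i] X B k ik by auto
    moreover have "perp_to k (act j (act k (act i X)))"
      using X B j k kj True \<open>up k (act i X)\<close> pstep_near[of "act i X" j k] by auto
    moreover have "up i (act j (act i Y))" using Y B j ij iY up_not_mem by (auto intro!: up_transfer)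
    ultimately have 1: "pstep\<^sup>*\<^sup>* (act i X, j) (act i (act j (act i Y)), k)"
      using X Y B j k ik pstep.far[of "act j (act i Y)" k i]
      by (metis act_BB converse_rtranclp_into_rtranclp r_into_rtranclp)
    have kZ: "act k Z = act j Y" unfolding Z_def Y_def X_def using act_braid[of B k j] B j k kj by auto
    then have "act k Z \<noteq> act i Z" using Z up_act_not_perp[of Y j] Y j by auto
    then have "up k (act i Z)" using Z B k ik by (auto intro!: up_comm)
    then have "pstep (act i Z, j) (act j (act k (act i Z)), k)" using Z B j k kj by (auto intro!: pstep.near)
    moreover have "act k (act i Z) = act i (act j Y)" using kZ act_comm[of Z k i] Z B k ik by auto
    moreover have "act j (act i (act j Y)) = act i (act j (act i Y))" using act_braid[of Y i j] Y B j ij by auto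
    moreover have "pstep (act k B, i) (act i Z, j)" unfolding Z_def using B j k u f by (auto intro!: pstep.near)
    ultimately have "pstep\<^sup>*\<^sup>* (act k B, i) (act i (act j (act i Y)), k)"
      by (metis converse_rtranclp_into_rtranclp r_into_rtranclp)
    with 1 show ?thesis unfolding X_def by blast
  qed
qed

text \<open>If \<open>r\<^sub>jB = r\<^sub>kB\<close>, the pair \<open>(B, i)\<close> would rewrite to \<open>(D, j)\<close> and \<open>(D, k)\<close> with the same \<open>D\<close>,
  and these need not be joinable.\<close>

lemma near_near_distinct:
  assumes B: "B \<in> BB" "i < n" "perp_to i B" and j: "j < n" "adj j i" "up j B"
    and k: "k < n" "adj k i" "up k B" and jk: "j \<noteq> k" "\<not> adj j k"
  shows "act j B \<noteq> act k B"
proof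
  assume eq: "act j B = act k B"
  have nin: "fund j \<notin> B" "fund k \<notin> B" using B j k up_not_mem by blast+
  have z: "fund j \<bullet> fund k = 0" "fund k \<bullet> fund j = 0"
    using ip_fund_nonadj[of j k] j k jk ip_sym[of "fund j" "fund k"] by auto
  have m: "fund i \<bullet> fund j = -1" "fund j \<bullet> fund i = -1" "fund i \<bullet> fund k = -1" "fund k \<bullet> fund i = -1"
    using B j k ip_fund_adj adj_sym by auto
  obtain \<beta> where b: "\<beta> \<in> B" "\<beta> \<bullet> fund j = -1" "\<And>\<gamma>. \<gamma> \<in> B \<Longrightarrow> \<gamma> \<bullet> fund j = 1 \<Longrightarrow> ht \<beta> < ht \<gamma> - 1"
    using j(3) by (auto simp: up_def)
  have n2: "\<beta> \<in> norm2" "\<beta> \<bullet> \<beta> = 2" and pos: "\<beta> \<in> pos_roots n adj"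
    using orth_norm2[OF orth_BB[OF B(1)] b(1)] orth_pos[OF orth_BB[OF B(1)] b(1)] by (auto simp: norm2_def)
  have "ref j ` B = ref k ` B" using eq act_ref B j k nin by auto
  then obtain \<gamma> where g: "\<gamma> \<in> B" "ref j \<beta> = ref k \<gamma>" using b(1) by blast
  then have g': "\<gamma> = ref k (\<beta> + fund j)" using k b(2) by (metis ref_raise ref_ref)
  have ip': "(\<beta> + fund j) \<bullet> fund k = \<beta> \<bullet> fund k" using z by simp
  have "\<beta> \<noteq> fund k" using nin b(1) by auto
  \<comment> \<open>\<gamma> is the root of \<open>B\<close> that \<open>ref k\<close> sends to
    \<open>\<beta> + fund j\<close>. The three cases contradict orthogonality of \<beta> and
    \<gamma>, the gap required by \<open>up j B\<close>, and positivity of \<beta>,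
    respectively.\<close>
  then consider "\<beta> \<bullet> fund k = 0" | "\<beta> \<bullet> fund k = 1" | "\<beta> \<bullet> fund k = -1"
    using ip_fund_cases[OF pos k(1)] by blast
  then show False
  proof cases
    case 1
    then have "\<gamma> = \<beta> + fund j" using g' ip' by (simp add: ref_fix)
    then have 2: "\<beta> \<bullet> \<gamma> = 1" using n2 b(2) by simp
    then have "\<beta> \<noteq> \<gamma>" using n2(2) by auto
    with 2 show False using orth_ip[OF orth_BB[OF B(1)] b(1) g(1)] by simp
  next
    case 2
    then have "\<gamma> = \<beta> + fund j - fund k" using g' ip' by (simp add: ref_lower)
    then have "\<gamma> \<bullet> fund j = 1" "ht \<gamma> = ht \<beta>" using b(2) z j k by auto
    then show False using b(3)[OF g(1)] by simp
  next
    case 3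
    have "fund i + fund j + fund k \<in> norm2" using m z B j k by (auto simp: norm2_def)
    moreover have "\<beta> \<bullet> (fund i + fund j + fund k) = -2" using 3 b B by (simp add: perp_iff)
    ultimately have "\<beta> = - (fund i + fund j + fund k)" using norm2_ip_ge[OF n2(1)] by fastforce
    then show False using ht_pos_root[OF pos] B j k by simp
  qed
qed

text \<open>Without triangles \<open>j\<close> and \<open>k\<close> are nonadjacent. Each branch
  continues with a far step and a near step that restores the node \<open>i\<close>; the resulting
  words \<open>r_j r_i r_k r_i r_j\<close> and \<open>r_k r_i r_j r_i r_k\<close> agree in the Weyl
  group.\<close>

lemma joinable_near_near:
  assumes B: "B \<in> BB" "i < n" "perp_to i B" and j: "j < n" "adj j i" "up j B"
    and k: "k < n" "adj k i" "up k B" and jk: "j \<noteq> k"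
  shows "joinable (act i (act j B), j) (act i (act k B), k)"
proof -
  have nadj: "\<not> adj j k" "\<not> adj k j" using no_triangle B j k adj_sym by blast+
  have step: "pstep\<^sup>*\<^sup>* (act i (act j B), j) (act j (act i (act k (act i (act j B)))), i)"
    if j: "j < n" "adj j i" "up j B" and k: "k < n" "adj k i" "up k B" and jk: "j \<noteq> k" "\<not> adj j k" for j k
  proof -
    have ad: "adj i j" "adj i k" "\<not> adj k j" using B j k jk adj_sym by blast+
    define X where "X = act j B"
    have X: "X \<in> BB" "up i X" "perp_to j (act i X)" using B j pstep_near[OF B j] by (auto simp: X_def)
    have "up k X" unfolding X_def
      using near_near_distinct[OF B j k jk] B j k jk ad by (auto intro!: up_comm)
    then have u: "up k (act i X)" "up i (act k (act i X))"
      using X B k ad up_not_mem by (auto intro!: up_hexagon up_transfer)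
    then have "perp_to j (act k (act i X))" using X B j k ad pstep_far[of "act i X" j k] by auto
    with u have "pstep (act i X, j) (act k (act i X), j)"
      "pstep (act k (act i X), j) (act j (act i (act k (act i X))), i)"
      using X B j k ad by (auto intro!: pstep.intros)
    then show ?thesis unfolding X_def by (metis converse_rtranclp_into_rtranclp r_into_rtranclp)
  qed
  have ad: "adj i j" "adj i k" using B j k adj_sym by blast+
  have "act j (act i (act k (act i (act j B)))) = act j (act k (act i (act k (act j B))))"
    using act_braid[of "act j B" i k] B j k ad by simp
  also have "\<dots> = act k (act j (act i (act j (act k B))))"
    using act_comm[of B k j] act_comm[of "act i (act j (act k B))" j k] B j k nadj jk by simp
  also have "\<dots> = act k (act i (act j (act i (act k B))))"
    using act_braid[of "act k B" i j] B j k ad by simp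
  finally show ?thesis using step[OF j k jk nadj(1)] step[OF k j jk[symmetric] nadj(2)] by auto
qed

lemma pstep_confluent:
  assumes "pstep\<^sup>*\<^sup>* x y" "pstep\<^sup>*\<^sup>* x z" shows "joinable y z"
proof (rule newman[OF _ _ assms])
  show "wfp (\<lambda>y x. pstep x y)"
    by (rule wfp_if_convertible_to_wfp[OF wf_below, where f=fst]) (auto dest: pstep_inv)
next
  fix x y z assume "pstep x y" "pstep x z"
  then show "joinable y z"
  proof (elim pstep.cases, goal_cases)
    case (1 B i j B' i' k)
    then show ?case using joinable_far_far[of B i j k] by simp
  next
    case (2 B i j B' i' k)
    then show ?case using joinable_near_far[of B i k j] by auto
  next
    case (3 B i j B' i' k)
    then show ?case using joinable_near_far[of B i j k] by auto
  next
    case (4 B i j B' i' k)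
    then show ?case using joinable_near_near[of B i j k] by (cases "j = k") auto
  qed
qed

section \<open>The top set and the terminal node of a pair\<close>

definition B0 :: "vec set" where
  "B0 = (SOME B0. B0 \<in> BB \<and> (\<forall>B\<in>BB. rise\<^sup>*\<^sup>* B B0) \<and> (\<forall>j<n. \<not> up j B0))"

lemma B0_BB [simp]: "B0 \<in> BB" and rise_B0: "B \<in> BB \<Longrightarrow> rise\<^sup>*\<^sup>* B B0" and not_up_B0: "j < n \<Longrightarrow> \<not> up j B0"
proof -
  have "B0 \<in> BB \<and> (\<forall>B\<in>BB. rise\<^sup>*\<^sup>* B B0) \<and> (\<forall>j<n. \<not> up j B0)"
    unfolding B0_def by (rule someI_ex) (use ex_top in blast)
  then show "B0 \<in> BB" "B \<in> BB \<Longrightarrow> rise\<^sup>*\<^sup>* B B0" "j < n \<Longrightarrow> \<not> up j B0" by auto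
qed

lemma ex_up: assumes "B \<in> BB" "B \<noteq> B0" shows "\<exists>j<n. up j B"
  using rise_B0[OF assms(1)] assms(2) by (cases rule: converse_rtranclpE) (auto elim: rise.cases)

text \<open>\<open>h\<^sub>B\<^sub>,\<^sub>i\<close> is the image of the generator with index \<open>kap B i\<close>.\<close>

definition kap :: "vec set \<Rightarrow> nat \<Rightarrow> nat" where
  "kap B i = (SOME k. pstep\<^sup>*\<^sup>* (B, i) (B0, k))"

lemma ex_pstep_B0:
  assumes "B \<in> BB" "i < n" "perp_to i B" shows "\<exists>k. pstep\<^sup>*\<^sup>* (B, i) (B0, k)"
  using assms
proof (induction B arbitrary: i rule: BB_induct_up)
  case (up B)
  show ?case
  proof (cases "B = B0")
    case False
    then obtain j where "j < n" "local.up j B" using ex_up up by blast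
    then obtain B' i' where "pstep (B, i) (B', i')" using up pstep.intros[of B i j] by blast
    then show ?thesis using up(2)[of B' i'] pstep_inv by (meson converse_rtranclp_into_rtranclp)
  qed auto
qed

lemma not_pstep_B0: "\<not> pstep (B0, i) x"
  using not_up_B0 by (auto elim: pstep.cases)

lemma kap_eqI: assumes "pstep\<^sup>*\<^sup>* (B, i) (B0, k)" shows "kap B i = k"
proof -
  have "pstep\<^sup>*\<^sup>* (B, i) (B0, kap B i)" unfolding kap_def using assms by (rule someI)
  then obtain u where "pstep\<^sup>*\<^sup>* (B0, kap B i) u" "pstep\<^sup>*\<^sup>* (B0, k) u" using pstep_confluent assms by blast
  then show ?thesis by (metis converse_rtranclpE not_pstep_B0 prod.inject)
qed

lemma pstep_kap: "B \<in> BB \<Longrightarrow> i < n \<Longrightarrow> perp_to i B \<Longrightarrow> pstep\<^sup>*\<^sup>* (B, i) (B0, kap B i)"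
  using ex_pstep_B0 kap_eqI by blast

lemma psteps_inv:
  assumes "pstep\<^sup>*\<^sup>* x y" "fst x \<in> BB" "snd x < n" "perp_to (snd x) (fst x)"
  shows "fst y \<in> BB \<and> snd y < n \<and> perp_to (snd y) (fst y)"
  using assms
proof (induction rule: rtranclp_induct)
  case (step y z)
  then show ?case using pstep_inv[of "fst y" "snd y" "fst z" "snd z"] by simp
qed simp

lemma kap_lt: "B \<in> BB \<Longrightarrow> i < n \<Longrightarrow> perp_to i B \<Longrightarrow> kap B i < n"
  and kap_perp: "B \<in> BB \<Longrightarrow> i < n \<Longrightarrow> perp_to i B \<Longrightarrow> perp_to (kap B i) B0"
  using psteps_inv[OF pstep_kap] by auto

lemma kap_B0: "kap B0 i = i"
  by (rule kap_eqI) simp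

lemma kap_pstep:
  assumes "pstep (B, i) (B', i')" shows "kap B' i' = kap B i"
proof -
  have "pstep\<^sup>*\<^sup>* (B', i') (B0, kap B' i')" using pstep_kap pstep_inv[OF assms] by blast
  then have "kap B i = kap B' i'" using assms by (intro kap_eqI) (rule converse_rtranclp_into_rtranclp)
  then show ?thesis by simp
qed

lemma kap_near:
  "B \<in> BB \<Longrightarrow> i < n \<Longrightarrow> perp_to i B \<Longrightarrow> j < n \<Longrightarrow> adj j i \<Longrightarrow> up j B \<Longrightarrow> kap (act i (act j B)) j = kap B i"
  by (intro kap_pstep pstep.near)

text \<open>If \<open>j\<close> leads downwards, the rewriting step is read backwards from
  \<open>act j B\<close>, so direction does not matter here.\<close>

lemma kap_far:
  assumes "B \<in> BB" "i < n" "perp_to i B" "j < n" "j \<noteq> i" "\<not> adj j i" shows "kap (act j B) i = kap B i"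
proof -
  have p: "perp_to i (act j B)" using assms adj_sym perp_act_nonadj[of B i j] by auto
  consider "\<not> moves j B" | "up j B" | "up j (act j B)" using assms up_or_up_act[of B j] by auto
  then show ?thesis
  proof cases
    case 3
    then have "pstep (act j B, i) (B, i)" using pstep.far[of "act j B" i j] assms p by simp
    then show ?thesis by (metis kap_pstep)
  qed (use assms in \<open>auto simp: act_fixed intro!: kap_pstep pstep.far\<close>)
qed

text \<open>Distinct nodes may end at the same generator, which of course commutes with itself;
  hence the first alternative.\<close>

lemma kap_nonadj:
  assumes "B \<in> BB" "i < n" "j < n" "perp_to i B" "perp_to j B" "i \<noteq> j" "\<not> adj i j"
  shows "kap B i = kap B j \<or> \<not> adj (kap B i) (kap B j)"
  using assms
proof (induction B arbitrary: i j rule: BB_induct_up)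
  case (up B)
  have ji: "\<not> adj j i" using up adj_sym by blast
  show ?case
  proof (cases "B = B0")
    case True
    with up show ?thesis by (simp add: kap_B0)
  next
    case False
    then obtain k where k: "k < n" "local.up k B" using ex_up up by blast
    have ne: "k \<noteq> i" "k \<noteq> j" using k up up_not_perp by blast+
    \<comment> \<open>Lifting along \<open>k\<close> turns the nodes \<open>i\<close>,
      \<open>j\<close> into \<open>k\<close>, \<open>j\<close> over a higher set, again nonadjacent.
      Both orders of adjacency are proved so that the statement can be used with \<open>i\<close>
      and \<open>j\<close> exchanged.\<close>
    have mixed: "kap B i = kap B j \<or> \<not> adj (kap B i) (kap B j) \<and> \<not> adj (kap B j) (kap B i)"
      if i: "i < n" "perp_to i B" and j: "j < n" "perp_to j B" "i \<noteq> j" "\<not> adj i j" "\<not> adj j i"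
        and ki: "adj k i" "\<not> adj k j" and ne: "k \<noteq> i" "k \<noteq> j" for i j
    proof -
      have jk: "\<not> adj j k" using j k ki adj_sym by blast
      note near = pstep_near[OF up(1) i k(1) ki(1) k(2)]
      have pj: "perp_to j (act k B)" using pstep_far[OF up(1) j(1,2) k(1) ki(2) k(2)] by blast
      then have pj2: "perp_to j (act i (act k B))" using i j k up(1) perp_act_nonadj[of "act k B" j i] by auto
      have "kap B i = kap (act i (act k B)) k" using kap_near up(1) i k ki by simp
      moreover have "kap B j = kap (act i (act k B)) j"
        using kap_far[of B j k] kap_far[of "act k B" j i] up(1) i j k ki ne pj by simp
      ultimately show ?thesis
        using up(2)[of "act i (act k B)" k j] up(2)[of "act i (act k B)" j k] near pj2 up(1) i j k ki ne jk by auto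
    qed
    consider "\<not> adj k i" "\<not> adj k j" | "adj k i" "\<not> adj k j" | "\<not> adj k i" "adj k j" | "adj k i" "adj k j" by blast
    then show ?thesis
    proof cases
      case 1
      then show ?thesis
        using up(2)[of "act k B" i j] kap_far[of B i k] kap_far[of B j k] up k ne
          pstep_far[of B i k] pstep_far[of B j k] by auto
    next
      case 2
      then show ?thesis using mixed[of i j] up ji ne by auto
    next
      case 3
      then show ?thesis using mixed[of j i] up ji ne by auto
    next
      case 4
      define X where "X = act k B"
      have X: "X \<in> BB" using up k by (simp add: X_def)
      have ad: "adj i k" "adj j k" using 4 up k adj_sym by blast+
      note ni = pstep_near[OF up(1) up(3) up(5) k(1) 4(1) k(2), folded X_def]
      note nj = pstep_near[OF up(1) up(4) up(6) k(1) 4(2) k(2), folded X_def]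
      have ki: "kap B i = kap (act i X) k" and kj: "kap B j = kap (act j X) k"
        using kap_near up k 4 by (simp_all add: X_def)
      show ?thesis
      proof (cases "act i X = act j X")
        case True
        then show ?thesis using ki kj by simp
      next
        case False
        \<comment> \<open>Over \<open>D\<close> both pairs have moved up by two near steps each, and
          the nodes \<open>i\<close> and \<open>j\<close> have changed places.\<close>
        define D where "D = act k (act j (act i X))"
        have comm: "act i (act j X) = act j (act i X)" using act_comm[of X i j] up X by simp
        have u: "local.up j (act i X)" "local.up i (act j X)"
          using False X ni nj up ji by (auto intro!: up_comm)
        note di = pstep_near[OF _ k(1) ni(1) up(4) ad(2) u(1), folded D_def]
        note dj = pstep_near[OF _ k(1) nj(1) up(3) ad(1) u(2), unfolded comm, folded D_def]
        have "kap B i = kap D j" "kap B j = kap D i"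
          using ki kj kap_near[of "act i X" k j] kap_near[of "act j X" k i] ni nj u ad X up k comm
          by (auto simp: D_def)
        moreover have "below B D" using below_trans[OF ni(2) di(2)] X up by simp
        ultimately show ?thesis using up(2)[of D j i] di(1) dj(1) X up k ji by (auto simp: D_def)
      qed
    qed
  qed
qed

text \<open>Induction from the top as for nonadjacent nodes. An upward node adjacent to both would
  close a triangle, so at most one of \<open>i\<close>, \<open>j\<close> is replaced.\<close>

lemma kap_adj:
  assumes "B \<in> BB" "i < n" "j < n" "perp_to i B" "perp_to j B" "adj i j"
  shows "adj (kap B i) (kap B j)"
  using assms
proof (induction B arbitrary: i j rule: BB_induct_up)
  case (up B)
  have ji: "adj j i" using up adj_sym by blast
  show ?case
  proof (cases "B = B0")
    case True
    with up show ?thesis by (simp add: kap_B0)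
  next
    case False
    then obtain k where k: "k < n" "local.up k B" using ex_up up by blast
    have ne: "k \<noteq> i" "k \<noteq> j" using k up up_not_perp by blast+
    have mixed: "adj (kap B i) (kap B j) \<and> adj (kap B j) (kap B i)"
      if i: "i < n" "perp_to i B" and j: "j < n" "perp_to j B" "adj i j" "adj j i"
        and ki: "adj k i" "\<not> adj k j" and ne: "k \<noteq> i" "k \<noteq> j" for i j
    proof -
      have jk: "\<not> adj j k" and ik: "adj i k" using i j k ki adj_sym by blast+
      note near = pstep_near[OF up(1) i k(1) ki(1) k(2)]
      have pj: "perp_to j (act k B)" using pstep_far[OF up(1) j(1,2) k(1) ki(2) k(2)] by blast
      \<comment> \<open>Over \<open>D\<close> the pair of nodes \<open>i\<close>, \<open>j\<close>
        has become \<open>k\<close>, \<open>i\<close>: the first by a near and a far step, the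
        second by a far and a near step.\<close>
      define D where "D = act j (act i (act k B))"
      have n2: "perp_to i D" "below (act k B) D"
        using pstep_near[OF _ j(1) pj i(1) j(3) near(3)] up(1) k by (auto simp: D_def)
      have pk: "perp_to k D"
        using near(1) perp_act_nonadj[of "act i (act k B)" k j] up(1) i j k ki ne by (auto simp: D_def)
      have "below B D" using below_trans[OF up_below n2(2)] up(1) k by simp
      moreover have "kap B i = kap D k"
        using kap_near[of B i k] kap_far[of "act i (act k B)" k j] near up(1) i j k ki ne jk by (auto simp: D_def)
      moreover have "kap B j = kap D i"
        using kap_far[of B j k] kap_near[of "act k B" j i] pj near up(1) i j k ki ne by (auto simp: D_def)
      ultimately show ?thesis
        using up(2)[of D k i] up(2)[of D i k] n2 pk up(1) i j k ki ik by (auto simp: D_def)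
    qed
    consider "\<not> adj k i" "\<not> adj k j" | "adj k i" "\<not> adj k j" | "\<not> adj k i" "adj k j" | "adj k i" "adj k j" by blast
    then show ?thesis
    proof cases
      case 1
      then show ?thesis
        using up(2)[of "act k B" i j] kap_far[of B i k] kap_far[of B j k] up k ne
          pstep_far[of B i k] pstep_far[of B j k] by auto
    next
      case 2
      then show ?thesis using mixed[of i j] up ji ne by auto
    next
      case 3
      then show ?thesis using mixed[of j i] up ji ne by auto
    next
      case 4
      then show ?thesis using no_triangle[of k i j] up k adj_sym by blast
    qed
  qed
qed

end

subsection \<open>The Hecke algebra\<close>

lemma fa_mult_Nil: "fa_mult x y [] = x [] * y []"
  by (simp add: fa_mult_def)

lemma fa_mult_Cons: "fa_mult x y (a # w) = x [] * y (a # w) + fa_mult (\<lambda>u. x (a # u)) y w"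
  by (simp add: fa_mult_def sum.atLeast0_atMost_Suc_shift del: sum.cl_ivl_Suc)

lemma fa_mult_add_left: "fa_mult (fa_add x y) z = fa_add (fa_mult x z) (fa_mult y z)"
  and fa_mult_add_right: "fa_mult z (fa_add x y) = fa_add (fa_mult z x) (fa_mult z y)"
  and fa_mult_diff_left: "fa_mult (fa_diff x y) z = fa_diff (fa_mult x z) (fa_mult y z)"
  and fa_mult_diff_right: "fa_mult z (fa_diff x y) = fa_diff (fa_mult z x) (fa_mult z y)"
  by (auto simp: fa_mult_def fa_add_def fa_diff_def algebra_simps sum.distrib sum_subtractf)

lemma fa_mult_scal_left: "fa_mult (fa_scal c x) y = fa_scal c (fa_mult x y)"
  and fa_mult_scal_right: "fa_mult x (fa_scal c y) = fa_scal c (fa_mult x y)"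
  by (auto simp: fa_mult_def fa_scal_def algebra_simps sum_distrib_left)

lemma fa_mult_zero_left [simp]: "fa_mult fa_zero x = fa_zero"
  and fa_mult_zero_right [simp]: "fa_mult x fa_zero = fa_zero"
  by (auto simp: fa_mult_def fa_zero_def)

text \<open>Peeling off the first letter of the word keeps the factors of the same shape after a
  shift of arguments; this replaces a double sum over cut points.\<close>

lemma fa_mult_assoc: "fa_mult (fa_mult x y) z = fa_mult x (fa_mult y z)"
proof
  fix w show "fa_mult (fa_mult x y) z w = fa_mult x (fa_mult y z) w"
  proof (induction w arbitrary: x y)
    case (Cons a w)
    have "(\<lambda>u. fa_mult x y (a # u)) =
        fa_add (fa_scal (x []) (\<lambda>u. y (a # u))) (fa_mult (\<lambda>u. x (a # u)) y)"
      by (auto simp: fa_mult_Cons fa_add_def fa_scal_def)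
    then show ?case
      by (simp add: fa_mult_Cons fa_mult_Nil fa_mult_add_left fa_mult_scal_left)
        (simp add: fa_add_def fa_scal_def Cons algebra_simps)
  qed (simp add: fa_mult_Nil)
qed

lemma mono_Nil_mult [simp]: "fa_mult (mono []) x = x"
proof
  have "(\<lambda>u. mono [] (a # u)) = fa_zero" for a by (auto simp: mono_def fa_zero_def)
  then show "fa_mult (mono []) x w = x w" for w
    by (cases w) (simp_all add: fa_mult_Nil fa_mult_Cons, simp_all add: fa_zero_def mono_def)
qed

lemma mono_mult: "fa_mult (mono u) (mono v) = mono (u @ v)"
proof
  show "fa_mult (mono u) (mono v) w = mono (u @ v) w" for w
  proof (induction u arbitrary: w)
    case (Cons a u)
    have eq: "(\<lambda>w. mono (a # u) (b # w)) = (if b = a then mono u else fa_zero)" for b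
      by (auto simp: mono_def fa_zero_def)
    show ?case
    proof (cases w)
      case (Cons b w')
      have "fa_mult (mono (a # u)) (mono v) w = (if b = a then fa_mult (mono u) (mono v) w' else 0)"
        unfolding Cons fa_mult_Cons eq by (auto simp: mono_def fa_mult_def fa_zero_def)
      then show ?thesis using Cons.IH[of w'] Cons by (auto simp: mono_def)
    qed (simp add: fa_mult_Nil, simp add: mono_def)
  qed simp
qed

text \<open>The genuine elements of the free algebra. The ideal consists of finite sums, so it
  absorbs products with these and not with arbitrary coefficient functions.\<close>

definition fin_fa :: "nat \<Rightarrow> fa set" where
  "fin_fa n = {x. finite {w. x w \<noteq> 0} \<and> (\<forall>w. x w \<noteq> 0 \<longrightarrow> set w \<subseteq> letters n)}"

lemma fin_fa_zero [simp]: "fa_zero \<in> fin_fa n"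
  and fin_fa_mono [simp]: "set w \<subseteq> letters n \<Longrightarrow> mono w \<in> fin_fa n"
  and fin_fa_scal [simp]: "x \<in> fin_fa n \<Longrightarrow> fa_scal c x \<in> fin_fa n"
  by (auto simp: fin_fa_def fa_zero_def mono_def fa_scal_def)

lemma fin_fa_add [simp]: "x \<in> fin_fa n \<Longrightarrow> y \<in> fin_fa n \<Longrightarrow> fa_add x y \<in> fin_fa n"
  and fin_fa_diff [simp]: "x \<in> fin_fa n \<Longrightarrow> y \<in> fin_fa n \<Longrightarrow> fa_diff x y \<in> fin_fa n"
proof -
  assume a: "x \<in> fin_fa n" "y \<in> fin_fa n"
  have "{w. x w + y w \<noteq> 0} \<subseteq> {w. x w \<noteq> 0} \<union> {w. y w \<noteq> 0}"
    "{w. x w - y w \<noteq> 0} \<subseteq> {w. x w \<noteq> 0} \<union> {w. y w \<noteq> 0}" by auto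
  with a show "fa_add x y \<in> fin_fa n" "fa_diff x y \<in> fin_fa n"
    unfolding fin_fa_def fa_add_def fa_diff_def by (auto intro: finite_subset) fastforce+
qed

lemma fin_fa_mult [simp]: assumes "x \<in> fin_fa n" "y \<in> fin_fa n" shows "fa_mult x y \<in> fin_fa n"
proof -
  have sub: "{w. fa_mult x y w \<noteq> 0} \<subseteq> (\<lambda>(u, v). u @ v) ` ({u. x u \<noteq> 0} \<times> {v. y v \<noteq> 0})"
  proof
    fix w assume "w \<in> {w. fa_mult x y w \<noteq> 0}"
    then obtain k where "x (take k w) * y (drop k w) \<noteq> 0"
      unfolding fa_mult_def by (auto elim: sum.not_neutral_contains_not_neutral)
    then have "(take k w, drop k w) \<in> {u. x u \<noteq> 0} \<times> {v. y v \<noteq> 0}" by auto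
    then show "w \<in> (\<lambda>(u, v). u @ v) ` ({u. x u \<noteq> 0} \<times> {v. y v \<noteq> 0})" by (rule rev_image_eqI) simp
  qed
  then have "finite {w. fa_mult x y w \<noteq> 0}" using assms by (auto simp: fin_fa_def intro: finite_subset)
  moreover have "set w \<subseteq> letters n" if "fa_mult x y w \<noteq> 0" for w
    using sub that assms unfolding fin_fa_def by fastforce
  ultimately show ?thesis by (simp add: fin_fa_def)
qed

lemma fin_fa_induct [consumes 1, case_names zero add]:
  assumes "x \<in> fin_fa n" "P fa_zero"
    and add: "\<And>y c w. P y \<Longrightarrow> set w \<subseteq> letters n \<Longrightarrow> P (fa_add y (fa_scal c (mono w)))"
  shows "P x"
proof -
  have "finite S \<Longrightarrow> {w. x w \<noteq> 0} = S \<Longrightarrow> x \<in> fin_fa n \<Longrightarrow> P x" for S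
  proof (induction S arbitrary: x rule: finite_induct)
    case empty
    then have "x = fa_zero" by (auto simp: fa_zero_def)
    with assms(2) show ?case by simp
  next
    case (insert w S)
    define y where "y = x(w := 0)"
    have "{w. y w \<noteq> 0} = S" using insert by (auto simp: y_def)
    moreover have "y \<in> fin_fa n" using insert(1) calculation insert(5) by (auto simp: fin_fa_def y_def)
    ultimately have "P y" using insert by blast
    moreover have "x = fa_add y (fa_scal (x w) (mono w))"
      by (auto simp: y_def fa_add_def fa_scal_def mono_def)
    moreover have "set w \<subseteq> letters n" using insert(4,5) by (auto simp: fin_fa_def)
    ultimately show ?case using add by metis
  qed
  then show ?thesis using assms(1) by (auto simp: fin_fa_def)
qed

section \<open>Congruence modulo the Hecke ideal\<close>

context simply_laced begin

abbreviation I :: "fa set" where "I \<equiv> hecke_ideal n adj"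
abbreviation heqv :: "fa \<Rightarrow> fa \<Rightarrow> bool" (infix "\<approx>" 50) where "x \<approx> y \<equiv> heq n adj x y"

lemma ideal_add: "y \<in> I \<Longrightarrow> x \<in> I \<Longrightarrow> fa_add x y \<in> I"
proof (induction rule: hecke_ideal.induct)
  case zero
  then show ?case by (simp add: fa_add_def fa_zero_def)
next
  case (step y r u v c)
  have "fa_add x (fa_add y t) = fa_add (fa_add x y) t" for t by (auto simp: fa_add_def)
  then show ?case using step hecke_ideal.step by metis
qed

lemma ideal_scal: "x \<in> I \<Longrightarrow> fa_scal c x \<in> I"
proof (induction rule: hecke_ideal.induct)
  case zero
  have "fa_scal c fa_zero = fa_zero" by (auto simp: fa_scal_def fa_zero_def)
  then show ?case by (simp add: hecke_ideal.zero)
next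
  case (step x r u v d)
  have "fa_scal c (fa_add x (fa_scal d t)) = fa_add (fa_scal c x) (fa_scal (c * d) t)" for t
    by (auto simp: fa_scal_def fa_add_def algebra_simps)
  then show ?case using step hecke_ideal.step by metis
qed

lemma ideal_diff: assumes "x \<in> I" "y \<in> I" shows "fa_diff x y \<in> I"
proof -
  have "fa_diff x y = fa_add x (fa_scal (-1) y)" by (auto simp: fa_diff_def fa_add_def fa_scal_def)
  then show ?thesis using assms ideal_add ideal_scal by metis
qed

lemma ideal_gen:
  assumes "r \<in> hecke_rels n adj" "set u \<subseteq> letters n" "set v \<subseteq> letters n"
  shows "fa_mult (fa_mult (mono u) r) (mono v) \<in> I"
proof -
  have "fa_add fa_zero (fa_scal 1 x) = x" for x by (auto simp: fa_add_def fa_scal_def fa_zero_def)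
  then show ?thesis using hecke_ideal.step[OF hecke_ideal.zero assms, of 1] by simp
qed

lemma ideal_mult_mono_left: "x \<in> I \<Longrightarrow> set w \<subseteq> letters n \<Longrightarrow> fa_mult (mono w) x \<in> I"
proof (induction rule: hecke_ideal.induct)
  case zero
  then show ?case by (simp add: hecke_ideal.zero)
next
  case (step x r u v c)
  have "fa_mult (mono w) (fa_mult (fa_mult (mono u) r) (mono v)) = fa_mult (fa_mult (mono (w @ u)) r) (mono v)"
    by (simp add: fa_mult_assoc mono_mult[symmetric])
  then show ?case using step
    by (simp add: fa_mult_add_right fa_mult_scal_right ideal_add ideal_scal ideal_gen)
qed

lemma ideal_mult_mono_right: "x \<in> I \<Longrightarrow> set w \<subseteq> letters n \<Longrightarrow> fa_mult x (mono w) \<in> I"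
proof (induction rule: hecke_ideal.induct)
  case zero
  then show ?case by (simp add: hecke_ideal.zero)
next
  case (step x r u v c)
  have "fa_mult (fa_mult (fa_mult (mono u) r) (mono v)) (mono w) = fa_mult (fa_mult (mono u) r) (mono (v @ w))"
    by (simp add: fa_mult_assoc mono_mult[symmetric])
  then show ?case using step
    by (simp add: fa_mult_add_left fa_mult_scal_left ideal_add ideal_scal ideal_gen)
qed

lemma ideal_mult_right: "y \<in> fin_fa n \<Longrightarrow> x \<in> I \<Longrightarrow> fa_mult x y \<in> I"
  by (induction rule: fin_fa_induct)
    (auto simp: fa_mult_add_right fa_mult_scal_right ideal_add ideal_scal ideal_mult_mono_right hecke_ideal.zero)

lemma sg_letters [simp]: "j < n \<Longrightarrow> sg j \<in> letters n" "j < n \<Longrightarrow> sginv j \<in> letters n"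
  by (auto simp: letters_def sg_def sginv_def)

lemma hecke_rels_fin_fa: "r \<in> hecke_rels n adj \<Longrightarrow> r \<in> fin_fa n"
  unfolding hecke_rels_def by auto

lemma ideal_fin_fa: "x \<in> I \<Longrightarrow> x \<in> fin_fa n"
  by (induction rule: hecke_ideal.induct) (auto simp: hecke_rels_fin_fa)

lemma heq_refl [simp]: "x \<approx> x"
proof -
  have "fa_diff x x = fa_zero" by (auto simp: fa_diff_def fa_zero_def)
  then show ?thesis by (simp add: heq_def hecke_ideal.zero)
qed

lemma heq_sym: assumes "x \<approx> y" shows "y \<approx> x"
proof -
  have "fa_diff y x = fa_scal (-1) (fa_diff x y)" by (auto simp: fa_diff_def fa_scal_def)
  then show ?thesis using assms ideal_scal by (simp add: heq_def)
qed

lemma heq_trans [trans]: assumes "x \<approx> y" "y \<approx> z" shows "x \<approx> z"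
proof -
  have "fa_diff x z = fa_add (fa_diff x y) (fa_diff y z)" by (auto simp: fa_diff_def fa_add_def)
  then show ?thesis using assms ideal_add by (simp add: heq_def)
qed

lemma heq_diff: assumes "x \<approx> y" "x' \<approx> y'" shows "fa_diff x x' \<approx> fa_diff y y'"
proof -
  have "fa_diff (fa_diff x x') (fa_diff y y') = fa_diff (fa_diff x y) (fa_diff x' y')"
    by (auto simp: fa_diff_def)
  then show ?thesis using assms ideal_diff by (simp add: heq_def)
qed

lemma heq_scal: assumes "x \<approx> y" shows "fa_scal c x \<approx> fa_scal c y"
proof -
  have "fa_diff (fa_scal c x) (fa_scal c y) = fa_scal c (fa_diff x y)"
    by (auto simp: fa_diff_def fa_scal_def algebra_simps)
  then show ?thesis using assms ideal_scal by (simp add: heq_def)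
qed

lemma heq_mult_left: "x \<approx> y \<Longrightarrow> set w \<subseteq> letters n \<Longrightarrow> fa_mult (mono w) x \<approx> fa_mult (mono w) y"
  unfolding heq_def fa_mult_diff_right[symmetric] by (rule ideal_mult_mono_left)

lemma heq_mult_right: "x \<approx> y \<Longrightarrow> z \<in> fin_fa n \<Longrightarrow> fa_mult x z \<approx> fa_mult y z"
  unfolding heq_def fa_mult_diff_left[symmetric] by (rule ideal_mult_right)

lemma heq_rel:
  assumes "fa_diff (mono a) (mono b) \<in> hecke_rels n adj" "set u \<subseteq> letters n" "set v \<subseteq> letters n"
  shows "mono (u @ a @ v) \<approx> mono (u @ b @ v)"
  using ideal_gen[OF assms] by (simp add: fa_mult_diff_left fa_mult_diff_right mono_mult heq_def)

lemma heq_inv: "j < n \<Longrightarrow> set u \<subseteq> letters n \<Longrightarrow> set v \<subseteq> letters n \<Longrightarrow>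
    mono (u @ [sginv j, sg j] @ v) \<approx> mono (u @ v)"
  by (rule heq_rel[where b="[]", simplified]) (auto simp: hecke_rels_def)

lemma heq_comm: "i < n \<Longrightarrow> j < n \<Longrightarrow> i \<noteq> j \<Longrightarrow> \<not> adj i j \<Longrightarrow> set u \<subseteq> letters n \<Longrightarrow> set v \<subseteq> letters n \<Longrightarrow>
    mono (u @ [sg i, sg j] @ v) \<approx> mono (u @ [sg j, sg i] @ v)"
  by (rule heq_rel) (auto simp: hecke_rels_def)

lemma heq_braid: "i < n \<Longrightarrow> j < n \<Longrightarrow> adj i j \<Longrightarrow> set u \<subseteq> letters n \<Longrightarrow> set v \<subseteq> letters n \<Longrightarrow>
    mono (u @ [sg i, sg j, sg i] @ v) \<approx> mono (u @ [sg j, sg i, sg j] @ v)"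
  by (rule heq_rel) (auto simp: hecke_rels_def)

section \<open>Conjugates of generators and membership in the subalgebra\<close>

text \<open>Commuting generators: conjugating \<open>s_i\<close> by \<open>s_j\<close> changes
  nothing.\<close>

lemma conj_far:
  assumes "i < n" "j < n" "i \<noteq> j" "\<not> adj i j" "set v \<subseteq> {..<n}"
  shows "conj_img i (j # v) \<approx> conj_img i v"
proof -
  have v: "set (map sginv (rev v)) \<subseteq> letters n" "set (map sg v) \<subseteq> letters n" using assms by auto
  have "mono ((map sginv (rev v) @ [sginv j]) @ [sg i, sg j] @ map sg v) \<approx>
      mono ((map sginv (rev v) @ [sginv j]) @ [sg j, sg i] @ map sg v)"
    using assms v by (intro heq_comm) auto
  also have "mono ((map sginv (rev v) @ [sginv j]) @ [sg j, sg i] @ map sg v) \<approx>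
      mono (map sginv (rev v) @ [sg i] @ map sg v)"
    using heq_inv[of j "map sginv (rev v)" "[sg i] @ map sg v"] assms v by auto
  finally show ?thesis by (simp add: conj_img_def)
qed

text \<open>By the braid relation \<open>s_i s_j s_i = s_j s_i s_j\<close>, conjugating
  \<open>s_i\<close> by \<open>s_j s_i\<close> yields \<open>s_j\<close>.\<close>

lemma conj_near:
  assumes "i < n" "j < n" "adj i j" "set v \<subseteq> {..<n}"
  shows "conj_img i (j # i # v) \<approx> conj_img j v"
proof -
  have v: "set (map sginv (rev v)) \<subseteq> letters n" "set (map sg v) \<subseteq> letters n" using assms by auto
  have "mono ((map sginv (rev v) @ [sginv i, sginv j]) @ [sg i, sg j, sg i] @ map sg v) \<approx>
      mono ((map sginv (rev v) @ [sginv i, sginv j]) @ [sg j, sg i, sg j] @ map sg v)"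
    using assms v by (intro heq_braid) auto
  also have "mono ((map sginv (rev v) @ [sginv i, sginv j]) @ [sg j, sg i, sg j] @ map sg v) \<approx>
      mono ((map sginv (rev v) @ [sginv i]) @ [sg i, sg j] @ map sg v)"
    using heq_inv[of j "map sginv (rev v) @ [sginv i]" "[sg i, sg j] @ map sg v"] assms v by auto
  also have "mono ((map sginv (rev v) @ [sginv i]) @ [sg i, sg j] @ map sg v) \<approx>
      mono (map sginv (rev v) @ [sg j] @ map sg v)"
    using heq_inv[of i "map sginv (rev v)" "[sg j] @ map sg v"] assms v by auto
  finally show ?thesis by (simp add: conj_img_def)
qed

abbreviation smult :: "nat \<Rightarrow> fa \<Rightarrow> fa" where "smult k x \<equiv> fa_mult (mono [sg k]) x"

lemma smult_comm:
  assumes "k < n" "l < n" "k = l \<or> \<not> adj k l" "x \<in> fin_fa n"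
  shows "smult k (smult l x) \<approx> smult l (smult k x)"
proof (cases "k = l")
  case False
  then have "mono [sg k, sg l] \<approx> mono [sg l, sg k]" using heq_comm[of k l "[]" "[]"] assms by simp
  from heq_mult_right[OF this assms(4)] show ?thesis by (simp add: fa_mult_assoc[symmetric] mono_mult)
qed simp

lemma smult_braid:
  assumes "k < n" "l < n" "adj k l" "x \<in> fin_fa n"
  shows "smult k (smult l (smult k x)) \<approx> smult l (smult k (smult l x))"
proof -
  have "mono [sg k, sg l, sg k] \<approx> mono [sg l, sg k, sg l]" using heq_braid[of k l "[]" "[]"] assms by simp
  from heq_mult_right[OF this assms(4)] show ?thesis by (simp add: fa_mult_assoc[symmetric] mono_mult)
qed

lemma smult_square:
  assumes "k < n" "x \<in> fin_fa n"
  shows "fa_add (fa_diff (smult k (smult k x)) x) (fa_scal m_ind (smult k x)) \<in> I"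
proof -
  have "fa_add (fa_diff (mono [sg k, sg k]) (mono [])) (fa_scal m_ind (mono [sg k])) \<in> I"
    using ideal_gen[of "fa_add (fa_diff (mono [sg k, sg k]) (mono [])) (fa_scal m_ind (mono [sg k]))" "[]" "[]"] assms(1)
    by (auto simp: hecke_rels_def fa_mult_add_left fa_mult_diff_left fa_mult_scal_left mono_mult)
  from ideal_mult_right[OF assms(2) this] show ?thesis
    by (simp add: fa_mult_add_left fa_mult_diff_left fa_mult_scal_left fa_mult_assoc[symmetric] mono_mult)
qed

lemma inZ_heq: "x \<approx> y \<Longrightarrow> inZ n adj C y \<Longrightarrow> inZ n adj C x"
  unfolding inZ_def using heq_trans by blast

lemma inZ_zero: "inZ n adj C fa_zero"
  unfolding inZ_def by (rule exI[of _ fa_zero]) (simp add: fa_zero_def)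

lemma inZ_mono: "k \<in> C \<Longrightarrow> inZ n adj C (mono [sg k])"
  unfolding inZ_def by (rule exI[of _ "mono [sg k]"]) (simp add: mono_def)

lemma inZ_scal: assumes "inZ n adj C x" shows "inZ n adj C (fa_scal c x)"
proof -
  obtain z where z: "finite {w. z w \<noteq> 0}" "\<forall>w. z w \<noteq> 0 \<longrightarrow> set w \<subseteq> sg ` C" "x \<approx> z"
    using assms by (auto simp: inZ_def)
  then show ?thesis unfolding inZ_def
    by (intro exI[of _ "fa_scal c z"]) (auto simp: heq_scal, auto simp: fa_scal_def)
qed

lemma inZ_diff: assumes "inZ n adj C x" "inZ n adj C y" shows "inZ n adj C (fa_diff x y)"
proof -
  obtain z where z: "finite {w. z w \<noteq> 0}" "\<forall>w. z w \<noteq> 0 \<longrightarrow> set w \<subseteq> sg ` C" "x \<approx> z"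
    using assms(1) by (auto simp: inZ_def)
  obtain z' where z': "finite {w. z' w \<noteq> 0}" "\<forall>w. z' w \<noteq> 0 \<longrightarrow> set w \<subseteq> sg ` C" "y \<approx> z'"
    using assms(2) by (auto simp: inZ_def)
  have sub: "{w. fa_diff z z' w \<noteq> 0} \<subseteq> {w. z w \<noteq> 0} \<union> {w. z' w \<noteq> 0}" by (auto simp: fa_diff_def)
  have "finite {w. fa_diff z z' w \<noteq> 0}" using sub z(1) z'(1) finite_subset by blast
  moreover have "\<forall>w. fa_diff z z' w \<noteq> 0 \<longrightarrow> set w \<subseteq> sg ` C" using sub z(2) z'(2) by blast
  ultimately show ?thesis unfolding inZ_def using heq_diff[OF z(3) z'(3)] by blast
qed

lemma inZ_smult: assumes "inZ n adj C x" "k \<in> C" "k < n" shows "inZ n adj C (smult k x)"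
proof -
  obtain z where z: "finite {w. z w \<noteq> 0}" "\<forall>w. z w \<noteq> 0 \<longrightarrow> set w \<subseteq> sg ` C" "x \<approx> z"
    using assms by (auto simp: inZ_def)
  have sub: "{w. smult k z w \<noteq> 0} \<subseteq> (\<lambda>w. sg k # w) ` {w. z w \<noteq> 0}"
  proof
    fix w assume w: "w \<in> {w. smult k z w \<noteq> 0}"
    have eq: "(\<lambda>u. mono [sg k] (a # u)) = (if a = sg k then mono [] else fa_zero)" for a
      by (auto simp: mono_def fa_zero_def)
    have m0: "mono [sg k] [] = 0" "fa_zero u = 0" for u by (simp_all add: mono_def fa_zero_def)
    show "w \<in> (\<lambda>w. sg k # w) ` {w. z w \<noteq> 0}"
      using w by (cases w) (auto simp: fa_mult_Nil fa_mult_Cons eq m0 split: if_splits)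
  qed
  have "finite {w. smult k z w \<noteq> 0}" using sub z(1) finite_subset by blast
  moreover have "\<forall>w. smult k z w \<noteq> 0 \<longrightarrow> set w \<subseteq> sg ` C" using sub z(2) assms(2) by fastforce
  ultimately show ?thesis unfolding inZ_def using heq_mult_left[OF z(3), of "[sg k]"] assms(3) by auto
qed

text \<open>\<open>inZ\<close> asks only for congruence to a finite combination, but elements of the
  ideal are themselves finite, so \<open>x\<close> is too.\<close>

lemma inZ_fin_fa: assumes "inZ n adj C x" "C \<subseteq> {..<n}" shows "x \<in> fin_fa n"
proof -
  obtain z where z: "finite {w. z w \<noteq> 0}" "\<forall>w. z w \<noteq> 0 \<longrightarrow> set w \<subseteq> sg ` C" "x \<approx> z"
    using assms(1) by (auto simp: inZ_def)
  have "sg ` C \<subseteq> letters n" using assms(2) by auto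
  then have "z \<in> fin_fa n" unfolding fin_fa_def using z(1,2) by blast
  moreover have "fa_diff x z \<in> fin_fa n" using z(3) ideal_fin_fa by (simp add: heq_def)
  moreover have "x = fa_add (fa_diff x z) z" by (auto simp: fa_add_def fa_diff_def)
  ultimately show ?thesis using fin_fa_add by metis
qed

end

subsection \<open>The operators\<close>

context admissible_orbit begin

text \<open>Every clause for words is a rewriting step of pairs read upwards; \<open>kap\<close> is
  constant along it and so is the conjugate in \<open>H\<close>. All words for \<open>(B, i)\<close>
  therefore give the same generator.\<close>

lemma inV_kap:
  "inV n adj BB below B0 B i v \<Longrightarrow>
    B \<in> BB \<and> i < n \<and> perp_to i B \<and> set v \<subseteq> {..<n} \<and> conj_img i v \<approx> mono [sg (kap B i)]"
proof (induction rule: inV.induct)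
  case (base i)
  then show ?case by (simp add: kap_B0 conj_img_def)
next
  case (nadj B i j v)
  have u: "up j B" using nadj below_act_iff by simp
  have ij: "\<not> adj i j" using nadj adj_sym by blast
  have "conj_img i (j # v) \<approx> conj_img i v" using nadj ij by (intro conj_far) auto
  moreover have "kap (act j B) i = kap B i" using nadj u by (intro kap_far) auto
  ultimately show ?case using nadj heq_trans by (metis insert_subset lessThan_iff list.simps(15))
next
  case (isadj B i j v)
  have u: "up j B" using isadj below_act_iff by simp
  have ij: "adj i j" using isadj adj_sym by blast
  have "conj_img i (j # i # v) \<approx> conj_img j v" using isadj ij by (intro conj_near) auto
  moreover have "kap (act i (act j B)) j = kap B i" using isadj u by (intro kap_near) auto
  ultimately show ?case using isadj heq_trans by (metis insert_subset lessThan_iff list.simps(15))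
qed

lemma ex_inV:
  assumes "B \<in> BB" "i < n" "perp_to i B" shows "\<exists>v. inV n adj BB below B0 B i v"
  using assms
proof (induction B arbitrary: i rule: BB_induct_up)
  case (up B)
  show ?case
  proof (cases "B = B0")
    case True
    then show ?thesis using up inV.base by blast
  next
    case False
    then obtain j where j: "j < n" "local.up j B" using ex_up up by blast
    then have b: "below B (act j B)" "j \<noteq> i" using up up_below up_not_perp by auto
    show ?thesis
    proof (cases "adj j i")
      case True
      have "\<exists>v. inV n adj BB below B0 (act i (act j B)) j v"
        using pstep_near[OF up(1,3,4) j(1) True j(2)] up(1,3) j by (intro up(2)) auto
      then obtain v where v: "inV n adj BB below B0 (act i (act j B)) j v" ..
      have "inV n adj BB below B0 B i (j # i # v)"
        by (rule inV.isadj) (use up(1,3,4) j(1) True b(1) v in simp_all)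
      then show ?thesis ..
    next
      case False
      have "\<exists>v. inV n adj BB below B0 (act j B) i v"
        using pstep_far[OF up(1,3,4) j(1) False j(2)] up(1,3) j by (intro up(2)) auto
      then obtain v where v: "inV n adj BB below B0 (act j B) i v" ..
      have "inV n adj BB below B0 B i (j # v)"
        by (rule inV.nadj) (use up(1,3,4) j(1) False b v in simp_all)
      then show ?thesis ..
    qed
  qed
qed

abbreviation C :: "nat set" where "C \<equiv> Cset n adj B0"

lemma C_lt: "C \<subseteq> {..<n}"
  by (auto simp: Cset_def)

lemma kap_C: "B \<in> BB \<Longrightarrow> i < n \<Longrightarrow> perp_to i B \<Longrightarrow> kap B i \<in> C"
  by (simp add: Cset_def kap_lt kap_perp)

lemma hB_kap:
  assumes "B \<in> BB" "i < n" "perp_to i B" shows "hB n adj BB below B0 B i \<approx> mono [sg (kap B i)]"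
  unfolding hB_def using inV_kap[OF someI_ex[OF ex_inV[OF assms]]] by blast

lemma well_defined_below: "well_defined n adj BB below B0"
proof -
  have a: "\<exists>j<n. below B (act j B)" if "B \<in> BB" "B \<noteq> B0" for B
    by (metis ex_up that up_below orth_BB)
  have b: "B \<noteq> act i B" "below B (act i B) \<or> below (act i B) B"
    if "B \<in> BB" "i < n" "fund i \<notin> B \<union> perp n adj B" for B i
  proof -
    have "moves i B" using that by (simp add: moves_iff)
    then show "B \<noteq> act i B" "below B (act i B) \<or> below (act i B) B"
      using that up_or_up_act[of B i] moves_act_neq[of B i] below_act_iff[of B i] act_below_iff[of B i]
      by auto
  qed
  have c: "inZ n adj C (conj_img i v)" if "inV n adj BB below B0 B i v" for B i v
    using inV_kap[OF that] inZ_heq inZ_mono kap_C by blast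
  have d: "conj_img i v \<approx> conj_img i v'"
    if "inV n adj BB below B0 B i v" "inV n adj BB below B0 B i v'" for B i v v'
    using inV_kap[OF that(1)] inV_kap[OF that(2)] heq_trans heq_sym by blast
  show ?thesis unfolding well_defined_def
    by (intro conjI ballI allI impI; (rule a b ex_inV c d; assumption))
qed

text \<open>The matrix of \<open>\<tau>\<^sub>i\<close> is symmetric, so the coordinates of \<open>\<tau>\<^sub>i f\<close> obey the formula
  that defines \<open>\<tau>\<^sub>i\<close> on basis vectors.\<close>

definition T :: "nat \<Rightarrow> vm \<Rightarrow> vm" where
  "T i f B = (if fund i \<in> B then fa_zero
     else if perp_to i B then smult (kap B i) (f B)
     else if up i B then fa_diff (f (act i B)) (fa_scal m_ind (f B))
     else f (act i B))"

lemma T_mem: "fund i \<in> B \<Longrightarrow> T i f B = fa_zero"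
  by (simp add: T_def)

lemma T_perp: "i < n \<Longrightarrow> perp_to i B \<Longrightarrow> T i f B = smult (kap B i) (f B)"
  by (simp add: T_def perp_not_mem)

lemma T_up: "B \<in> BB \<Longrightarrow> i < n \<Longrightarrow> up i B \<Longrightarrow> T i f B = fa_diff (f (act i B)) (fa_scal m_ind (f B))"
  by (simp add: T_def up_not_mem up_not_perp)

lemma T_down: "B \<in> BB \<Longrightarrow> i < n \<Longrightarrow> moves i B \<Longrightarrow> \<not> up i B \<Longrightarrow> T i f B = f (act i B)"
  by (simp add: T_def moves_iff)

lemma T_moves:
  "B \<in> BB \<Longrightarrow> i < n \<Longrightarrow> moves i B \<Longrightarrow>
    T i f B = (if up i B then fa_diff (f (act i B)) (fa_scal m_ind (f B)) else f (act i B))"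
  by (simp add: T_up T_down)

lemma T_act_up: assumes "B \<in> BB" "i < n" "up i B" shows "T i f (act i B) = f B"
  using T_down[of "act i B" i f] assms moves_act[OF _ _ up_moves] up_act_not_up by simp

lemma tau_coef_zero:
  assumes "B \<in> BB" "i < n" "B \<noteq> B'" "B \<noteq> act i B'"
  shows "tau_coef n adj BB below B0 i B B' = fa_zero"
proof -
  have "B' \<noteq> act i B" using assms by auto
  moreover have "fa_diff fa_zero fa_zero = fa_zero" by (simp add: fa_diff_def fa_zero_def)
  ultimately show ?thesis using assms by (simp add: tau_coef_def)
qed

text \<open>Finite support of \<open>f B\<close> is what permits replacing the chosen representative
  of \<open>h\<close> by a generator under the product.\<close>

lemma tau_apply_T:
  assumes "B \<in> BB" "i < n" "f B \<in> fin_fa n"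
  shows "tau_apply n adj BB below B0 i f B \<approx> T i f B"
proof -
  let ?c = "\<lambda>A. tau_coef n adj BB below B0 i A B"
  \<comment> \<open>Only the basis vectors of \<open>B\<close> and \<open>act i B\<close> can
    contribute to the coordinate at \<open>B\<close>.\<close>
  have eq: "tau_apply n adj BB below B0 i f B = (\<lambda>w. \<Sum>A\<in>{B, act i B}. fa_mult (?c A) (f A) w)"
  proof -
    have "(\<Sum>A\<in>BB. fa_mult (?c A) (f A) w) = (\<Sum>A\<in>{B, act i B}. fa_mult (?c A) (f A) w)" for w
    proof (rule sum.mono_neutral_right[OF finite_BB], use assms(1,2) in simp, rule ballI)
      fix A assume "A \<in> BB - {B, act i B}"
      then have "?c A = fa_zero" using assms(2) by (intro tau_coef_zero) auto
      then show "fa_mult (?c A) (f A) w = 0" by simp (simp add: fa_zero_def)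
    qed
    then show ?thesis using assms(1) by (simp add: tau_apply_def)
  qed
  have zd: "fa_diff x fa_zero = x" for x by (simp add: fa_diff_def fa_zero_def)
  show ?thesis
  proof (cases "moves i B")
    case False
    then have fixed: "act i B = B" using assms by (simp add: act_fixed)
    have "fund i \<in> B \<or> perp_to i B" using False assms by (simp add: moves_iff)
    then show ?thesis
    proof
      assume "fund i \<in> B"
      then show ?thesis unfolding eq fixed by (simp add: T_mem tau_coef_def)
    next
      assume p: "perp_to i B"
      then have "?c B = hB n adj BB below B0 B i" using perp_not_mem assms by (simp add: tau_coef_def)
      then show ?thesis unfolding eq fixed
        using heq_mult_right[OF hB_kap[OF assms(1,2) p] assms(3)] p assms by (simp add: T_perp)
    qed
  next
    case True
    have ne: "act i B \<noteq> B" "B \<noteq> act i B" using True assms moves_act_neq[of B i] by auto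
    have m': "moves i (act i B)" using True assms moves_act by simp
    have np: "fund i \<notin> B" "\<not> perp_to i B" "fund i \<notin> act i B" "\<not> perp_to i (act i B)"
      using True m' assms by (auto simp: moves_iff)
    have iff: "below B (act i B) \<longleftrightarrow> up i B" "below (act i B) B \<longleftrightarrow> \<not> up i B"
      using True assms below_act_iff[of B i] act_below_iff[of B i] up_act_iff[of B i] by auto
    have c2: "?c (act i B) = mono []" using np iff ne assms by (simp add: tau_coef_def zd)
    show ?thesis
    proof (cases "up i B")
      case up: True
      have "?c B = fa_diff fa_zero (fa_scal m_ind (mono []))" using np iff ne up by (simp add: tau_coef_def)
      then have "tau_apply n adj BB below B0 i f B = T i f B" unfolding eq
        using ne c2 assms up
        by (simp add: T_up fa_mult_diff_left fa_mult_scal_left) (simp add: fa_diff_def fa_zero_def fa_scal_def)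
      then show ?thesis by simp
    next
      case down: False
      have "?c B = fa_zero" using np iff ne down by (simp add: tau_coef_def)
      then have "tau_apply n adj BB below B0 i f B = T i f B" unfolding eq
        using ne c2 assms down True by (simp add: T_down) (simp add: fa_zero_def)
      then show ?thesis by simp
    qed
  qed
qed

definition fin_vm :: "vm \<Rightarrow> bool" where "fin_vm f \<longleftrightarrow> (\<forall>B\<in>BB. f B \<in> fin_fa n)"

lemma Vspace_fin_vm: "f \<in> Vspace n adj BB B0 \<Longrightarrow> fin_vm f"
  using inZ_fin_fa[OF _ C_lt] by (auto simp: Vspace_def fin_vm_def)

lemma tau_apply_Vspace:
  assumes "f \<in> Vspace n adj BB B0" "i < n" shows "tau_apply n adj BB below B0 i f \<in> Vspace n adj BB B0"
proof -
  have "inZ n adj C (tau_apply n adj BB below B0 i f B)" if B: "B \<in> BB" for B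
  proof (rule inZ_heq[OF tau_apply_T])
    have "inZ n adj C (f B)" "inZ n adj C (f (act i B))" using assms B by (auto simp: Vspace_def)
    then show "inZ n adj C (T i f B)"
      using assms(2) B by (auto simp: T_def inZ_zero kap_lt kap_C intro!: inZ_smult inZ_diff inZ_scal)
  qed (use assms B Vspace_fin_vm in \<open>auto simp: fin_vm_def\<close>)
  moreover have "tau_apply n adj BB below B0 i f B = fa_zero" if "B \<notin> BB" for B
    using that by (simp add: tau_apply_def)
  ultimately show ?thesis by (simp add: Vspace_def)
qed

lemma T_cong:
  assumes "veq n adj BB f g" "B \<in> BB" "i < n" shows "T i f B \<approx> T i g B"
  using assms by (auto simp: T_def veq_def kap_lt intro!: heq_mult_left heq_diff heq_scal)

lemma tau_apply_cong:
  assumes "f \<in> Vspace n adj BB B0" "g \<in> Vspace n adj BB B0" "i < n" "veq n adj BB f g"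
  shows "veq n adj BB (tau_apply n adj BB below B0 i f) (tau_apply n adj BB below B0 i g)"
  unfolding veq_def
proof
  fix B assume B: "B \<in> BB"
  have "tau_apply n adj BB below B0 i f B \<approx> T i f B" "tau_apply n adj BB below B0 i g B \<approx> T i g B"
    using assms B Vspace_fin_vm by (auto simp: fin_vm_def intro!: tau_apply_T)
  then show "tau_apply n adj BB below B0 i f B \<approx> tau_apply n adj BB below B0 i g B"
    using T_cong[OF assms(4) B assms(3)] heq_trans heq_sym by blast
qed

lemma scal_zero [simp]: "fa_scal c fa_zero = fa_zero" "fa_diff fa_zero fa_zero = fa_zero"
  by (auto simp: fa_scal_def fa_diff_def fa_zero_def)

section \<open>Commutation of operators for nonadjacent nodes\<close>

text \<open>\<open>fund i\<close> also lies in \<open>act j B\<close>, so \<open>T i f\<close>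
  vanishes at both places that \<open>T j\<close> looks at.\<close>

lemma T_mem_comm:
  assumes "B \<in> BB" "i < n" "j < n" "i \<noteq> j" "\<not> adj i j" "fund i \<in> B" shows "T j (T i f) B = fa_zero"
  using assms mem_act_nonadj[of B i j] by (auto simp: T_def[of j] T_mem)

lemma T_perp_moves_comm:
  assumes "B \<in> BB" "i < n" "j < n" "i \<noteq> j" "\<not> adj i j" "perp_to i B" "moves j B"
  shows "T i (T j f) B = T j (T i f) B"
proof -
  have p: "perp_to i (act j B)" using assms perp_act_nonadj by simp
  have k: "kap (act j B) i = kap B i" using assms adj_sym[of j i] by (intro kap_far) auto
  show ?thesis
  proof (cases "up j B")
    case True
    then show ?thesis using assms p k
      by (simp add: T_perp T_up fa_mult_diff_right fa_mult_scal_right)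
  next
    case False
    then show ?thesis using assms p k by (simp add: T_perp T_down)
  qed
qed

lemma T_comm:
  assumes B: "B \<in> BB" and ij: "i < n" "j < n" "i \<noteq> j" "\<not> adj i j" and f: "fin_vm f"
  shows "T i (T j f) B \<approx> T j (T i f) B"
proof -
  have ji: "\<not> adj j i" using ij adj_sym by blast
  consider "fund i \<in> B" | "fund j \<in> B" | "perp_to i B" "perp_to j B" | "perp_to i B" "moves j B"
    | "perp_to j B" "moves i B" | "moves i B" "moves j B"
    using B ij by (auto simp: moves_iff)
  then show ?thesis
  proof cases
    case 1
    then show ?thesis using T_mem_comm[OF B ij] by (simp add: T_mem)
  next
    case 2
    then show ?thesis using T_mem_comm[OF B ij(2,1) ij(3)[symmetric] ji] by (simp add: T_mem)
  next
    case 3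
    then show ?thesis using B ij f kap_nonadj[of B i j]
      by (auto simp: T_perp fin_vm_def kap_lt intro!: smult_comm)
  next
    case 4
    then show ?thesis using T_perp_moves_comm[of B i j f] B ij by simp
  next
    case 5
    then show ?thesis using T_perp_moves_comm[of B j i f] B ij ji by simp
  next
    case 6
    show ?thesis
    proof (cases "act i B = act j B")
      case True
      \<comment> \<open>The reflections agree on the two sets \<open>B\<close> and \<open>X\<close>
        and have the same direction, so the two operators coincide in these coordinates.\<close>
      define X where "X = act i B"
      have X: "X \<in> BB" "act i B = X" "act j B = X" "act i X = B" "act j X = B"
        unfolding X_def using True B ij by (simp, simp, metis, metis act_invol orth_BB, metis act_invol orth_BB)
      have m: "moves i X" "moves j X" using 6 B ij moves_act[of B i] moves_act[of B j] X(2,3) by auto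
      have u: "up i B \<longleftrightarrow> up j B" "up i X \<longleftrightarrow> up j X"
        using B ij X below_act_iff[of B i] below_act_iff[of B j] below_act_iff[of X i] below_act_iff[of X j] by auto
      have ev: "T k g B = (if up j B then fa_diff (g X) (fa_scal m_ind (g B)) else g X)"
        "T k g X = (if up j X then fa_diff (g B) (fa_scal m_ind (g X)) else g B)" if "k \<in> {i, j}" for k g
        using that T_moves[OF B ij(1) 6(1)] T_moves[OF B ij(2) 6(2)] T_moves[OF X(1) ij(1) m(1)]
          T_moves[OF X(1) ij(2) m(2)] X(2-5) u by auto
      show ?thesis by (simp add: ev)
    next
      case False
      \<comment> \<open>Parallel sides of the square point the same way, hence both orders of
        evaluation produce the same four terms.\<close>
      have u: "up i (act j B) \<longleftrightarrow> up i B" "up j (act i B) \<longleftrightarrow> up j B"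
        using up_comm_iff[OF B ij False] up_comm_iff[OF B ij(2,1) ij(3)[symmetric] ji] False by auto
      have m: "moves i (act j B)" "moves j (act i B)"
        using 6 B ij ji perp_act_nonadj[of B i j] perp_act_nonadj[of B j i]
          mem_act_nonadj[of "act j B" i j] mem_act_nonadj[of "act i B" j i]
        by (auto simp: moves_iff)
      have c: "act i (act j B) = act j (act i B)" using act_comm[of B i j] B ij by simp
      show ?thesis
        using 6 B ij u m c
        by (cases "up i B"; cases "up j B")
          (auto simp: T_up T_down fa_diff_def fa_scal_def algebra_simps)
    qed
  qed
qed

section \<open>Braid relations for adjacent nodes\<close>

text \<open>The relation is checked one coordinate at a time, so that each set can be treated
  according to the shape of its own rank-two orbit.\<close>

definition braided :: "nat \<Rightarrow> nat \<Rightarrow> vec set \<Rightarrow> bool" where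
  "braided i j B \<longleftrightarrow> (\<forall>f. fin_vm f \<longrightarrow> T i (T j (T i f)) B \<approx> T j (T i (T j f)) B)"

lemma braided_sym: "braided i j B \<Longrightarrow> braided j i B"
  using heq_sym by (auto simp: braided_def)

lemma sum_mem:
  assumes "B \<in> BB" "i < n" "j < n" "adj i j" "fund i + fund j \<in> B"
  shows "moves i B" "\<not> up i B" "fund j \<in> act i B"
proof -
  have ij: "fund j \<bullet> fund i = -1" "fund i \<bullet> fund j = -1" using assms ip_fund_adj adj_sym by auto
  then have "(fund i + fund j) \<bullet> fund i = 1" using assms by simp
  then show "moves i B" unfolding moves_def using assms(5) by blast
  show "\<not> up i B" using up_sum_not_mem[of B j i] assms adj_sym by (auto simp: add.commute)
  have "ref i (fund i + fund j) = fund j" using ref_lower[of "fund i + fund j" i] ij assms by simp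
  then show "fund j \<in> act i B"
    using assms absv_pos_root[OF fund_pos_root[OF assms(3)]] by (force simp: act_eq)
qed

text \<open>One side vanishes at once. On the other, the path over \<open>act j B\<close> runs
  downwards to a set containing \<open>fund j\<close>, and the remaining term vanishes because
  \<open>fund i\<close> lies in \<open>B\<close>.\<close>

lemma braided_mem:
  assumes "B \<in> BB" "i < n" "j < n" "adj i j" "fund i \<in> B" shows "braided i j B"
proof -
  have "up j B" using up_mem assms by simp
  moreover have "fund i + fund j \<in> act j B" "fund j \<in> act i (act j B)" using mem_act_act assms by auto
  moreover from this have "moves i (act j B)" "\<not> up i (act j B)" using sum_mem[of "act j B" i j] assms by auto
  ultimately have "T j (T i (T j f)) B = fa_zero" for f
    using assms by (simp add: T_up T_down T_mem)
  then show ?thesis using assms by (simp add: braided_def T_mem)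
qed

text \<open>From the peak both reflections lead down to sets in which the next operator vanishes, so
  both sides are zero.\<close>

lemma braided_sum_mem:
  assumes "B \<in> BB" "i < n" "j < n" "adj i j" "fund i + fund j \<in> B" shows "braided i j B"
proof -
  have ji: "adj j i" using assms adj_sym by blast
  show ?thesis
    using assms ji sum_mem[OF assms] sum_mem[of B j i] by (auto simp: braided_def T_down T_mem add.commute)
qed

text \<open>\<open>E\<close> is the bottom, orthogonal to \<open>fund i\<close>, and the top is
  orthogonal to \<open>fund j\<close>; by \<open>kap_near\<close> the same generator acts at both
  ends.\<close>

lemma braided_chain:
  assumes E: "E \<in> BB" "i < n" "j < n" "adj i j" "perp_to i E" "up j E"
  shows "braided i j E" "braided i j (act j E)" "braided i j (act i (act j E))"
proof -
  have ji: "adj j i" using assms adj_sym by blast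
  define M where "M = act j E"
  define F where "F = act i M"
  define k where "k = kap E i"
  have M: "M \<in> BB" "up i M" and F: "F \<in> BB" "perp_to j F"
    using pstep_near[OF E(1,2,5,3) ji E(6)] E by (auto simp: M_def F_def)
  have kF: "kap F j = k" using kap_near E ji by (simp add: F_def M_def k_def)
  have k: "k < n" using kap_lt E by (simp add: k_def)
  have ev: "T i g E = smult k (g E)" "T j g E = fa_diff (g M) (fa_scal m_ind (g E))" "T j g M = g E"
    "T i g M = fa_diff (g F) (fa_scal m_ind (g M))" "T i g F = g M" "T j g F = smult k (g F)" for g
    using E M F kF T_act_up[of E j g] T_act_up[of M i g]
    by (simp_all add: T_perp T_up k_def M_def[symmetric] F_def[symmetric])
  have "T i (T j (T i f)) E \<approx> T j (T i (T j f)) E" if "fin_vm f" for f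
  proof -
    \<comment> \<open>All terms from the middle and the top cancel. What remains at the bottom is -m
      times the quadratic relation applied to \<open>f E\<close>.\<close>
    have "fa_diff (T i (T j (T i f)) E) (T j (T i (T j f)) E) =
        fa_scal (- m_ind) (fa_add (fa_diff (smult k (smult k (f E))) (f E)) (fa_scal m_ind (smult k (f E))))"
      by (simp add: ev fa_mult_diff_right fa_mult_scal_right)
        (auto simp: fa_diff_def fa_add_def fa_scal_def algebra_simps)
    moreover have "f E \<in> fin_fa n" using that E by (simp add: fin_vm_def)
    ultimately show ?thesis using smult_square[OF k] ideal_scal by (simp add: heq_def)
  qed
  then show "braided i j E" by (simp add: braided_def)
  show "braided i j (act j E)" unfolding M_def[symmetric] braided_def
    by (simp add: ev fa_mult_diff_right fa_mult_scal_right)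
  show "braided i j (act i (act j E))" unfolding M_def[symmetric] F_def[symmetric] braided_def
    by (simp add: ev)
qed

text \<open>If \<open>j\<close> leads upwards, \<open>B\<close> is the bottom of a chain. Otherwise
  it is the top, and \<open>i\<close> must lead downwards from \<open>act j B\<close>, giving the
  same chain with the two nodes exchanged.\<close>

lemma braided_perp:
  assumes B: "B \<in> BB" "i < n" "j < n" "adj i j" "perp_to i B" "moves j B"
  shows "braided i j B" "braided i j (act j B)"
proof -
  have ji: "adj j i" using assms adj_sym by blast
  define M where "M = act j B"
  have M: "M \<in> BB" "act j M = B" using B by (auto simp: M_def)
  have "braided i j B \<and> braided i j M"
  proof (cases "up j B")
    case True
    then show ?thesis using braided_chain[OF B(1-5)] by (simp add: M_def)
  next
    case False
    then have uj: "up j M" using B up_or_up_act[of B j] by (auto simp: M_def)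
    have nu: "\<not> up i M"
      using up_hexagon[of M j i] M uj ji B up_not_perp[of B i] by auto
    have "\<not> perp_to i M"
    proof
      assume "perp_to i M"
      then have "perp_to j B"
        using perp_act_act[of B j i] perp_act_adj[of B i j] perp_act_adj[of B j i] act_fixed[of B i] perp_not_moves[of B i] B ji
        by (auto simp: M_def)
      then show False using B perp_not_moves[of B j] by simp
    qed
    moreover have "fund i \<notin> M"
    proof
      assume "fund i \<in> M"
      then have "fund i + fund j \<in> B" using mem_act_act(2)[of M i j] M B by simp
      then have "(fund i + fund j) \<bullet> fund i = 0" using B unfolding perp_iff[OF B(2)] by blast
      then show False using ip_fund_adj[of j i] ji B by simp
    qed
    ultimately have "moves i M" using M B by (simp add: moves_iff)
    then have uE: "up i (act i M)" using nu up_or_up_act[of M i] M B by auto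
    have "perp_to j (act i M)" unfolding M_def using perp_act_act B by simp
    from braided_chain[OF _ B(3,2) ji this uE] have "braided j i M" "braided j i B"
      using M B by auto
    then show ?thesis using braided_sym by blast
  qed
  then show "braided i j B" "braided i j (act j B)" by (auto simp: M_def)
qed

lemma braided_hexagon:
  assumes A: "A \<in> BB" "i < n" "j < n" "adj i j" "up i A" "up j A"
  shows "\<forall>X\<in>{A, act i A, act j A, act j (act i A), act i (act j A), act i (act j (act i A))}. braided i j X"
proof -
  have ji: "adj j i" using assms adj_sym by blast
  define a where "a = act i A"
  define b where "b = act j A"
  define c where "c = act j a"
  define d where "d = act i b"
  define e where "e = act i c"
  have BB: "a \<in> BB" "b \<in> BB" "c \<in> BB" "d \<in> BB" "e \<in> BB"
    using A by (auto simp: a_def b_def c_def d_def e_def)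
  have e': "e = act j d" using act_braid[of A i j] A by (simp add: a_def b_def c_def d_def e_def)
  have u: "up j a" "up i b" "up i c" "up j d"
    using A ji up_not_mem unfolding a_def b_def c_def d_def by (auto intro!: up_hexagon up_transfer)
  have ev: "T i g A = fa_diff (g a) (fa_scal m_ind (g A))" "T i g a = g A"
    "T j g A = fa_diff (g b) (fa_scal m_ind (g A))" "T j g b = g A"
    "T j g a = fa_diff (g c) (fa_scal m_ind (g a))" "T j g c = g a"
    "T i g b = fa_diff (g d) (fa_scal m_ind (g b))" "T i g d = g b"
    "T i g c = fa_diff (g e) (fa_scal m_ind (g c))" "T i g e = g c"
    "T j g d = fa_diff (g e) (fa_scal m_ind (g d))" "T j g e = g d" for g
    using A BB u T_act_up[of A i g] T_act_up[of A j g] T_act_up[of a j g] T_act_up[of b i g]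
      T_act_up[of c i g] T_act_up[of d j g]
    by (simp_all add: T_up a_def[symmetric] b_def[symmetric] c_def[symmetric] d_def[symmetric] e_def[symmetric] e'[symmetric])
  \<comment> \<open>No \<open>h\<close> occurs on the hexagon, so both sides are literally equal at
    all six places, not merely congruent.\<close>
  have "T i (T j (T i f)) X = T j (T i (T j f)) X" if "X \<in> {A, a, b, c, d, e}" for f X
    using that by (auto simp: ev fa_diff_def fa_scal_def algebra_simps)
  then show ?thesis
    unfolding a_def[symmetric] b_def[symmetric] c_def[symmetric] d_def[symmetric] e_def[symmetric]
    by (simp add: braided_def)
qed

lemma moves_transfer:
  assumes "B \<in> BB" "i < n" "j < n" "adj i j" "moves j B" shows "moves i (act j (act i B))"
proof -
  have "\<not> perp_to i (act j (act i B))"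
    using perp_act_adj[of "act i B" i j] perp_not_moves[of B j] assms by auto
  moreover have "fund i \<notin> act j (act i B)"
    using mem_act_act(1)[of "act j (act i B)" i j] moves_not_mem[of B j] assms by auto
  ultimately show ?thesis using assms by (simp add: moves_iff)
qed

text \<open>The six sets are closed under both reflections and moved by both. From a minimal one
  both edges lead upwards, so it is the bottom required by \<open>braided_hexagon\<close>, and
  \<open>B\<close> lies on its hexagon.\<close>

lemma braided_free:
  assumes B: "B \<in> BB" "i < n" "j < n" "adj i j" "moves i B" "moves j B" "moves i (act j B)" "moves j (act i B)"
  shows "braided i j B"
proof -
  have ji: "adj j i" using assms adj_sym by blast
  define S where "S X = {X, act i X, act j X, act j (act i X), act i (act j X), act i (act j (act i X))}" for X
  have SB: "S B \<subseteq> BB" "finite (S B)" using B by (auto simp: S_def)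
  have br: "act i (act j (act i B)) = act j (act i (act j B))" using act_braid[of B i j] B by simp
  have inv: "act k (act k X) = X" if "X \<in> BB" "k < n" for k X using that by simp
  have e: "act i (act j (act i (act j B))) = act j (act i B)"
    using inv[of "act j (act i B)" i] br B by simp
  have closed: "act i X \<in> S B" "act j X \<in> S B" if "X \<in> S B" for X
    using that B(1-3) unfolding S_def by (elim insertE emptyE; simp add: br e)+
  have m: "moves i (act i B)" "moves j (act j B)" "moves j (act j (act i B))" "moves i (act i (act j B))"
    using B moves_act by simp_all
  have m2: "moves i (act j (act i B))" "moves j (act i (act j B))"
    using moves_transfer[of B i j] moves_transfer[of B j i] B ji by simp_all
  have m3: "moves i (act j (act i (act j B)))" "moves j (act j (act i (act j B)))"
    using moves_act[OF _ B(2) m2(1)] moves_act[OF _ B(3) m2(2)] B(1-3) br by simp_all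
  have mv: "moves i X" "moves j X" if "X \<in> S B" for X
    using that unfolding S_def by (elim insertE emptyE; simp add: B br m m2 m3)+
  have asym: "asymp_on (S B) below" using below_trans below_irrefl by (auto intro!: asymp_onI)
  have tr: "transp_on (S B) below" using below_trans by (auto intro!: transp_onI)
  have "S B \<noteq> {}" by (simp add: S_def)
  then obtain A where A: "A \<in> S B" "\<And>X. X \<in> S B \<Longrightarrow> X \<noteq> A \<Longrightarrow> \<not> below X A"
    using Finite_Set.bex_min_element[OF SB(2) asym tr] by metis
  have ABB: "A \<in> BB" using A SB by blast
  have up: "up k A" if "k < n" "moves k A" "act k A \<in> S B" for k
  proof (rule ccontr)
    assume "\<not> up k A"
    then have "up k (act k A)" using up_or_up_act[of A k] that ABB by auto
    then have "below (act k A) A" using act_below_iff that ABB by simp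
    then show False using A(2)[OF that(3)] below_irrefl by metis
  qed
  have "up i A" "up j A" using up mv[OF A(1)] closed[OF A(1)] B by auto
  from braided_hexagon[OF ABB B(2-4) this] have "\<forall>X\<in>S A. braided i j X" by (simp add: S_def)
  moreover have "B \<in> S A"
    using A(1) B(1-3) unfolding S_def by (elim insertE emptyE; simp)
  ultimately show ?thesis by blast
qed

text \<open>The cases ask which of \<open>fund i\<close>, \<open>fund j\<close>,
  \<open>fund i + fund j\<close> lies in \<open>B\<close> or is orthogonal to it. Orthogonality to
  the sum, with \<open>B\<close> moved by \<open>i\<close>, makes \<open>B\<close> the middle of a
  chain; if none of this happens, the orbit is free in the sense of
  \<open>braided_free\<close>.\<close>

lemma braided:
  assumes B: "B \<in> BB" "i < n" "j < n" "adj i j" shows "braided i j B"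
proof -
  have ji: "adj j i" using assms adj_sym by blast
  consider "fund i \<in> B" | "fund j \<in> B" | "fund i + fund j \<in> B" | "perp_to i B" "perp_to j B"
    | "perp_to i B" "moves j B" | "perp_to j B" "moves i B"
    | "moves i B" "perp_to j (act i B)"
    | "moves i B" "moves j B" "\<not> perp_to j (act i B)" "fund i + fund j \<notin> B"
    using B by (auto simp: moves_iff)
  then show ?thesis
  proof cases
    case 1
    then show ?thesis using braided_mem B by blast
  next
    case 2
    then show ?thesis using braided_mem braided_sym B ji by blast
  next
    case 3
    then show ?thesis using braided_sum_mem B by blast
  next
    case 4
    then show ?thesis using B kap_adj[of B i j]
      by (auto simp: braided_def T_perp fin_vm_def kap_lt intro!: smult_braid)
  next
    case 5
    then show ?thesis using braided_perp B by blast
  next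
    case 6
    then show ?thesis using braided_perp braided_sym B ji by blast
  next
    case 7
    then have "moves i (act i B)" using B moves_act by simp
    then have "braided j i (act i (act i B))" using braided_perp(2)[OF _ B(3,2) ji 7(2)] B by simp
    then show ?thesis using braided_sym B by simp
  next
    case 8
    have "fund j \<notin> act i B" using mem_act_act(2)[of "act i B" j i] 8 B ji by (auto simp: add.commute)
    moreover have "fund i \<notin> act j B" using mem_act_act(2)[of "act j B" i j] 8 B by auto
    moreover have "\<not> perp_to i (act j B)" using perp_act_adj[of B i j] 8 B by auto
    ultimately have "moves i (act j B)" "moves j (act i B)" using 8 B by (auto simp: moves_iff)
    then show ?thesis using braided_free 8 B by blast
  qed
qed

section \<open>From coordinates to the action of the Artin monoid\<close>

abbreviation tau :: "nat \<Rightarrow> vm \<Rightarrow> vm" where "tau \<equiv> tau_apply n adj BB below B0"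
abbreviation tauw :: "nat list \<Rightarrow> vm \<Rightarrow> vm" where "tauw \<equiv> tau_word n adj BB below B0"
abbreviation Vs :: "vm set" where "Vs \<equiv> Vspace n adj BB B0"

lemma veq_refl: "veq n adj BB f f"
  by (simp add: veq_def)

lemma veq_sym: "veq n adj BB f g \<Longrightarrow> veq n adj BB g f"
  unfolding veq_def by (blast intro: heq_sym)

lemma veq_trans: "veq n adj BB f g \<Longrightarrow> veq n adj BB g h \<Longrightarrow> veq n adj BB f h"
  unfolding veq_def by (blast intro: heq_trans)

lemma veq_tau_T: "fin_vm f \<Longrightarrow> i < n \<Longrightarrow> veq n adj BB (tau i f) (T i f)"
  by (auto simp: veq_def fin_vm_def tau_apply_T)

lemma veq_tau_T_step:
  assumes "f \<in> Vs" "veq n adj BB f g" "i < n" shows "veq n adj BB (tau i f) (T i g)"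
proof -
  have "veq n adj BB (T i f) (T i g)" using T_cong assms by (simp add: veq_def)
  then show ?thesis using veq_tau_T[OF Vspace_fin_vm] assms veq_trans by blast
qed

lemma tauw_append: "tauw (u @ v) f = tauw u (tauw v f)"
  by (induction u) auto

lemma tauw_Vspace: "set u \<subseteq> {..<n} \<Longrightarrow> f \<in> Vs \<Longrightarrow> tauw u f \<in> Vs"
  by (induction u) (auto simp: tau_apply_Vspace)

lemma tauw_cong:
  "set u \<subseteq> {..<n} \<Longrightarrow> f \<in> Vs \<Longrightarrow> g \<in> Vs \<Longrightarrow> veq n adj BB f g \<Longrightarrow> veq n adj BB (tauw u f) (tauw u g)"
  by (induction u) (auto intro!: tau_apply_cong tauw_Vspace)

lemma tau_comm:
  assumes "f \<in> Vs" "i < n" "j < n" "i \<noteq> j" "\<not> adj i j"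
  shows "veq n adj BB (tauw [i, j] f) (tauw [j, i] f)"
proof -
  have "veq n adj BB (tauw [i, j] f) (T i (T j f))" "veq n adj BB (tauw [j, i] f) (T j (T i f))"
    using assms by (auto intro!: veq_tau_T_step veq_refl tau_apply_Vspace)
  moreover have "veq n adj BB (T i (T j f)) (T j (T i f))"
    using T_comm[OF _ assms(2-5) Vspace_fin_vm[OF assms(1)]] by (simp add: veq_def)
  ultimately show ?thesis using veq_trans veq_sym by blast
qed

lemma tau_braid:
  assumes "f \<in> Vs" "i < n" "j < n" "adj i j"
  shows "veq n adj BB (tauw [i, j, i] f) (tauw [j, i, j] f)"
proof -
  have "veq n adj BB (tauw [i, j, i] f) (T i (T j (T i f)))" "veq n adj BB (tauw [j, i, j] f) (T j (T i (T j f)))"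
    using assms by (auto intro!: veq_tau_T_step veq_refl tau_apply_Vspace)
  moreover have "veq n adj BB (T i (T j (T i f))) (T j (T i (T j f)))"
    using braided[OF _ assms(2-4)] Vspace_fin_vm[OF assms(1)] by (simp add: veq_def braided_def)
  ultimately show ?thesis using veq_trans veq_sym by blast
qed

text \<open>Guarantees that the intermediate word in a transitivity step uses only nodes of the
  diagram, for which nothing is assumed directly.\<close>

lemma artin_eq_set: "artin_eq n adj u v \<Longrightarrow> set u = set v"
  by (induction rule: artin_eq.induct) auto

lemma tauw_artin_eq:
  "artin_eq n adj u w \<Longrightarrow> set u \<subseteq> {..<n} \<Longrightarrow> f \<in> Vs \<Longrightarrow> veq n adj BB (tauw u f) (tauw w f)"
proof (induction arbitrary: f rule: artin_eq.induct)
  case (refl u)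
  then show ?case by (simp add: veq_refl)
next
  case (sym u v)
  then show ?case using artin_eq_set veq_sym by metis
next
  case (trans u v w)
  then show ?case using artin_eq_set veq_trans by metis
next
  case (braid i j u v)
  have v: "tauw v f \<in> Vs" using braid by (auto intro!: tauw_Vspace)
  have "veq n adj BB (tauw u (tauw [i, j, i] (tauw v f))) (tauw u (tauw [j, i, j] (tauw v f)))"
    using braid v tau_braid[OF v] by (intro tauw_cong tauw_Vspace) auto
  then show ?case by (simp only: tauw_append)
next
  case (comm i j u v)
  have v: "tauw v f \<in> Vs" using comm by (auto intro!: tauw_Vspace)
  have "veq n adj BB (tauw u (tauw [i, j] (tauw v f))) (tauw u (tauw [j, i] (tauw v f)))"
    using comm v tau_comm[OF v] by (intro tauw_cong tauw_Vspace) auto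
  then show ?case by (simp only: tauw_append)
qed

lemma extends_below: "extends_to_artin_hom n adj BB below B0"
  unfolding extends_to_artin_hom_def using tau_apply_Vspace tauw_artin_eq by blast

lemma strict_po_below: "strict_po_on BB below"
  unfolding strict_po_on_def using below_irrefl below_trans by blast

lemma rise_below: "rise\<^sup>*\<^sup>* B B' \<Longrightarrow> B = B' \<or> below B B'"
  by (induction rule: rtranclp_induct) (auto elim!: rise.cases dest: up_below[OF orth_BB] intro: below_trans)

lemma unique_max_below: "unique_max BB below B0"
proof -
  have "below B B0" if "B \<in> BB" "B \<noteq> B0" for B using rise_below rise_B0 that by blast
  then show ?thesis unfolding unique_max_def using below_trans below_irrefl by (metis B0_BB)
qed

end

theorem theorem1p1:
  fixes n :: nat and adj :: "nat \<Rightarrow> nat \<Rightarrow> bool" and BB :: "vec set set"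
  assumes "spherical_simply_laced n adj"
    and "admissible n adj BB"
  shows "\<exists>lt B0. strict_po_on BB lt \<and> unique_max BB lt B0 \<and>
           well_defined n adj BB lt B0 \<and> extends_to_artin_hom n adj BB lt B0"
proof -
  interpret admissible_orbit n adj BB
    by unfold_locales (use assms in auto)
  show ?thesis
    using strict_po_below unique_max_below well_defined_below extends_below by blast
qed

end
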